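(* Let $M$ be a smooth manifold, let $H:T^*M\to\mathbb{R}$ be a smooth Hamiltonian and let $\Sigma\subset T^*M$ be a subset which is contained in a countable union of manifolds of positive codimension which are transversal to the vertical. Then there exists an $F_\sigma$ with empty interior $\mathcal{F}\subset C^\infty(M)$ such that, for each $u\in C^\infty(M)\setminus\mathcal{F}$, the Hamiltonian system $H+u$ has the following property: For each orbit $\theta$ of $H+u$, and each time $t_0$ such that $\partial_pH(\theta(t_0))\neq0$, there exist times $t$, arbitrarily close to $t_0$, such that $\theta(t)\notin\Sigma$.
   Context: A function $u\in C^\infty(M)$ (a potential) is identified with the function $u\circ\pi$ on $T^*M$, where $\pi:T^*M\to M$ is the projection, so that $H+u$ is a Hamiltonian on $T^*M$. $C^\infty(M)$ carries its usual separable Fréchet topology. An $F_\sigma$ is a countable union of closed sets. The vertical is the kernel of $d\pi$, i.e. the tangent spaces to the fibers of $T^*M$; a submanifold $N\subset T^*M$ is transversal to the vertical if $T_xN+\ker d\pi_x=T_x(T^*M)$ for every $x\in N$. $\partial_pH$ denotes the derivative of $H$ along the fibers. *)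

theory Defs
  imports "HOL-Analysis.Analysis"
begin

section \<open>Smooth maps between open subsets of normed spaces\<close>

primrec k_smooth_on ::
  "nat \<Rightarrow> 'a set \<Rightarrow> ('a::real_normed_vector \<Rightarrow> 'b::real_normed_vector) \<Rightarrow> bool" where
  "k_smooth_on 0 S f \<longleftrightarrow> continuous_on S f"
| "k_smooth_on (Suc k) S f \<longleftrightarrow>
     (\<forall>x\<in>S. f differentiable (at x)) \<and>
     (\<forall>v. k_smooth_on k S (\<lambda>x. frechet_derivative f (at x) v))"

text \<open>Only meant for open \<open>S\<close>.\<close>

definition smooth_on ::
  "'a set \<Rightarrow> ('a::real_normed_vector \<Rightarrow> 'b::real_normed_vector) \<Rightarrow> bool" where
  "smooth_on S f \<longleftrightarrow> (\<forall>k. k_smooth_on k S f)"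

primrec iter_deriv ::
  "'a list \<Rightarrow> ('a::real_normed_vector \<Rightarrow> 'b::real_normed_vector) \<Rightarrow> 'a \<Rightarrow> 'b" where
  "iter_deriv [] f = f"
| "iter_deriv (b # bs) f = (\<lambda>x. frechet_derivative (iter_deriv bs f) (at x) b)"


section \<open>Smooth manifolds\<close>

text \<open>A chart is a pair of a domain and a map. The values of the map outside of the domain are
  irrelevant. The smooth structure is the one determined by an atlas, which need not be maximal.\<close>

type_synonym ('m, 'e) chart = "'m set \<times> ('m \<Rightarrow> 'e)"

abbreviation cdom :: "('m, 'e) chart \<Rightarrow> 'm set" where "cdom \<equiv> fst"
abbreviation cmap :: "('m, 'e) chart \<Rightarrow> 'm \<Rightarrow> 'e" where "cmap \<equiv> snd"

definition cimg :: "('m, 'e) chart \<Rightarrow> 'e set" where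
  "cimg c = cmap c ` cdom c"

definition cinv :: "('m, 'e) chart \<Rightarrow> 'e \<Rightarrow> 'm" where
  "cinv c = inv_into (cdom c) (cmap c)"

definition carrier_of :: "('m, 'e) chart set \<Rightarrow> 'm set" where
  "carrier_of A = (\<Union>c\<in>A. cdom c)"

definition charts_at :: "('m, 'e) chart set \<Rightarrow> 'm \<Rightarrow> ('m, 'e) chart set" where
  "charts_at A x = {c \<in> A. x \<in> cdom c}"

definition smooth_transition ::
  "('m, 'e::euclidean_space) chart \<Rightarrow> ('m, 'e) chart \<Rightarrow> bool" where
  "smooth_transition c d \<longleftrightarrow>
     open (cmap c ` (cdom c \<inter> cdom d)) \<and>
     smooth_on (cmap c ` (cdom c \<inter> cdom d)) (cmap d \<circ> cinv c)"

definition second_countable :: "'m topology \<Rightarrow> bool" where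
  "second_countable X \<longleftrightarrow>
     (\<exists>\<B>. countable \<B> \<and> (\<forall>B\<in>\<B>. openin X B) \<and>
          (\<forall>U x. openin X U \<and> x \<in> U \<longrightarrow> (\<exists>B\<in>\<B>. x \<in> B \<and> B \<subseteq> U)))"

definition smooth_manifold ::
  "'m topology \<Rightarrow> ('m, 'e::euclidean_space) chart set \<Rightarrow> bool" where
  "smooth_manifold M A \<longleftrightarrow>
     Hausdorff_space M \<and> second_countable M \<and>
     carrier_of A = topspace M \<and>
     (\<forall>c\<in>A. openin M (cdom c) \<and> open (cimg c) \<and>
        homeomorphic_map (subtopology M (cdom c)) (top_of_set (cimg c)) (cmap c)) \<and>
     (\<forall>c\<in>A. \<forall>d\<in>A. smooth_transition c d)"

text \<open>Openness of the sets below, over all pairs of charts, amounts to continuity of \<open>f\<close>.\<close>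

definition smooth_map ::
  "('m, 'e::euclidean_space) chart set \<Rightarrow> ('n, 'f::euclidean_space) chart set \<Rightarrow>
   ('m \<Rightarrow> 'n) \<Rightarrow> bool" where
  "smooth_map A B f \<longleftrightarrow>
     f ` carrier_of A \<subseteq> carrier_of B \<and>
     (\<forall>c\<in>A. \<forall>d\<in>B.
        open (cmap c ` {x \<in> cdom c. f x \<in> cdom d}) \<and>
        smooth_on (cmap c ` {x \<in> cdom c. f x \<in> cdom d}) (cmap d \<circ> f \<circ> cinv c))"

definition std_atlas :: "'e set \<Rightarrow> ('e, 'e) chart set" where
  "std_atlas S = {(S, \<lambda>x. x)}"


section \<open>The space of potentials\<close>

definition smooth_functions :: "('m, 'e::euclidean_space) chart set \<Rightarrow> ('m \<Rightarrow> real) set" where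
  "smooth_functions A =
     {u \<in> extensional (carrier_of A). smooth_map A (std_atlas UNIV) u}"

text \<open>The topology of uniform convergence of all partial derivatives on compact subsets of the
  charts. It is generated by the balls of the seminorms
  \<open>u \<mapsto> sup\<^bsub>K\<^esub> |\<partial>\<^bsub>bs\<^esub> (u \<circ> c\<^sup>-\<^sup>1)|\<close>. The whole space is inserted for the case of the empty atlas.\<close>

definition smooth_functions_topology ::
  "('m, 'e::euclidean_space) chart set \<Rightarrow> ('m \<Rightarrow> real) topology" where
  "smooth_functions_topology A = topology_generated_by
     (insert (smooth_functions A)
       {{u \<in> smooth_functions A.
          \<forall>y\<in>K. \<bar>iter_deriv bs (u \<circ> cinv c) y - iter_deriv bs (u\<^sub>0 \<circ> cinv c) y\<bar> < \<epsilon>}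
        | c K bs u\<^sub>0 \<epsilon>. c \<in> A \<and> compact K \<and> K \<subseteq> cimg c \<and> set bs \<subseteq> Basis \<and>
            u\<^sub>0 \<in> smooth_functions A \<and> 0 < \<epsilon>})"


section \<open>Tangent vectors\<close>

text \<open>A tangent vector at \<open>x\<close> is the family of its coordinate vectors in all charts at \<open>x\<close>,
  which transform by the derivatives of the transition maps. Vector operations are pointwise.\<close>

definition tangent_space ::
  "('m, 'e::euclidean_space) chart set \<Rightarrow> 'm \<Rightarrow> (('m, 'e) chart \<Rightarrow> 'e) set" where
  "tangent_space A x =
     {v. (\<forall>c. c \<notin> charts_at A x \<longrightarrow> v c = 0) \<and>
         (\<forall>c\<in>charts_at A x. \<forall>d\<in>charts_at A x.
            v d = frechet_derivative (cmap d \<circ> cinv c) (at (cmap c x)) (v c))}"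

definition coord_vector ::
  "('m, 'e::euclidean_space) chart set \<Rightarrow> 'm \<Rightarrow> ('m, 'e) chart \<Rightarrow> 'e \<Rightarrow>
   (('m, 'e) chart \<Rightarrow> 'e)" where
  "coord_vector A x c w =
     (\<lambda>d. if d \<in> charts_at A x
          then frechet_derivative (cmap d \<circ> cinv c) (at (cmap c x)) w else 0)"

text \<open>The tangent map at \<open>x\<close> of a smooth map \<open>f\<close>; the result does not depend on the
  chosen chart.\<close>

definition differential_at ::
  "('m, 'e::euclidean_space) chart set \<Rightarrow> ('n, 'f::euclidean_space) chart set \<Rightarrow>
   ('m \<Rightarrow> 'n) \<Rightarrow> 'm \<Rightarrow> (('m, 'e) chart \<Rightarrow> 'e) \<Rightarrow> (('n, 'f) chart \<Rightarrow> 'f)" where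
  "differential_at A B f x v =
     (\<lambda>d. if d \<in> charts_at B (f x)
          then (let c = (SOME c. c \<in> charts_at A x) in
                frechet_derivative (cmap d \<circ> f \<circ> cinv c) (at (cmap c x)) (v c))
          else 0)"

definition velocity ::
  "('m, 'e::euclidean_space) chart set \<Rightarrow> (real \<Rightarrow> 'm) \<Rightarrow> real \<Rightarrow> (('m, 'e) chart \<Rightarrow> 'e)" where
  "velocity A \<gamma> t =
     (\<lambda>c. if c \<in> charts_at A (\<gamma> t) then vector_derivative (cmap c \<circ> \<gamma>) (at t) else 0)"


section \<open>Submanifolds\<close>

definition admissible_chart ::
  "('m, 'e::euclidean_space) chart set \<Rightarrow> ('m, 'e) chart \<Rightarrow> bool" where
  "admissible_chart A c \<longleftrightarrow>
     cdom c \<subseteq> carrier_of A \<and> inj_on (cmap c) (cdom c) \<and> open (cimg c) \<and>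
     (\<forall>d\<in>A. smooth_transition c d \<and> smooth_transition d c)"

definition submanifold ::
  "('m, 'e::euclidean_space) chart set \<Rightarrow> nat \<Rightarrow> 'm set \<Rightarrow> bool" where
  "submanifold A k N \<longleftrightarrow>
     N \<subseteq> carrier_of A \<and>
     (\<forall>x\<in>N. \<exists>c S. admissible_chart A c \<and> x \<in> cdom c \<and> subspace S \<and> dim S = k \<and>
        cmap c ` (N \<inter> cdom c) = cimg c \<inter> S)"

definition submanifold_tangent_space ::
  "('m, 'e::euclidean_space) chart set \<Rightarrow> 'm set \<Rightarrow> 'm \<Rightarrow> (('m, 'e) chart \<Rightarrow> 'e) set" where
  "submanifold_tangent_space A N x =
     {velocity A \<gamma> 0 | \<gamma> \<epsilon>. \<epsilon> > 0 \<and> smooth_map (std_atlas {-\<epsilon><..<\<epsilon>}) A \<gamma> \<and>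
        \<gamma> ` {-\<epsilon><..<\<epsilon>} \<subseteq> N \<and> \<gamma> 0 = x}"


section \<open>The cotangent bundle\<close>

text \<open>Covectors are set to \<open>0\<close> outside of the tangent space, so that the vector operations of
  the cotangent space are the pointwise ones.\<close>

type_synonym ('m, 'e) covector = "(('m, 'e) chart \<Rightarrow> 'e) \<Rightarrow> real"

definition cotangent_space ::
  "('m, 'e::euclidean_space) chart set \<Rightarrow> 'm \<Rightarrow> ('m, 'e) covector set" where
  "cotangent_space A x =
     {\<xi>. (\<forall>v\<in>tangent_space A x. \<forall>w\<in>tangent_space A x. \<forall>a b.
            \<xi> (\<lambda>c. a *\<^sub>R v c + b *\<^sub>R w c) = a * \<xi> v + b * \<xi> w) \<and>
         (\<forall>v. v \<notin> tangent_space A x \<longrightarrow> \<xi> v = 0)}"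

definition cotangent_bundle ::
  "('m, 'e::euclidean_space) chart set \<Rightarrow> ('m \<times> ('m, 'e) covector) set" where
  "cotangent_bundle A = Sigma (carrier_of A) (cotangent_space A)"

text \<open>Canonical coordinates \<open>(q, p)\<close>, where \<open>p\<close> has components \<open>p\<^sub>b = \<xi> (\<partial>/\<partial>q\<^sub>b)\<close>.\<close>

definition cotangent_chart ::
  "('m, 'e::euclidean_space) chart set \<Rightarrow> ('m, 'e) chart \<Rightarrow>
   ('m \<times> ('m, 'e) covector, 'e \<times> 'e) chart" where
  "cotangent_chart A c =
     ({z \<in> cotangent_bundle A. fst z \<in> cdom c},
      \<lambda>(x, \<xi>). (cmap c x, \<Sum>b\<in>Basis. \<xi> (coord_vector A x c b) *\<^sub>R b))"

definition cotangent_atlas ::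
  "('m, 'e::euclidean_space) chart set \<Rightarrow> ('m \<times> ('m, 'e) covector, 'e \<times> 'e) chart set" where
  "cotangent_atlas A = cotangent_chart A ` A"

definition vertical_space ::
  "('m, 'e::euclidean_space) chart set \<Rightarrow> 'm \<times> ('m, 'e) covector \<Rightarrow>
   (('m \<times> ('m, 'e) covector, 'e \<times> 'e) chart \<Rightarrow> 'e \<times> 'e) set" where
  "vertical_space A z =
     {v \<in> tangent_space (cotangent_atlas A) z.
        differential_at (cotangent_atlas A) A fst z v = (\<lambda>_. 0)}"

definition transversal_to_vertical ::
  "('m, 'e::euclidean_space) chart set \<Rightarrow> ('m \<times> ('m, 'e) covector) set \<Rightarrow> bool" where
  "transversal_to_vertical A N \<longleftrightarrow>
     (\<forall>z\<in>N. {\<lambda>c. v c + w c | v w. v \<in> submanifold_tangent_space (cotangent_atlas A) N z \<and>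
                w \<in> vertical_space A z} = tangent_space (cotangent_atlas A) z)"


section \<open>Hamiltonian systems\<close>

definition fiber_derivative ::
  "('m \<times> ('m, 'e::euclidean_space) covector \<Rightarrow> real) \<Rightarrow> 'm \<times> ('m, 'e) covector \<Rightarrow>
   ('m, 'e) covector \<Rightarrow> real" where
  "fiber_derivative H z \<eta> = deriv (\<lambda>s. H (fst z, \<lambda>v. snd z v + s * \<eta> v)) 0"

definition hamiltonian_vector :: "('e \<times> 'e \<Rightarrow> real) \<Rightarrow> 'e \<times> 'e \<Rightarrow> 'e \<times> 'e::euclidean_space" where
  "hamiltonian_vector h y =
     (\<Sum>b\<in>Basis. frechet_derivative h (at y) (0, b) *\<^sub>R b,
      - (\<Sum>b\<in>Basis. frechet_derivative h (at y) (b, 0) *\<^sub>R b))"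

text \<open>Orbits are solutions of Hamilton's equations on an open time interval, not necessarily a
  maximal one. Openness of the preimages of the charts is the continuity of the orbit.\<close>

definition hamiltonian_orbit ::
  "('m, 'e::euclidean_space) chart set \<Rightarrow> ('m \<times> ('m, 'e) covector \<Rightarrow> real) \<Rightarrow>
   real set \<Rightarrow> (real \<Rightarrow> 'm \<times> ('m, 'e) covector) \<Rightarrow> bool" where
  "hamiltonian_orbit A H I \<theta> \<longleftrightarrow>
     open I \<and> is_interval I \<and> I \<noteq> {} \<and> \<theta> ` I \<subseteq> cotangent_bundle A \<and>
     (\<forall>c\<in>cotangent_atlas A.
        open {t \<in> I. \<theta> t \<in> cdom c} \<and>
        (\<forall>t\<in>I. \<theta> t \<in> cdom c \<longrightarrow>
           (cmap c \<circ> \<theta> has_vector_derivative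
              hamiltonian_vector (H \<circ> cinv c) (cmap c (\<theta> t))) (at t)))"

end

theory Submission
  imports Defs "HOL-Complex_Analysis.Great_Picard"
begin

text \<open>By transversality, every point of \<open>N\<close> has a neighbourhood in which \<open>N\<close> lies in a hypersurface
  \<open>f = 0\<close> with \<open>\<partial>\<^sub>p f \<noteq> 0\<close>. If \<open>\<partial>\<^sub>p H \<noteq> 0\<close> there as well, choose a potential \<open>\<sigma>\<close> whose differential is
  nonzero on both vectors, and perturb \<open>u\<close> to \<open>u + P(\<sigma>)\<close> with \<open>P\<close> a polynomial. Along an orbit segment
  of the perturbed system inside \<open>f = 0\<close>, the derivative of the constraint determines \<open>P'(\<sigma>)\<close> as a
  function \<open>G\<^sub>0\<close> of the point; hence the orbit solves an equation which does not depend on \<open>P\<close>, and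
  since \<open>\<sigma>\<close> is a time parameter, all derivatives of \<open>P'\<close> at \<open>\<sigma>\<close> are functions \<open>G\<^sub>k\<close> of the point, too.
  So the coefficients of \<open>P'\<close> are a smooth function of a point of the \<open>2 n\<close>-dimensional phase space:
  if \<open>P'\<close> has \<open>2 n + 1\<close> coefficients, those for which such a segment exists form a null set. The
  potentials with an orbit segment of given duration in a given compact subset of the hypersurface
  are thus nowhere dense, and they form a closed set by the theorem of Arzela and Ascoli. Baire's
  theorem, in the space of potentials and in the time interval, reduces the claim to countably many
  such sets.\<close>

section \<open>Calculus of smooth functions\<close>

text \<open>A potential depends on q alone, so it acts on the p-component of the Hamiltonian field
  only. Hence the two conditions on \<open>\<sigma>\<close>: if its differential pairs to 0 with
  \<open>\<partial>\<^sub>p f\<close>, the constraint \<open>f = 0\<close> does not see the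
  perturbation; if it pairs to 0 with \<open>\<partial>\<^sub>p H\<close>, which is q' and which no
  potential alters, then \<open>\<sigma>\<close> stands still along the orbit. Polynomials serve
  because their coefficients are exact finite combinations of the derivatives at one point, so that
  a single interior time of a segment reveals all of \<open>P'\<close>. Duration and compact set are
  fixed for the sake of closedness: in a limit of potentials, segments could otherwise shrink to a
  point or run off the hypersurface. For the same reason the compact sets are cut out by
  \<open>f\<close> and not by the submanifolds, which may fail to be closed. An orbit which meets
  the submanifolds at all times near \<open>t\<^sub>0\<close> could still jump between countably
  many of these sets; Baire's theorem in time finds an interval on which it stays in one of
  them.\<close>

lemma k_smooth_on_subset: "k_smooth_on k T f \<Longrightarrow> S \<subseteq> T \<Longrightarrow> k_smooth_on k S f"
  by (induction k arbitrary: f) (auto intro: continuous_on_subset)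

lemma smooth_on_subset: "smooth_on T f \<Longrightarrow> S \<subseteq> T \<Longrightarrow> smooth_on S f"
  unfolding smooth_on_def using k_smooth_on_subset by blast

lemma differentiable_cong_open:
  assumes "open S" "x \<in> S" "\<And>x. x \<in> S \<Longrightarrow> f x = g x" "f differentiable (at x)"
  shows "g differentiable (at x)"
  using assms unfolding differentiable_def
  by (meson has_derivative_transform_within_open)

lemma k_smooth_on_cong:
  assumes "open S" "\<And>x. x \<in> S \<Longrightarrow> f x = g x" "k_smooth_on k S f"
  shows "k_smooth_on k S g"
  using assms(2,3)
proof (induction k arbitrary: f g)
  case 0
  then show ?case using continuous_on_cong[of S S f g] by simp
next
  case (Suc k)
  have "g differentiable (at x)" if "x \<in> S" for x
    using differentiable_cong_open[OF assms(1) that, of f g] Suc.prems that by auto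
  moreover have "k_smooth_on k S (\<lambda>x. frechet_derivative g (at x) v)" for v
  proof (rule Suc.IH)
    show "k_smooth_on k S (\<lambda>x. frechet_derivative f (at x) v)" using Suc.prems by simp
    show "frechet_derivative f (at x) v = frechet_derivative g (at x) v" if "x \<in> S" for x
      using frechet_derivative_transform_within_open[of f x S g] assms(1) that Suc.prems by auto
  qed
  ultimately show ?case by simp
qed

lemma smooth_on_cong:
  "open S \<Longrightarrow> (\<And>x. x \<in> S \<Longrightarrow> f x = g x) \<Longrightarrow> smooth_on S f \<Longrightarrow> smooth_on S g"
  unfolding smooth_on_def using k_smooth_on_cong by blast

lemma k_smooth_on_local:
  assumes "\<And>x. x \<in> S \<Longrightarrow> \<exists>T. open T \<and> x \<in> T \<and> k_smooth_on k T f"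
  shows "k_smooth_on k S f"
  using assms
proof (induction k arbitrary: f)
  case 0
  have "isCont f x" if x: "x \<in> S" for x
  proof -
    from 0[OF x] obtain T where "open T" "x \<in> T" "continuous_on T f"
      by auto
    then show ?thesis by (simp add: continuous_on_eq_continuous_at)
  qed
  then show ?case by (simp add: continuous_at_imp_continuous_on)
next
  case (Suc k)
  have "f differentiable (at x)" if x: "x \<in> S" for x
    using Suc.prems[OF x] by auto
  moreover have "k_smooth_on k S (\<lambda>x. frechet_derivative f (at x) v)" for v
  proof (rule Suc.IH)
    fix x assume "x \<in> S"
    from Suc.prems[OF this]
    show "\<exists>T. open T \<and> x \<in> T \<and> k_smooth_on k T (\<lambda>x. frechet_derivative f (at x) v)"
      by auto
  qed
  ultimately show ?case by simp
qed

lemma smooth_on_local: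
  assumes "\<And>x. x \<in> S \<Longrightarrow> \<exists>T. open T \<and> x \<in> T \<and> smooth_on T f"
  shows "smooth_on S f"
  unfolding smooth_on_def
  by (intro allI k_smooth_on_local) (use assms smooth_on_def in blast)

lemma k_smooth_on_Suc_imp: "k_smooth_on (Suc k) S f \<Longrightarrow> k_smooth_on k S f"
proof (induction k arbitrary: f)
  case 0
  then show ?case
    by (auto intro!: continuous_at_imp_continuous_on differentiable_imp_continuous_within)
next
  case (Suc k)
  then show ?case by (metis k_smooth_on.simps(2))
qed

lemma smooth_on_SucI:
  assumes "\<And>x. x \<in> S \<Longrightarrow> f differentiable (at x)"
    and "\<And>v. smooth_on S (\<lambda>x. frechet_derivative f (at x) v)"
  shows "smooth_on S f"
  unfolding smooth_on_def
proof
  fix k show "k_smooth_on k S f"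
    by (rule k_smooth_on_Suc_imp) (use assms in \<open>simp add: smooth_on_def\<close>)
qed

lemma smooth_on_differentiable: "smooth_on S f \<Longrightarrow> x \<in> S \<Longrightarrow> f differentiable (at x)"
  unfolding smooth_on_def using k_smooth_on.simps(2) by blast

lemma smooth_on_has_derivative:
  "smooth_on S f \<Longrightarrow> x \<in> S \<Longrightarrow> (f has_derivative frechet_derivative f (at x)) (at x)"
  using frechet_derivative_works smooth_on_differentiable by blast

lemma smooth_on_frechet:
  "smooth_on S f \<Longrightarrow> smooth_on S (\<lambda>x. frechet_derivative f (at x) v)"
  unfolding smooth_on_def using k_smooth_on.simps(2) by blast

lemma smooth_on_continuous: "smooth_on S f \<Longrightarrow> continuous_on S f"
  unfolding smooth_on_def using k_smooth_on.simps(1) by blast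

lemma k_smooth_on_const [simp]: "k_smooth_on k S (\<lambda>x. c)"
  by (induction k arbitrary: c) simp_all

lemma smooth_on_const [simp]: "smooth_on S (\<lambda>x. c)"
  by (simp add: smooth_on_def)

lemma frechet_derivative_bounded_linear:
  "bounded_linear L \<Longrightarrow> frechet_derivative L (at x) = L"
  by (metis bounded_linear_imp_has_derivative frechet_derivative_at)

lemma smooth_on_bounded_linear: "bounded_linear L \<Longrightarrow> smooth_on S L"
  by (rule smooth_on_SucI)
     (simp_all add: frechet_derivative_bounded_linear bounded_linear_imp_differentiable)

lemma k_smooth_on_linear_comp:
  assumes "bounded_linear L" "open S" "k_smooth_on k S f"
  shows "k_smooth_on k S (\<lambda>x. L (f x))"
  using assms(3)
proof (induction k arbitrary: f)
  case 0
  then show ?case using assms(1) by (simp add: linear_continuous_on_compose bounded_linear.continuous_on)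
next
  case (Suc k)
  have D: "((\<lambda>x. L (f x)) has_derivative (\<lambda>v. L (frechet_derivative f (at x) v))) (at x)" if "x \<in> S" for x
    using Suc.prems that by (intro bounded_linear.has_derivative[OF assms(1)]) (simp add: frechet_derivative_works)
  have "k_smooth_on k S (\<lambda>x. frechet_derivative (\<lambda>x. L (f x)) (at x) v)" for v
  proof (rule k_smooth_on_cong[OF assms(2) _ Suc.IH])
    show "k_smooth_on k S (\<lambda>x. frechet_derivative f (at x) v)" using Suc.prems by simp
    show "L (frechet_derivative f (at x) v) = frechet_derivative (\<lambda>x. L (f x)) (at x) v" if "x \<in> S" for x
      using frechet_derivative_at[OF D[OF that]] by metis
  qed
  then show ?case using D by (auto simp: differentiable_def)
qed

lemma smooth_on_linear_comp:
  "bounded_linear L \<Longrightarrow> open S \<Longrightarrow> smooth_on S f \<Longrightarrow> smooth_on S (\<lambda>x. L (f x))"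
  using k_smooth_on_linear_comp unfolding smooth_on_def by blast

lemma k_smooth_on_add:
  assumes "open S" "k_smooth_on k S f" "k_smooth_on k S g"
  shows "k_smooth_on k S (\<lambda>x. f x + g x)"
  using assms(2,3)
proof (induction k arbitrary: f g)
  case 0
  then show ?case by (simp add: continuous_on_add)
next
  case (Suc k)
  have D: "((\<lambda>x. f x + g x) has_derivative (\<lambda>v. frechet_derivative f (at x) v + frechet_derivative g (at x) v)) (at x)"
    if "x \<in> S" for x
    using Suc.prems that by (intro has_derivative_add) (simp_all add: frechet_derivative_works)
  have "k_smooth_on k S (\<lambda>x. frechet_derivative (\<lambda>x. f x + g x) (at x) v)" for v
  proof (rule k_smooth_on_cong[OF assms(1) _ Suc.IH])
    show "k_smooth_on k S (\<lambda>x. frechet_derivative f (at x) v)"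
      "k_smooth_on k S (\<lambda>x. frechet_derivative g (at x) v)" using Suc.prems by simp_all
    show "frechet_derivative f (at x) v + frechet_derivative g (at x) v = frechet_derivative (\<lambda>x. f x + g x) (at x) v" if "x \<in> S" for x
      using frechet_derivative_at[OF D[OF that]] by metis
  qed
  then show ?case using D by (auto simp: differentiable_def)
qed

lemma smooth_on_add:
  "open S \<Longrightarrow> smooth_on S f \<Longrightarrow> smooth_on S g \<Longrightarrow> smooth_on S (\<lambda>x. f x + g x)"
  using k_smooth_on_add unfolding smooth_on_def by blast

lemma k_smooth_on_sum:
  assumes "open S" "\<And>i. i \<in> I \<Longrightarrow> k_smooth_on k S (f i)"
  shows "k_smooth_on k S (\<lambda>x. \<Sum>i\<in>I. f i x)"
  using assms(2)
  by (induction I rule: infinite_finite_induct) (simp_all add: k_smooth_on_add[OF assms(1)])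

lemma smooth_on_sum:
  "open S \<Longrightarrow> (\<And>i. i \<in> I \<Longrightarrow> smooth_on S (f i)) \<Longrightarrow> smooth_on S (\<lambda>x. \<Sum>i\<in>I. f i x)"
  using k_smooth_on_sum unfolding smooth_on_def by metis

lemma smooth_on_minus: "open S \<Longrightarrow> smooth_on S f \<Longrightarrow> smooth_on S (\<lambda>x. - f x)"
  using smooth_on_linear_comp[OF bounded_linear_minus[OF bounded_linear_ident]] .

lemma smooth_on_diff:
  "open S \<Longrightarrow> smooth_on S f \<Longrightarrow> smooth_on S g \<Longrightarrow> smooth_on S (\<lambda>x. f x - g x)"
  using smooth_on_add[of S f "\<lambda>x. - g x"] smooth_on_minus by auto

lemma k_smooth_on_bilinear:
  assumes "bounded_bilinear pr" "open S" "k_smooth_on k S f" "k_smooth_on k S g"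
  shows "k_smooth_on k S (\<lambda>x. pr (f x) (g x))"
  using assms(3,4)
proof (induction k arbitrary: f g)
  case 0
  then show ?case using bounded_bilinear.continuous_on[OF assms(1)] by simp
next
  case (Suc k)
  have D: "((\<lambda>x. pr (f x) (g x)) has_derivative
     (\<lambda>v. pr (f x) (frechet_derivative g (at x) v) + pr (frechet_derivative f (at x) v) (g x))) (at x)"
    if "x \<in> S" for x
    using Suc.prems that by (intro bounded_bilinear.FDERIV[OF assms(1)]) (simp_all add: frechet_derivative_works)
  have "k_smooth_on k S (\<lambda>x. frechet_derivative (\<lambda>x. pr (f x) (g x)) (at x) v)" for v
  proof (rule k_smooth_on_cong[OF assms(2)])
    have "k_smooth_on k S f" "k_smooth_on k S g"
      using Suc.prems k_smooth_on_Suc_imp by blast+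
    moreover have "k_smooth_on k S (\<lambda>x. frechet_derivative f (at x) v)"
      "k_smooth_on k S (\<lambda>x. frechet_derivative g (at x) v)" using Suc.prems by simp_all
    ultimately show "k_smooth_on k S (\<lambda>x. pr (f x) (frechet_derivative g (at x) v) + pr (frechet_derivative f (at x) v) (g x))"
      by (intro k_smooth_on_add[OF assms(2)] Suc.IH)
    show "pr (f x) (frechet_derivative g (at x) v) + pr (frechet_derivative f (at x) v) (g x)
       = frechet_derivative (\<lambda>x. pr (f x) (g x)) (at x) v" if "x \<in> S" for x
      using frechet_derivative_at[OF D[OF that]] by metis
  qed
  then show ?case using D by (auto simp: differentiable_def)
qed

lemma smooth_on_bilinear:
  "bounded_bilinear pr \<Longrightarrow> open S \<Longrightarrow> smooth_on S f \<Longrightarrow> smooth_on S g \<Longrightarrow>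
   smooth_on S (\<lambda>x. pr (f x) (g x))"
  using k_smooth_on_bilinear unfolding smooth_on_def by blast

lemmas smooth_on_mult =
    smooth_on_bilinear[OF bounded_bilinear_mult[where 'a = "'a::real_normed_algebra"]]
  and smooth_on_scaleR = smooth_on_bilinear[OF bounded_bilinear_scaleR]
  and smooth_on_inner = smooth_on_bilinear[OF bounded_bilinear_inner]

lemma smooth_on_fst: "open S \<Longrightarrow> smooth_on S f \<Longrightarrow> smooth_on S (\<lambda>x. fst (f x))"
  using smooth_on_linear_comp[OF bounded_linear_fst] .

lemma smooth_on_ident: "smooth_on S (\<lambda>x. x)"
  by (rule smooth_on_bounded_linear[OF bounded_linear_ident])

lemma smooth_on_Pair:
  assumes "open S" "smooth_on S f" "smooth_on S g"
  shows "smooth_on S (\<lambda>x. (f x, g x))"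
proof -
  have "smooth_on S (\<lambda>x. (f x, 0) + (0, g x))"
    by (intro smooth_on_add assms smooth_on_linear_comp[where L = "\<lambda>x. (x, 0)"]
          smooth_on_linear_comp[where L = "\<lambda>x. (0, x)"] bounded_linear_Pair
          bounded_linear_ident bounded_linear_zero)
  then show ?thesis by simp
qed

lemma linear_sum_Basis:
  fixes F :: "'a::euclidean_space \<Rightarrow> 'b::real_vector"
  assumes "linear F" shows "F v = (\<Sum>b\<in>Basis. (v \<bullet> b) *\<^sub>R F b)"
  by (metis (no_types, lifting) assms euclidean_representation linear_scale linear_sum sum.cong)

text \<open>\<open>k_smooth_on\<close> controls derivatives in fixed directions, whereas the chain
  rule differentiates \<open>g\<close> in a direction that moves with the point. Expanding this
  direction in a basis, hence the Euclidean space in the middle, gives a sum of products to which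
  the induction hypothesis and the product rule apply.\<close>

lemma k_smooth_on_compose:
  fixes f :: "'a::real_normed_vector \<Rightarrow> 'b::euclidean_space"
  assumes "open S" "open T" "f ` S \<subseteq> T" "k_smooth_on k S f" "k_smooth_on k T g"
  shows "k_smooth_on k S (\<lambda>x. g (f x))"
  using assms(4,5)
proof (induction k arbitrary: g)
  case 0
  then have "continuous_on S f" "continuous_on T g" by simp_all
  then show ?case using continuous_on_compose2[OF _ _ assms(3)] by simp
next
  case (Suc k)
  have D: "((\<lambda>x. g (f x)) has_derivative (\<lambda>v. frechet_derivative g (at (f x)) (frechet_derivative f (at x) v))) (at x)"
    if "x \<in> S" for x
  proof (rule has_derivative_compose[where f = f and g = g])
    show "(f has_derivative frechet_derivative f (at x)) (at x)"
      using Suc.prems that by (simp add: frechet_derivative_works)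
    show "(g has_derivative frechet_derivative g (at (f x))) (at (f x))"
    proof -
      have "f x \<in> T" using that assms(3) by blast
      then show ?thesis using Suc.prems(2) by (simp add: frechet_derivative_works)
    qed
  qed
  have "k_smooth_on k S (\<lambda>x. frechet_derivative (\<lambda>x. g (f x)) (at x) v)" for v
  proof (rule k_smooth_on_cong[OF assms(1)])
    have "k_smooth_on k S (\<lambda>x. (frechet_derivative f (at x) v \<bullet> b) *\<^sub>R frechet_derivative g (at (f x)) b)" for b
      using Suc.prems
      by (intro k_smooth_on_bilinear[OF bounded_bilinear_scaleR assms(1)]
          k_smooth_on_linear_comp[OF bounded_linear_inner_left assms(1)] Suc.IH[of "\<lambda>y. frechet_derivative g (at y) b"] k_smooth_on_Suc_imp[OF Suc.prems(1)])
        simp_all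
    then show "k_smooth_on k S (\<lambda>x. \<Sum>b\<in>Basis. (frechet_derivative f (at x) v \<bullet> b) *\<^sub>R frechet_derivative g (at (f x)) b)"
      by (intro k_smooth_on_sum[OF assms(1)])
    show "(\<Sum>b\<in>Basis. (frechet_derivative f (at x) v \<bullet> b) *\<^sub>R frechet_derivative g (at (f x)) b)
        = frechet_derivative (\<lambda>x. g (f x)) (at x) v" if "x \<in> S" for x
    proof -
      have "linear (frechet_derivative g (at (f x)))"
        using Suc.prems that assms(3) by (intro linear_frechet_derivative) auto
      from linear_sum_Basis[OF this, of "frechet_derivative f (at x) v"] show ?thesis
        using frechet_derivative_at[OF D[OF that]] by metis
    qed
  qed
  then show ?case using D by (auto simp: differentiable_def)
qed

lemma smooth_on_compose:
  fixes f :: "'a::real_normed_vector \<Rightarrow> 'b::euclidean_space"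
  assumes "open S" "open T" "f ` S \<subseteq> T" "smooth_on S f" "smooth_on T g"
  shows "smooth_on S (\<lambda>x. g (f x))"
  using k_smooth_on_compose[OF assms(1-3)] assms(4,5) unfolding smooth_on_def by blast

text \<open>The derivative \<open>- (1 / f) * f' * (1 / f)\<close> contains \<open>1 / f\<close>
  itself undifferentiated, so each step of the induction on the order gains one derivative.\<close>

lemma smooth_on_inverse:
  fixes f :: "'a::real_normed_vector \<Rightarrow> real"
  assumes "open S" "smooth_on S f" "\<And>x. x \<in> S \<Longrightarrow> f x \<noteq> 0"
  shows "smooth_on S (\<lambda>x. inverse (f x))"
  unfolding smooth_on_def
proof
  fix k
  have D: "((\<lambda>x. inverse (f x)) has_derivative (\<lambda>v. - (inverse (f x) * frechet_derivative f (at x) v * inverse (f x)))) (at x)"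
    if "x \<in> S" for x
    using Deriv.has_derivative_inverse[OF assms(3)[OF that] smooth_on_has_derivative[OF assms(2) that]] .
  show "k_smooth_on k S (\<lambda>x. inverse (f x))"
  proof (induction k)
    case 0
    then show ?case using assms smooth_on_continuous[OF assms(2)] by (auto intro: continuous_on_inverse)
  next
    case (Suc k)
    have "k_smooth_on k S (\<lambda>x. frechet_derivative (\<lambda>x. inverse (f x)) (at x) v)" for v
    proof (rule k_smooth_on_cong[OF assms(1)])
      show "- (inverse (f x) * frechet_derivative f (at x) v * inverse (f x)) =
          frechet_derivative (\<lambda>x. inverse (f x)) (at x) v" if "x \<in> S" for x
        using frechet_derivative_at[OF D[OF that]] by metis
      show "k_smooth_on k S (\<lambda>x. - (inverse (f x) * frechet_derivative f (at x) v * inverse (f x)))"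
        using assms(2)
        by (intro k_smooth_on_linear_comp[OF bounded_linear_minus[OF bounded_linear_ident] assms(1)]
           k_smooth_on_bilinear[OF bounded_bilinear_mult assms(1)] Suc.IH)
         (metis k_smooth_on.simps(2) smooth_on_def)
    qed
    then show ?case using D by (auto simp: differentiable_def)
  qed
qed

lemma smooth_on_divide:
  fixes f g :: "'a::real_normed_vector \<Rightarrow> real"
  assumes "open S" "smooth_on S f" "smooth_on S g" "\<And>x. x \<in> S \<Longrightarrow> g x \<noteq> 0"
  shows "smooth_on S (\<lambda>x. f x / g x)"
  using smooth_on_mult[OF assms(1,2) smooth_on_inverse[OF assms(1,3,4)]] by (simp add: field_simps)

lemma smooth_on_frechet_apply:
  fixes f :: "'a::euclidean_space \<Rightarrow> 'b::real_normed_vector"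
  assumes "open S" "smooth_on S f" "smooth_on S V"
  shows "smooth_on S (\<lambda>x. frechet_derivative f (at x) (V x))"
proof (rule smooth_on_cong[OF assms(1)])
  show "smooth_on S (\<lambda>x. \<Sum>b\<in>Basis. (V x \<bullet> b) *\<^sub>R frechet_derivative f (at x) b)"
    using assms by (intro smooth_on_sum smooth_on_scaleR smooth_on_inner smooth_on_frechet smooth_on_const)
  show "(\<Sum>b\<in>Basis. (V x \<bullet> b) *\<^sub>R frechet_derivative f (at x) b) = frechet_derivative f (at x) (V x)"
    if "x \<in> S" for x
    using linear_sum_Basis[OF linear_frechet_derivative[OF smooth_on_differentiable[OF assms(2) that]], of "V x"] by simp
qed

lemma smooth_on_power:
  fixes f :: "'a::real_normed_vector \<Rightarrow> real"
  assumes "open S" "smooth_on S f"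
  shows "smooth_on S (\<lambda>x. f x ^ n)"
  by (induction n) (simp_all add: smooth_on_mult[OF assms(1)] assms)

section \<open>Iterated partial derivatives\<close>

lemma iter_deriv_smooth_on:
  "smooth_on S f \<Longrightarrow> smooth_on S (iter_deriv bs f)"
  by (induction bs) (auto intro: smooth_on_frechet)

lemma iter_deriv_cong:
  assumes "open S" "\<And>x. x \<in> S \<Longrightarrow> f x = g x" "smooth_on S f" "x \<in> S"
  shows "iter_deriv bs f x = iter_deriv bs g x"
  using assms(4)
proof (induction bs arbitrary: x)
  case Nil
  then show ?case using assms by simp
next
  case (Cons b bs)
  have "iter_deriv bs f differentiable at x"
    using iter_deriv_smooth_on[OF assms(3)] smooth_on_differentiable Cons.prems by blast
  from frechet_derivative_transform_within_open[OF this assms(1) Cons.prems Cons.IH]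
  show ?case by simp
qed

lemma iter_deriv_add:
  assumes "open S" "smooth_on S f" "smooth_on S g" "x \<in> S"
  shows "iter_deriv bs (\<lambda>x. f x + g x) x = iter_deriv bs f x + iter_deriv bs g x"
  using assms(4)
proof (induction bs arbitrary: x)
  case (Cons b bs)
  have 1: "(iter_deriv bs f has_derivative frechet_derivative (iter_deriv bs f) (at x)) (at x)"
    "(iter_deriv bs g has_derivative frechet_derivative (iter_deriv bs g) (at x)) (at x)"
    using iter_deriv_smooth_on[OF assms(2)] iter_deriv_smooth_on[OF assms(3)] smooth_on_has_derivative Cons.prems by blast+
  have 2: "((\<lambda>x. iter_deriv bs f x + iter_deriv bs g x) has_derivative
      (\<lambda>v. frechet_derivative (iter_deriv bs f) (at x) v + frechet_derivative (iter_deriv bs g) (at x) v)) (at x)"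
    by (intro has_derivative_add 1)
  have "(iter_deriv bs (\<lambda>x. f x + g x) has_derivative
      (\<lambda>v. frechet_derivative (iter_deriv bs f) (at x) v + frechet_derivative (iter_deriv bs g) (at x) v)) (at x)"
    by (rule has_derivative_transform_within_open[OF 2 assms(1) Cons.prems]) (simp add: Cons.IH)
  from frechet_derivative_at[OF this] show ?case by (simp add: fun_eq_iff)
qed simp

lemma iter_deriv_cmult:
  fixes f :: "'a::real_normed_vector \<Rightarrow> real"
  assumes "open S" "smooth_on S f" "x \<in> S"
  shows "iter_deriv bs (\<lambda>x. a * f x) x = a * iter_deriv bs f x"
  using assms(3)
proof (induction bs arbitrary: x)
  case (Cons b bs)
  have 1: "(iter_deriv bs f has_derivative frechet_derivative (iter_deriv bs f) (at x)) (at x)"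
    using iter_deriv_smooth_on[OF assms(2)] smooth_on_has_derivative Cons.prems by blast
  have 2: "((\<lambda>x. a * iter_deriv bs f x) has_derivative
      (\<lambda>v. a * frechet_derivative (iter_deriv bs f) (at x) v)) (at x)"
    using has_derivative_mult_right[OF 1] by simp
  have "(iter_deriv bs (\<lambda>x. a * f x) has_derivative
      (\<lambda>v. a * frechet_derivative (iter_deriv bs f) (at x) v)) (at x)"
    by (rule has_derivative_transform_within_open[OF 2 assms(1) Cons.prems]) (simp add: Cons.IH)
  from frechet_derivative_at[OF this] show ?case by (simp add: fun_eq_iff)
qed simp

lemma iter_deriv_sum:
  fixes f :: "'i \<Rightarrow> 'a::real_normed_vector \<Rightarrow> real"
  assumes "open S" "\<And>i. i \<in> I \<Longrightarrow> smooth_on S (f i)" "x \<in> S" "finite I"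
  shows "iter_deriv bs (\<lambda>x. \<Sum>i\<in>I. a i * f i x) x = (\<Sum>i\<in>I. a i * iter_deriv bs (f i) x)"
  using assms(4,2)
proof (induction I)
  case empty
  have "iter_deriv bs (\<lambda>x::'a. 0::real) = (\<lambda>x. 0)"
    by (induction bs) auto
  then show ?case by simp
next
  case (insert i I)
  have "smooth_on S (\<lambda>x. a i * f i x)" "smooth_on S (\<lambda>x. \<Sum>i\<in>I. a i * f i x)"
    using insert.prems by (auto intro!: smooth_on_sum smooth_on_mult assms(1))
  from iter_deriv_add[OF assms(1) this assms(3), of bs] show ?case
    using insert iter_deriv_cmult[OF assms(1) _ assms(3), of "f i" bs "a i"] by simp
qed

text \<open>For limits of smooth functions: there the derivatives are known only as a family of
  limit functions \<open>g bs\<close>. If one differentiation always leads from \<open>g bs\<close>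
  to the members \<open>g (b # bs)\<close>, induction shows that the family consists of the
  derivatives of \<open>g []\<close>.\<close>

lemma derivative_family_smooth:
  fixes g :: "'a::euclidean_space list \<Rightarrow> 'a \<Rightarrow> real"
  assumes "open S"
    and D: "\<And>bs x. set bs \<subseteq> Basis \<Longrightarrow> x \<in> S \<Longrightarrow> (g bs has_derivative (\<lambda>v. \<Sum>b\<in>Basis. (v \<bullet> b) * g (b # bs) x)) (at x)"
  shows "set bs \<subseteq> Basis \<Longrightarrow> smooth_on S (g bs)"
    and "set bs \<subseteq> Basis \<Longrightarrow> x \<in> S \<Longrightarrow> iter_deriv bs (g []) x = g bs x"
proof -
  have *: "k_smooth_on k S (g bs)" if "set bs \<subseteq> Basis" for k bs
    using that
  proof (induction k arbitrary: bs)
    case 0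
    have "isCont (g bs) x" if "x \<in> S" for x
      using D[OF 0 that] has_derivative_continuous by blast
    then show ?case by (simp add: continuous_at_imp_continuous_on)
  next
    case (Suc k)
    have "k_smooth_on k S (\<lambda>x. frechet_derivative (g bs) (at x) v)" for v
    proof (rule k_smooth_on_cong[OF assms(1)])
      show "k_smooth_on k S (\<lambda>x. \<Sum>b\<in>Basis. (v \<bullet> b) * g (b # bs) x)"
        using Suc by (intro k_smooth_on_sum[OF assms(1)] k_smooth_on_linear_comp[OF bounded_linear_mult_right assms(1)]) simp
      show "(\<Sum>b\<in>Basis. (v \<bullet> b) * g (b # bs) x) = frechet_derivative (g bs) (at x) v" if "x \<in> S" for x
        using frechet_derivative_at[OF D[OF Suc.prems that]] by metis
    qed
    then show ?case using D[OF Suc.prems] by (auto simp: differentiable_def)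
  qed
  then show "set bs \<subseteq> Basis \<Longrightarrow> smooth_on S (g bs)" by (simp add: smooth_on_def)
  show "set bs \<subseteq> Basis \<Longrightarrow> x \<in> S \<Longrightarrow> iter_deriv bs (g []) x = g bs x"
  proof (induction bs arbitrary: x)
    case (Cons b bs)
    then have bs: "set bs \<subseteq> Basis" and b: "b \<in> Basis" by auto
    have "frechet_derivative (iter_deriv bs (g [])) (at x) = frechet_derivative (g bs) (at x)"
    proof (rule frechet_derivative_transform_within_open[OF _ assms(1) Cons.prems(2)])
      have "smooth_on S (g [])" using * by (simp add: smooth_on_def)
      then show "iter_deriv bs (g []) differentiable at x"
        using iter_deriv_smooth_on smooth_on_differentiable Cons.prems(2) by blast
    qed (simp add: Cons.IH bs)
    also have "\<dots> = (\<lambda>v. \<Sum>b\<in>Basis. (v \<bullet> b) * g (b # bs) x)"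
      using frechet_derivative_at[OF D[OF bs Cons.prems(2)]] by metis
    finally have "iter_deriv (b # bs) (g []) x = (\<Sum>a\<in>Basis. (b \<bullet> a) * g (a # bs) x)" by simp
    also have "\<dots> = (\<Sum>a\<in>Basis. if a = b then g (a # bs) x else 0)"
      using b by (intro sum.cong) (auto simp: inner_Basis)
    finally show ?case using b by simp
  qed simp
qed

section \<open>Flat functions\<close>

text \<open>\<open>flat 1\<close> is the classical smooth function \<open>exp (- 1 / x)\<close>
  extended by 0. The polynomial factor makes the family closed under differentiation, so that
  smoothness of all members is a single induction.\<close>

definition flat :: "real poly \<Rightarrow> real \<Rightarrow> real" where
  "flat p x = (if x > 0 then poly p (1 / x) * exp (- (1 / x)) else 0)"

lemma poly_div_exp_tendsto_0: "((\<lambda>t::real. poly p t / exp t) \<longlongrightarrow> 0) at_top"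
proof -
  have "((\<lambda>t::real. \<Sum>i\<le>degree p. coeff p i * (t ^ i / exp t)) \<longlongrightarrow> 0) at_top"
    by (intro tendsto_null_sum tendsto_mult_right_zero tendsto_power_div_exp_0)
  then show ?thesis by (simp add: poly_altdef sum_divide_distrib)
qed

text \<open>For positive \<open>x\<close>, differentiating \<open>1 / x\<close> in both factors
  produces \<open>1 / x^2\<close> times \<open>p - pderiv p\<close>; the polynomial
  \<open>[:0, 0, 1:]\<close> is this square. At 0 the exponential beats every power of
  \<open>1 / x\<close>.\<close>

lemma flat_has_derivative:
  "(flat p has_real_derivative flat ([:0, 0, 1:] * (p - pderiv p)) x) (at x)"
proof (cases x "0::real" rule: linorder_cases)
  case less
  have "(flat p has_real_derivative 0) (at x)"
    by (rule has_field_derivative_transform_within_open[of "\<lambda>x. 0" _ _ "{..<0}"])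
       (use less in \<open>auto simp: flat_def\<close>)
  then show ?thesis using less by (simp add: flat_def)
next
  case greater
  have "((\<lambda>x. poly p (1 / x) * exp (- (1 / x))) has_real_derivative
      flat ([:0, 0, 1:] * (p - pderiv p)) x) (at x)"
    unfolding flat_def using greater
    by (auto intro!: derivative_eq_intros DERIV_chain2[OF poly_DERIV] simp: field_simps power2_eq_square)
  then show ?thesis
    by (rule has_field_derivative_transform_within_open[of _ _ _ "{0<..}"])
       (use greater in \<open>auto simp: flat_def\<close>)
next
  case equal
  have "((\<lambda>h. flat p h / h) \<longlongrightarrow> 0) (at_left 0)"
    by (rule Lim_transform_eventually[OF tendsto_const])
       (auto simp: eventually_at_filter flat_def)
  moreover have "((\<lambda>h. flat p h / h) \<longlongrightarrow> 0) (at_right 0)"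
  proof (rule Lim_transform_eventually)
    \<comment> \<open>With \<open>t = 1 / h\<close> the difference quotient at 0 is
      \<open>t * poly p t / exp t\<close>; \<open>pCons 0 p\<close> supplies the factor
      \<open>t\<close>.\<close>
    show "((\<lambda>h. poly (pCons 0 p) (inverse h) / exp (inverse h)) \<longlongrightarrow> 0) (at_right 0)"
      using filterlim_compose[OF poly_div_exp_tendsto_0 filterlim_inverse_at_top_right] .
    show "\<forall>\<^sub>F h in at_right 0. poly (pCons 0 p) (inverse h) / exp (inverse h) = flat p h / h"
      by (auto simp: eventually_at_filter flat_def exp_minus field_simps)
  qed
  ultimately have "((\<lambda>h. flat p h / h) \<longlongrightarrow> 0) (at 0)"
    by (simp add: filterlim_at_split)
  then show ?thesis using equal by (simp add: DERIV_def flat_def)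
qed

lemma smooth_on_flat: "smooth_on UNIV (flat p)"
  unfolding smooth_on_def
proof
  fix k
  show "k_smooth_on k UNIV (flat p)"
  proof (induction k arbitrary: p)
    case 0
    then show ?case using DERIV_isCont[OF flat_has_derivative] by (simp add: continuous_at_imp_continuous_on)
  next
    case (Suc k)
    have D: "(flat p has_derivative (\<lambda>v. flat ([:0, 0, 1:] * (p - pderiv p)) x * v)) (at x)" for x
      using flat_has_derivative[of p x] by (simp add: has_field_derivative_def)
    have "(\<lambda>x. frechet_derivative (flat p) (at x) v) = (\<lambda>x. flat ([:0, 0, 1:] * (p - pderiv p)) x * v)" for v
      using frechet_derivative_at[OF D] by (metis (no_types, lifting))
    moreover have "flat p differentiable (at x)" for x
      using D differentiable_def by blast
    ultimately show ?case
      using k_smooth_on_linear_comp[OF bounded_linear_mult_left open_UNIV Suc] by simp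
  qed
qed

text \<open>A bump function times a linear form centred at \<open>q\<close>. The form vanishes at
  \<open>q\<close>, so the product rule leaves only \<open>\<beta> q\<close> times the form there,
  and dividing the form by \<open>\<beta> q\<close> in advance gives exactly
  \<open>l\<close>.\<close>

lemma local_function_with_gradient:
  fixes q l :: "'e::euclidean_space"
  assumes "r > 0"
  obtains f :: "'e \<Rightarrow> real" where "smooth_on UNIV f" "\<And>y. y \<notin> cball q r \<Longrightarrow> f y = 0"
    "(f has_derivative (\<lambda>v. l \<bullet> v)) (at q)"
proof -
  define \<beta> where "\<beta> y = flat 1 (r\<^sup>2 - (y - q) \<bullet> (y - q))" for y
  have \<beta>: "smooth_on UNIV \<beta>"
    unfolding \<beta>_def
    by (rule smooth_on_compose[where T = UNIV])
       (auto intro!: smooth_on_diff smooth_on_inner smooth_on_ident smooth_on_flat)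
  have pos: "\<beta> q > 0" using assms by (simp add: \<beta>_def flat_def)
  define f where "f y = \<beta> y * ((l /\<^sub>R \<beta> q) \<bullet> (y - q))" for y
  show ?thesis
  proof
    show "smooth_on UNIV f"
      unfolding f_def by (intro smooth_on_mult \<beta> smooth_on_inner smooth_on_const smooth_on_diff smooth_on_ident) auto
    show "f y = 0" if "y \<notin> cball q r" for y
    proof -
      have "r < norm (y - q)" using that by (simp add: dist_norm norm_minus_commute)
      then have "r\<^sup>2 < (norm (y - q))\<^sup>2" using assms by (intro power_strict_mono) auto
      then show ?thesis by (simp add: f_def \<beta>_def flat_def power2_norm_eq_inner)
    qed
    have "((\<lambda>y. \<beta> y * ((l /\<^sub>R \<beta> q) \<bullet> (y - q))) has_derivative
        (\<lambda>v. \<beta> q * ((l /\<^sub>R \<beta> q) \<bullet> v) + frechet_derivative \<beta> (at q) v * ((l /\<^sub>R \<beta> q) \<bullet> (q - q)))) (at q)"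
      by (intro has_derivative_mult smooth_on_has_derivative[OF \<beta>]) (auto intro!: derivative_eq_intros)
    moreover have "(\<lambda>v. \<beta> q * ((l /\<^sub>R \<beta> q) \<bullet> v) + frechet_derivative \<beta> (at q) v * ((l /\<^sub>R \<beta> q) \<bullet> (q - q))) = (\<lambda>v. l \<bullet> v)"
      using pos by (intro ext) (simp add: field_simps)
    ultimately show "(f has_derivative (\<lambda>v. l \<bullet> v)) (at q)" by (simp only: f_def[abs_def])
  qed
qed

section \<open>Atlases\<close>

text \<open>Charts without a topology on the carrier. This covers the cotangent atlas, for which
  openness is always expressed in charts, and atlases enlarged by a straightening chart of a
  submanifold.\<close>

locale atlas =
  fixes A :: "('m, 'e::euclidean_space) chart set"
  assumes inj_chart: "c \<in> A \<Longrightarrow> inj_on (cmap c) (cdom c)"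
    and open_cimg: "c \<in> A \<Longrightarrow> open (cimg c)"
    and transition: "c \<in> A \<Longrightarrow> d \<in> A \<Longrightarrow> smooth_transition c d"
begin

lemma cinv_cmap: "c \<in> A \<Longrightarrow> x \<in> cdom c \<Longrightarrow> cinv c (cmap c x) = x"
  by (simp add: cinv_def inj_chart)

lemma cmap_in_cimg: "x \<in> cdom c \<Longrightarrow> cmap c x \<in> cimg c"
  by (simp add: cimg_def)

lemma cmap_cinv: "y \<in> cimg c \<Longrightarrow> cmap c (cinv c y) = y"
  by (simp add: cinv_def cimg_def f_inv_into_f)

lemma cinv_in_cdom: "y \<in> cimg c \<Longrightarrow> cinv c y \<in> cdom c"
  by (simp add: cinv_def cimg_def inv_into_into)

lemma open_overlap: "c \<in> A \<Longrightarrow> d \<in> A \<Longrightarrow> open (cmap c ` (cdom c \<inter> cdom d))"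
  using transition smooth_transition_def by blast

lemma overlap_iff:
  assumes "c \<in> A"
  shows "y \<in> cmap c ` (cdom c \<inter> cdom d) \<longleftrightarrow> y \<in> cimg c \<and> cinv c y \<in> cdom d"
proof
  assume "y \<in> cmap c ` (cdom c \<inter> cdom d)"
  then show "y \<in> cimg c \<and> cinv c y \<in> cdom d"
    using cinv_cmap[OF assms] by (auto simp: cimg_def)
next
  assume y: "y \<in> cimg c \<and> cinv c y \<in> cdom d"
  then have "cmap c (cinv c y) = y" "cinv c y \<in> cdom c \<inter> cdom d"
    using cmap_cinv[of y c] cinv_in_cdom[of y c] by simp_all
  then show "y \<in> cmap c ` (cdom c \<inter> cdom d)" by (metis imageI)
qed

lemma smooth_on_transition:
  "c \<in> A \<Longrightarrow> d \<in> A \<Longrightarrow> smooth_on (cmap c ` (cdom c \<inter> cdom d)) (cmap d \<circ> cinv c)"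
  using transition smooth_transition_def by blast

lemma transition_has_derivative:
  assumes "c \<in> A" "d \<in> A" "x \<in> cdom c" "x \<in> cdom d"
  shows "(cmap d \<circ> cinv c has_derivative frechet_derivative (cmap d \<circ> cinv c) (at (cmap c x))) (at (cmap c x))"
  by (rule smooth_on_has_derivative[OF smooth_on_transition]) (use assms in auto)

lemma read_in_chart_has_derivative:
  assumes "c \<in> A" "d \<in> A" "x \<in> cdom c" "x \<in> cdom d"
    and "(f \<circ> cinv d has_derivative D) (at (cmap d x))"
  shows "(f \<circ> cinv c has_derivative (\<lambda>v. D (frechet_derivative (cmap d \<circ> cinv c) (at (cmap c x)) v))) (at (cmap c x))"
proof (rule has_derivative_transform_within_open)
  have "(cmap d \<circ> cinv c) (cmap c x) = cmap d x" using assms by (simp add: cinv_cmap)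
  then have "(f \<circ> cinv d has_derivative D) (at ((cmap d \<circ> cinv c) (cmap c x)))"
    using assms(5) by (simp only:)
  from has_derivative_compose[OF transition_has_derivative[OF assms(1-4)] this]
  show "((\<lambda>y. (f \<circ> cinv d) ((cmap d \<circ> cinv c) y)) has_derivative
      (\<lambda>v. D (frechet_derivative (cmap d \<circ> cinv c) (at (cmap c x)) v))) (at (cmap c x))" .
  show "open (cmap c ` (cdom c \<inter> cdom d))" "cmap c x \<in> cmap c ` (cdom c \<inter> cdom d)"
    using assms open_overlap by auto
  show "(f \<circ> cinv d) ((cmap d \<circ> cinv c) y) = (f \<circ> cinv c) y" if "y \<in> cmap c ` (cdom c \<inter> cdom d)" for y
    using that assms by (auto simp: cinv_cmap)
qed

lemma frechet_derivative_transition_compose: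
  assumes "c \<in> A" "d \<in> A" "e \<in> A" "x \<in> cdom c" "x \<in> cdom d" "x \<in> cdom e"
  shows "frechet_derivative (cmap e \<circ> cinv c) (at (cmap c x)) v =
    frechet_derivative (cmap e \<circ> cinv d) (at (cmap d x)) (frechet_derivative (cmap d \<circ> cinv c) (at (cmap c x)) v)"
  using frechet_derivative_at[OF read_in_chart_has_derivative[OF assms(1,2,4,5) transition_has_derivative[OF assms(2,3,5,6)]]]
  by metis

lemma frechet_derivative_transition_same:
  assumes "c \<in> A" "x \<in> cdom c"
  shows "frechet_derivative (cmap c \<circ> cinv c) (at (cmap c x)) v = v"
proof -
  have "(cmap c \<circ> cinv c has_derivative (\<lambda>v. v)) (at (cmap c x))"
    by (rule has_derivative_transform_within_open[OF has_derivative_ident open_cimg[OF assms(1)]])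
       (use assms in \<open>auto simp: cmap_cinv cmap_in_cimg\<close>)
  from frechet_derivative_at[OF this, symmetric] show ?thesis by (rule fun_cong)
qed

section \<open>Tangent vectors in coordinates\<close>

lemma coord_vector_in_tangent_space:
  assumes "c \<in> charts_at A x"
  shows "coord_vector A x c w \<in> tangent_space A x"
proof -
  have *: "frechet_derivative (cmap e \<circ> cinv c) (at (cmap c x)) w =
      frechet_derivative (cmap e \<circ> cinv d) (at (cmap d x)) (frechet_derivative (cmap d \<circ> cinv c) (at (cmap c x)) w)"
    if "d \<in> charts_at A x" "e \<in> charts_at A x" for d e
    using that assms unfolding charts_at_def by (intro frechet_derivative_transition_compose) blast+
  have "coord_vector A x c w e = frechet_derivative (cmap e \<circ> cinv d) (at (cmap d x)) (coord_vector A x c w d)"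
    if "d \<in> charts_at A x" "e \<in> charts_at A x" for d e
    using *[OF that] by (simp only: coord_vector_def that if_True)
  moreover have "coord_vector A x c w e = 0" if "e \<notin> charts_at A x" for e
    by (simp only: coord_vector_def that if_False)
  ultimately show ?thesis unfolding tangent_space_def by blast
qed

lemma coord_vector_same:
  assumes "c \<in> charts_at A x"
  shows "coord_vector A x c w c = w"
  using assms frechet_derivative_transition_same[of c x w] by (simp add: coord_vector_def charts_at_def)

lemma tangent_vector_eq_coord_vector:
  assumes "c \<in> charts_at A x" "v \<in> tangent_space A x"
  shows "v = coord_vector A x c (v c)"
proof
  fix d
  show "v d = coord_vector A x c (v c) d"
  proof (cases "d \<in> charts_at A x")
    case True
    then have "v d = frechet_derivative (cmap d \<circ> cinv c) (at (cmap c x)) (v c)"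
      using assms unfolding tangent_space_def by blast
    then show ?thesis by (simp only: coord_vector_def True if_True)
  next
    case False
    then have "v d = 0" using assms unfolding tangent_space_def by blast
    then show ?thesis by (simp only: coord_vector_def False if_False)
  qed
qed

lemma coord_vector_linear:
  assumes "c \<in> charts_at A x"
  shows "coord_vector A x c (a *\<^sub>R v + b *\<^sub>R w) = (\<lambda>d. a *\<^sub>R coord_vector A x c v d + b *\<^sub>R coord_vector A x c w d)"
proof
  fix d
  show "coord_vector A x c (a *\<^sub>R v + b *\<^sub>R w) d = a *\<^sub>R coord_vector A x c v d + b *\<^sub>R coord_vector A x c w d"
  proof (cases "d \<in> charts_at A x")
    case True
    then have "linear (frechet_derivative (cmap d \<circ> cinv c) (at (cmap c x)))"
      using assms transition_has_derivative[of c d x] has_derivative_linear by (auto simp: charts_at_def)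
    then show ?thesis using True by (simp add: coord_vector_def linear_add linear_scale)
  qed (simp add: coord_vector_def)
qed

lemma tangent_space_linear:
  assumes "v \<in> tangent_space A x" "w \<in> tangent_space A x" "x \<in> carrier_of A"
  shows "(\<lambda>c. a *\<^sub>R v c + b *\<^sub>R w c) \<in> tangent_space A x"
proof -
  obtain c where c: "c \<in> charts_at A x" using assms(3) by (auto simp: carrier_of_def charts_at_def)
  have "(\<lambda>d. a *\<^sub>R v d + b *\<^sub>R w d) = coord_vector A x c (a *\<^sub>R v c + b *\<^sub>R w c)"
    using tangent_vector_eq_coord_vector[OF c assms(1)] tangent_vector_eq_coord_vector[OF c assms(2)]
      by (subst coord_vector_linear[OF c]) metis
  then show ?thesis using coord_vector_in_tangent_space[OF c] by simp
qed

lemma smooth_functions_iff: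
  "u \<in> smooth_functions A \<longleftrightarrow> u \<in> extensional (carrier_of A) \<and> (\<forall>c\<in>A. smooth_on (cimg c) (u \<circ> cinv c))"
proof -
  have "(\<lambda>x. x) \<circ> u \<circ> cinv c = u \<circ> cinv c" for c :: "('m, 'e) chart" by auto
  moreover have "carrier_of (std_atlas (UNIV :: real set)) = UNIV"
    by (simp add: carrier_of_def std_atlas_def)
  ultimately show ?thesis
    using open_cimg by (auto simp: smooth_functions_def smooth_map_def std_atlas_def cimg_def)
qed

lemma smooth_in_chart: "u \<in> smooth_functions A \<Longrightarrow> c \<in> A \<Longrightarrow> smooth_on (cimg c) (u \<circ> cinv c)"
  by (simp add: smooth_functions_iff)

lemma smooth_on_change_chart:
  assumes "c \<in> A" "d \<in> A" "smooth_on (cimg d) (u \<circ> cinv d)"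
  shows "smooth_on (cmap c ` (cdom c \<inter> cdom d)) (u \<circ> cinv c)"
proof (rule smooth_on_cong)
  show "smooth_on (cmap c ` (cdom c \<inter> cdom d)) (\<lambda>y. (u \<circ> cinv d) ((cmap d \<circ> cinv c) y))"
    by (rule smooth_on_compose[OF open_overlap[OF assms(1,2)] open_cimg[OF assms(2)] _ smooth_on_transition[OF assms(1,2)] assms(3)])
       (use assms(1) in \<open>auto simp: cinv_cmap cimg_def\<close>)
  show "open (cmap c ` (cdom c \<inter> cdom d))" by (rule open_overlap[OF assms(1,2)])
  show "(u \<circ> cinv d) ((cmap d \<circ> cinv c) y) = (u \<circ> cinv c) y" if "y \<in> cmap c ` (cdom c \<inter> cdom d)" for y
    using that assms(1,2) by (auto simp: cinv_cmap)
qed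

text \<open>Around each point, any chart differs from one of the covering family by a smooth
  transition. Thus a limit function has to be examined in countably many charts only.\<close>

lemma smooth_functionsI:
  assumes "u \<in> extensional (carrier_of A)" "A\<^sub>0 \<subseteq> A" "carrier_of A \<subseteq> carrier_of A\<^sub>0"
    and "\<And>c. c \<in> A\<^sub>0 \<Longrightarrow> smooth_on (cimg c) (u \<circ> cinv c)"
  shows "u \<in> smooth_functions A"
  unfolding smooth_functions_iff
proof (intro conjI ballI assms(1) smooth_on_local)
  fix c y assume c: "c \<in> A" and y: "y \<in> cimg c"
  then have "cinv c y \<in> carrier_of A\<^sub>0" using assms(3) cinv_in_cdom[OF y] by (auto simp: carrier_of_def)
  then obtain d where d: "d \<in> A\<^sub>0" "cinv c y \<in> cdom d" by (auto simp: carrier_of_def)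
  with assms(2) have dA: "d \<in> A" by blast
  show "\<exists>T. open T \<and> y \<in> T \<and> smooth_on T (u \<circ> cinv c)"
    using open_overlap[OF c dA] smooth_on_change_chart[OF c dA assms(4)[OF d(1)]]
      overlap_iff[OF c, of y d] y d(2) by blast
qed

end

section \<open>Countable subatlases and cut-off functions\<close>

locale manifold =
  fixes M :: "'m topology" and A :: "('m, 'e::euclidean_space) chart set"
  assumes smooth_manifold: "smooth_manifold M A"
begin

sublocale atlas A
proof
  show "inj_on (cmap c) (cdom c)" if "c \<in> A" for c
  proof -
    have "homeomorphic_map (subtopology M (cdom c)) (top_of_set (cimg c)) (cmap c)" "openin M (cdom c)"
      using smooth_manifold that by (auto simp: smooth_manifold_def)
    then show ?thesis
      using homeomorphic_imp_injective_map openin_subset by (fastforce simp: Int_absorb1)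
  qed
qed (use smooth_manifold in \<open>auto simp: smooth_manifold_def\<close>)

lemma topspace_M: "topspace M = carrier_of A"
  using smooth_manifold by (simp add: smooth_manifold_def)

text \<open>Of a countable base, keep the sets which fit into some chart domain and choose one such
  chart for each; the base property makes these domains cover.\<close>

lemma countable_subatlas:
  obtains A\<^sub>0 where "A\<^sub>0 \<subseteq> A" "countable A\<^sub>0" "carrier_of A\<^sub>0 = carrier_of A"
proof -
  have "second_countable M" using smooth_manifold by (simp add: smooth_manifold_def)
  then obtain \<B> where "countable \<B>" "\<forall>U x. openin M U \<and> x \<in> U \<longrightarrow> (\<exists>B\<in>\<B>. x \<in> B \<and> B \<subseteq> U)"
    unfolding second_countable_def by (elim exE conjE)
  then have B: "countable \<B>" "\<And>U x. openin M U \<Longrightarrow> x \<in> U \<Longrightarrow> \<exists>B\<in>\<B>. x \<in> B \<and> B \<subseteq> U"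
    by simp_all
  define \<B>' where "\<B>' = {B \<in> \<B>. \<exists>c\<in>A. B \<subseteq> cdom c}"
  define g where "g B = (SOME c. c \<in> A \<and> B \<subseteq> cdom c)" for B
  have g: "g B \<in> A \<and> B \<subseteq> cdom (g B)" if "B \<in> \<B>'" for B
    using that someI_ex[of "\<lambda>c. c \<in> A \<and> B \<subseteq> cdom c"] unfolding g_def \<B>'_def by blast
  show ?thesis
  proof
    show sub: "g ` \<B>' \<subseteq> A" using g by blast
    have "\<B>' \<subseteq> \<B>" unfolding \<B>'_def by blast
    then show "countable (g ` \<B>')" using B(1) countable_subset by blast
    show "carrier_of (g ` \<B>') = carrier_of A"
    proof
      show "carrier_of (g ` \<B>') \<subseteq> carrier_of A" using sub unfolding carrier_of_def by blast
      show "carrier_of A \<subseteq> carrier_of (g ` \<B>')"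
      proof
        fix x assume "x \<in> carrier_of A"
        then obtain c where c: "c \<in> A" "x \<in> cdom c" by (auto simp: carrier_of_def)
        then have "openin M (cdom c)" using smooth_manifold by (auto simp: smooth_manifold_def)
        from B(2)[OF this c(2)] obtain B where "B \<in> \<B>" "x \<in> B" "B \<subseteq> cdom c" by blast
        with c have "B \<in> \<B>'" unfolding \<B>'_def by blast
        then show "x \<in> carrier_of (g ` \<B>')" using g[OF \<open>B \<in> \<B>'\<close>] \<open>x \<in> B\<close> unfolding carrier_of_def by blast
      qed
    qed
  qed
qed

lemma open_chart_image:
  assumes "d \<in> A" "openin M U"
  shows "open (cmap d ` (cdom d \<inter> U))"
proof -
  have "homeomorphic_map (subtopology M (cdom d)) (top_of_set (cimg d)) (cmap d)"
    using smooth_manifold assms by (auto simp: smooth_manifold_def)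
  then have "openin (top_of_set (cimg d)) (cmap d ` (cdom d \<inter> U))"
    using homeomorphic_imp_open_map assms(2) by (metis open_map_def openin_subtopology_Int2)
  then show ?thesis using open_cimg[OF assms(1)] openin_open_trans by blast
qed

text \<open>This is where the Hausdorff property enters: the compact support of a bump in a chart is
  closed in all of \<open>M\<close>, so extension by 0 is smooth.\<close>

lemma closed_chart_preimage:
  assumes c: "c \<in> A" and "compact K" "K \<subseteq> cimg c"
  shows "closedin M (cinv c ` K)"
proof -
  have hom: "homeomorphic_map (subtopology M (cdom c)) (top_of_set (cimg c)) (cmap c)" and op: "openin M (cdom c)"
    using smooth_manifold c by (auto simp: smooth_manifold_def)
  then obtain g where g: "homeomorphic_maps (subtopology M (cdom c)) (top_of_set (cimg c)) (cmap c) g"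
    using homeomorphic_map_maps by blast
  have top: "topspace (subtopology M (cdom c)) = cdom c" using op openin_subset by fastforce
  have "g y = cinv c y" if "y \<in> cimg c" for y
    using g that top unfolding homeomorphic_maps_def
    by (metis cinv_in_cdom cmap_cinv topspace_euclidean_subtopology)
  then have eq: "cinv c ` K = g ` K" using assms(3) by (intro image_cong) auto
  have "compactin (top_of_set (cimg c)) K" using assms by (simp add: compactin_subtopology)
  then have "compactin (subtopology M (cdom c)) (cinv c ` K)"
    unfolding eq using g image_compactin unfolding homeomorphic_maps_def by blast
  then have "compactin M (cinv c ` K)" by (simp add: compactin_subtopology)
  then show ?thesis using smooth_manifold compactin_imp_closedin by (auto simp: smooth_manifold_def)
qed

lemma function_with_gradient:
  assumes c: "c \<in> A" and q: "q \<in> cimg c"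
  obtains \<sigma> where "\<sigma> \<in> smooth_functions A" "(\<sigma> \<circ> cinv c has_derivative (\<lambda>v. l \<bullet> v)) (at q)"
proof -
  obtain r where r: "r > 0" "cball q r \<subseteq> cimg c"
    using open_cimg[OF c] q open_contains_cball by blast
  obtain f :: "'e \<Rightarrow> real" where f: "smooth_on UNIV f" "\<And>y. y \<notin> cball q r \<Longrightarrow> f y = 0"
    "(f has_derivative (\<lambda>v. l \<bullet> v)) (at q)"
    using local_function_with_gradient[OF r(1), where q = q and l = l] by blast
  define \<sigma> where "\<sigma> = restrict (\<lambda>x. if x \<in> cdom c then f (cmap c x) else 0) (carrier_of A)"
  define K where "K = cinv c ` cball q r"
  have K: "openin M (topspace M - K)"
    unfolding K_def using closed_chart_preimage[OF c compact_cball r(2)] by blast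
  have \<sigma>c: "\<sigma> (cinv c y) = f y" if "y \<in> cimg c" for y
    using that c cinv_in_cdom[OF that] by (auto simp: \<sigma>_def cmap_cinv carrier_of_def)
  have \<sigma>0: "\<sigma> x = 0" if "x \<in> carrier_of A" "x \<notin> K" for x
    using that f(2)[of "cmap c x"] c cinv_cmap[OF c] by (force simp: \<sigma>_def K_def image_iff)
  have smc: "smooth_on (cimg c) (\<sigma> \<circ> cinv c)"
    by (rule smooth_on_cong[OF open_cimg[OF c] _ smooth_on_subset[OF f(1)]]) (auto simp: \<sigma>c)
  show ?thesis
  proof
    show "\<sigma> \<in> smooth_functions A"
      unfolding smooth_functions_iff
    proof (intro conjI ballI smooth_on_local)
      show "\<sigma> \<in> extensional (carrier_of A)" by (simp add: \<sigma>_def)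
      fix d y assume d: "d \<in> A" and y: "y \<in> cimg d"
      show "\<exists>T. open T \<and> y \<in> T \<and> smooth_on T (\<sigma> \<circ> cinv d)"
      proof (cases "cinv d y \<in> cdom c")
        case True
        with d y show ?thesis
          using open_overlap[OF d c] smooth_on_change_chart[OF d c smc] overlap_iff[OF d] by blast
      next
        case False
        \<comment> \<open>A point outside the domain of \<open>c\<close> is off the closed set
          \<open>K\<close>, so \<open>\<sigma>\<close> vanishes on a whole neighbourhood of
          it.\<close>
        define T where "T = cmap d ` (cdom d \<inter> (topspace M - K))"
        have "open T" unfolding T_def by (rule open_chart_image[OF d K])
        moreover have "cinv d y \<in> topspace M - K"
          using False cinv_in_cdom[OF y] d r(2) cinv_in_cdom[of _ c] by (auto simp: topspace_M carrier_of_def K_def)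
        then have "y \<in> T" unfolding T_def using cinv_in_cdom[OF y] cmap_cinv[OF y] by (metis IntI imageI)
        moreover have "smooth_on T (\<sigma> \<circ> cinv d)"
          by (rule smooth_on_cong[OF \<open>open T\<close> _ smooth_on_const[of T 0]])
             (auto simp: T_def cinv_cmap[OF d] \<sigma>0 topspace_M)
        ultimately show ?thesis by blast
      qed
    qed
    show "(\<sigma> \<circ> cinv c has_derivative (\<lambda>v. l \<bullet> v)) (at q)"
      by (rule has_derivative_transform_within_open[OF f(3) open_cimg[OF c] q]) (simp add: \<sigma>c)
  qed
qed

end

section \<open>Gradients and Hamiltonian vector fields\<close>

definition grad :: "('e::euclidean_space \<Rightarrow> real) \<Rightarrow> 'e \<Rightarrow> 'e" where
  "grad f y = (\<Sum>b\<in>Basis. frechet_derivative f (at y) b *\<^sub>R b)"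

lemma inner_grad:
  assumes "f differentiable (at y)"
  shows "grad f y \<bullet> v = frechet_derivative f (at y) v"
  using linear_sum_Basis[OF linear_frechet_derivative[OF assms], of v]
  by (simp add: grad_def inner_sum_left inner_commute[of v] mult.commute)

lemma smooth_on_grad:
  "open S \<Longrightarrow> smooth_on S f \<Longrightarrow> smooth_on S (grad f)"
  unfolding grad_def[abs_def] by (intro smooth_on_sum smooth_on_scaleR smooth_on_frechet smooth_on_const)

lemma smooth_on_hamiltonian_vector:
  "open S \<Longrightarrow> smooth_on S h \<Longrightarrow> smooth_on S (hamiltonian_vector h)"
  unfolding hamiltonian_vector_def[abs_def]
  by (intro smooth_on_Pair smooth_on_minus smooth_on_sum smooth_on_scaleR smooth_on_frechet smooth_on_const)

lemma smooth_on_comp_fst: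
  fixes S :: "'a::euclidean_space set" and g :: "'a \<Rightarrow> 'c::real_normed_vector"
  assumes "open S" "smooth_on S g"
  shows "smooth_on (S \<times> (UNIV :: 'b::real_normed_vector set)) (\<lambda>y. g (fst y))"
proof (rule smooth_on_compose[where T = S])
  show "smooth_on (S \<times> (UNIV :: 'b set)) fst" by (rule smooth_on_bounded_linear[OF bounded_linear_fst])
qed (use assms in \<open>auto intro: open_Times\<close>)

lemma fst_hamiltonian_vector_inner:
  assumes "h differentiable (at y)"
  shows "fst (hamiltonian_vector h y) \<bullet> p = frechet_derivative h (at y) (0, p)"
proof -
  have lin: "linear (\<lambda>p. frechet_derivative h (at y) (0, p))"
    using linear_compose[OF _ linear_frechet_derivative[OF assms], of "\<lambda>p. (0, p)"]
    by (simp add: comp_def linear_iff)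
  show ?thesis
    using linear_sum_Basis[OF lin, of p]
    by (simp add: hamiltonian_vector_def inner_sum_left inner_commute[of p] mult.commute)
qed

section \<open>The cotangent atlas\<close>

context atlas
begin

text \<open>The fibre part of the inverse of a canonical chart: the covector at \<open>x\<close>
  whose momentum coordinates in \<open>c\<close> are \<open>p\<close>.\<close>

definition covec :: "('m, 'e) chart \<Rightarrow> 'm \<Rightarrow> 'e \<Rightarrow> ('m, 'e) covector" where
  "covec c x p = (\<lambda>v. if v \<in> tangent_space A x then v c \<bullet> p else 0)"

lemma charts_atI: "c \<in> A \<Longrightarrow> x \<in> cdom c \<Longrightarrow> c \<in> charts_at A x"
  by (simp add: charts_at_def)

lemma covec_in_cotangent_space:
  assumes "c \<in> A" "x \<in> cdom c"
  shows "covec c x p \<in> cotangent_space A x"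
proof -
  have x: "x \<in> carrier_of A" using assms unfolding carrier_of_def by blast
  show ?thesis
    unfolding cotangent_space_def covec_def
    using tangent_space_linear[OF _ _ x] by (simp add: inner_add_left)
qed

lemma covector_eq_covec:
  assumes "c \<in> A" "x \<in> cdom c" and \<xi>: "\<xi> \<in> cotangent_space A x"
  shows "\<xi> = covec c x (\<Sum>b\<in>Basis. \<xi> (coord_vector A x c b) *\<^sub>R b)"
proof
  fix v
  note c = charts_atI[OF assms(1,2)]
  show "\<xi> v = covec c x (\<Sum>b\<in>Basis. \<xi> (coord_vector A x c b) *\<^sub>R b) v"
  proof (cases "v \<in> tangent_space A x")
    case True
    have comb: "\<xi> (coord_vector A x c (a *\<^sub>R w + b *\<^sub>R w')) = a * \<xi> (coord_vector A x c w) + b * \<xi> (coord_vector A x c w')" for a b w w'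
      unfolding coord_vector_linear[OF c]
      using \<xi> coord_vector_in_tangent_space[OF c] unfolding cotangent_space_def by blast
    have "linear (\<lambda>w. \<xi> (coord_vector A x c w))"
      using comb[of 1 _ 1] comb[of _ _ 0] by (intro linearI) simp_all
    from linear_sum_Basis[OF this, of "v c"]
    have "\<xi> (coord_vector A x c (v c)) = v c \<bullet> (\<Sum>b\<in>Basis. \<xi> (coord_vector A x c b) *\<^sub>R b)"
      by (simp add: inner_sum_right mult.commute)
    then show ?thesis
      using tangent_vector_eq_coord_vector[OF c True] True by (simp add: covec_def)
  next
    case False
    then show ?thesis using \<xi> by (simp add: covec_def cotangent_space_def)
  qed
qed

lemma cotangent_chart_simps:
  "cdom (cotangent_chart A c) = {z \<in> cotangent_bundle A. fst z \<in> cdom c}"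
  "cmap (cotangent_chart A c) (x, \<xi>) = (cmap c x, \<Sum>b\<in>Basis. \<xi> (coord_vector A x c b) *\<^sub>R b)"
  by (simp_all add: cotangent_chart_def)

lemma cdom_cotangent_chart_iff:
  assumes "c \<in> A"
  shows "(x, \<xi>) \<in> cdom (cotangent_chart A c) \<longleftrightarrow> x \<in> cdom c \<and> \<xi> \<in> cotangent_space A x"
  using assms unfolding cotangent_chart_simps cotangent_bundle_def carrier_of_def by auto

lemma cmap_cotangent_chart_covec:
  assumes "c \<in> A" "x \<in> cdom c"
  shows "cmap (cotangent_chart A c) (x, covec c x p) = (cmap c x, p)"
  using charts_atI[OF assms]
  by (simp add: cotangent_chart_simps covec_def coord_vector_same coord_vector_in_tangent_space
      inner_commute[of _ p] euclidean_representation)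

lemma inj_cotangent_chart:
  assumes "c \<in> A"
  shows "inj_on (cmap (cotangent_chart A c)) (cdom (cotangent_chart A c))"
proof (rule inj_onI)
  fix z z' assume z: "z \<in> cdom (cotangent_chart A c)" "z' \<in> cdom (cotangent_chart A c)"
    "cmap (cotangent_chart A c) z = cmap (cotangent_chart A c) z'"
  obtain x \<xi> x' \<xi>' where zz: "z = (x, \<xi>)" "z' = (x', \<xi>')" by fastforce
  have x: "x \<in> cdom c" "x' \<in> cdom c" and \<xi>: "\<xi> \<in> cotangent_space A x" "\<xi>' \<in> cotangent_space A x'"
    using z(1,2) unfolding zz cdom_cotangent_chart_iff[OF assms] by simp_all
  have "cmap c x = cmap c x'" using z(3) unfolding zz by (simp add: cotangent_chart_simps)
  then have xx: "x = x'" using inj_onD[OF inj_chart[OF assms]] x by blast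
  have "(\<Sum>b\<in>Basis. \<xi> (coord_vector A x c b) *\<^sub>R b) = (\<Sum>b\<in>Basis. \<xi>' (coord_vector A x' c b) *\<^sub>R b)"
    using z(3) unfolding zz by (simp add: cotangent_chart_simps)
  then have "\<xi> = \<xi>'"
    using covector_eq_covec[OF assms x(1) \<xi>(1)] covector_eq_covec[OF assms x(2) \<xi>(2)] xx by metis
  then show "z = z'" by (simp add: zz xx)
qed

lemma cotangent_chart_inverse:
  assumes "c \<in> A" "q \<in> cimg c"
  shows "(cinv c q, covec c (cinv c q) p) \<in> cdom (cotangent_chart A c)"
    and "cmap (cotangent_chart A c) (cinv c q, covec c (cinv c q) p) = (q, p)"
    and "cinv (cotangent_chart A c) (q, p) = (cinv c q, covec c (cinv c q) p)"
proof -
  note x = cinv_in_cdom[OF assms(2)]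
  show 1: "(cinv c q, covec c (cinv c q) p) \<in> cdom (cotangent_chart A c)"
    using x covec_in_cotangent_space[OF assms(1) x] by (simp add: cdom_cotangent_chart_iff[OF assms(1)])
  show 2: "cmap (cotangent_chart A c) (cinv c q, covec c (cinv c q) p) = (q, p)"
    using cmap_cotangent_chart_covec[OF assms(1) x] cmap_cinv[OF assms(2)] by simp
  show "cinv (cotangent_chart A c) (q, p) = (cinv c q, covec c (cinv c q) p)"
    unfolding cinv_def[of "cotangent_chart A c"]
    by (rule inv_into_f_eq[OF inj_cotangent_chart[OF assms(1)] 1 2])
qed

lemma cotangent_overlap:
  assumes "c \<in> A"
  shows "cmap (cotangent_chart A c) ` (cdom (cotangent_chart A c) \<inter> cdom (cotangent_chart A d)) =
    cmap c ` (cdom c \<inter> cdom d) \<times> UNIV" (is "?L = ?R")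
proof
  show "?L \<subseteq> ?R"
    by (auto simp: cotangent_chart_simps)
  show "?R \<subseteq> ?L"
  proof
    fix y assume "y \<in> ?R"
    then obtain x p where y: "y = (cmap c x, p)" and x: "x \<in> cdom c" "x \<in> cdom d" by auto
    have "y = cmap (cotangent_chart A c) (x, covec c x p)"
      using y cmap_cotangent_chart_covec[OF assms x(1)] by simp
    moreover have "(x, covec c x p) \<in> cdom (cotangent_chart A c)"
      using x covec_in_cotangent_space[OF assms x(1)] by (simp add: cdom_cotangent_chart_iff[OF assms])
    moreover from this have "(x, covec c x p) \<in> cdom (cotangent_chart A d)"
      using x(2) by (simp add: cotangent_chart_simps)
    ultimately show "y \<in> ?L" by blast
  qed
qed

lemma cimg_cotangent_chart:
  assumes "c \<in> A"
  shows "cimg (cotangent_chart A c) = cimg c \<times> UNIV"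
  using cotangent_overlap[OF assms, of c] by (simp add: cimg_def)

text \<open>Positions change by the transition map, momenta by the transpose of the derivative of
  the inverse transition. The latter is linear in the momentum with coefficients smooth in the
  position, whence the smoothness of the cotangent atlas.\<close>

lemma cotangent_transition:
  assumes "c \<in> A" "d \<in> A" "y \<in> cmap c ` (cdom c \<inter> cdom d) \<times> UNIV"
  shows "(cmap (cotangent_chart A d) \<circ> cinv (cotangent_chart A c)) y =
    ((cmap d \<circ> cinv c) (fst y), \<Sum>b\<in>Basis. (frechet_derivative (cmap c \<circ> cinv d) (at ((cmap d \<circ> cinv c) (fst y))) b \<bullet> snd y) *\<^sub>R b)"
proof -
  obtain q p where y: "y = (q, p)" by fastforce
  have q: "q \<in> cimg c" "cinv c q \<in> cdom d"
    using assms(3) overlap_iff[OF assms(1), of q d] unfolding y by simp_all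
  have "c \<in> charts_at A (cinv c q)" "d \<in> charts_at A (cinv c q)"
    using assms(1,2) q cinv_in_cdom[OF q(1)] by (auto intro: charts_atI)
  then have "covec c (cinv c q) p (coord_vector A (cinv c q) d b) =
      frechet_derivative (cmap c \<circ> cinv d) (at (cmap d (cinv c q))) b \<bullet> p" for b
    using coord_vector_in_tangent_space by (simp add: covec_def coord_vector_def)
  then show ?thesis
    by (simp add: y cotangent_chart_inverse(3)[OF assms(1) q(1)] cotangent_chart_simps)
qed

lemma atlas_cotangent: "atlas (cotangent_atlas A)"
proof
  fix cc assume "cc \<in> cotangent_atlas A"
  then obtain c where c: "c \<in> A" "cc = cotangent_chart A c" by (auto simp: cotangent_atlas_def)
  show "inj_on (cmap cc) (cdom cc)" using inj_cotangent_chart c by simp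
  show "open (cimg cc)" using cimg_cotangent_chart[OF c(1)] open_cimg[OF c(1)] c by (simp add: open_Times)
  fix dd assume "dd \<in> cotangent_atlas A"
  then obtain d where d: "d \<in> A" "dd = cotangent_chart A d" by (auto simp: cotangent_atlas_def)
  define V where "V = cmap c ` (cdom c \<inter> cdom d)"
  have V: "open V" "open (V \<times> (UNIV :: 'e set))" unfolding V_def using open_overlap[OF c(1) d(1)] by (auto intro: open_Times)
  have s1: "smooth_on (V \<times> UNIV) (\<lambda>y. (cmap d \<circ> cinv c) (fst y))"
    using smooth_on_comp_fst[OF V(1)] smooth_on_transition[OF c(1) d(1)] V_def by blast
  have "smooth_on V (\<lambda>q. frechet_derivative (cmap c \<circ> cinv d) (at ((cmap d \<circ> cinv c) q)) b)" for b
  proof (rule smooth_on_compose[OF V(1) open_overlap[OF d(1) c(1)], where f = "cmap d \<circ> cinv c" and g = "\<lambda>y. frechet_derivative (cmap c \<circ> cinv d) (at y) b"])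
    show "(cmap d \<circ> cinv c) ` V \<subseteq> cmap d ` (cdom d \<inter> cdom c)"
      using cinv_cmap[OF c(1)] by (auto simp: V_def)
    show "smooth_on V (cmap d \<circ> cinv c)" using smooth_on_transition[OF c(1) d(1)] V_def by blast
    show "smooth_on (cmap d ` (cdom d \<inter> cdom c)) (\<lambda>y. frechet_derivative (cmap c \<circ> cinv d) (at y) b)"
      by (rule smooth_on_frechet[OF smooth_on_transition[OF d(1) c(1)]])
  qed
  from smooth_on_comp_fst[OF V(1) this]
  have s2: "smooth_on (V \<times> (UNIV :: 'e set)) (\<lambda>y. frechet_derivative (cmap c \<circ> cinv d) (at ((cmap d \<circ> cinv c) (fst y))) b)" for b .
  have "smooth_on (V \<times> UNIV) (\<lambda>y. ((cmap d \<circ> cinv c) (fst y),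
      \<Sum>b\<in>Basis. (frechet_derivative (cmap c \<circ> cinv d) (at ((cmap d \<circ> cinv c) (fst y))) b \<bullet> snd y) *\<^sub>R b))"
    by (intro smooth_on_Pair V s1 smooth_on_sum smooth_on_scaleR smooth_on_inner s2 smooth_on_const
        smooth_on_bounded_linear[OF bounded_linear_snd])
  then have "smooth_on (V \<times> UNIV) (cmap dd \<circ> cinv cc)"
    unfolding c(2) d(2)
    by (rule smooth_on_cong[OF V(2), rotated])
       (rule cotangent_transition[OF c(1) d(1), folded V_def, symmetric])
  then show "smooth_transition cc dd"
    unfolding smooth_transition_def c(2) d(2) cotangent_overlap[OF c(1)] using V V_def by simp
qed

section \<open>Hamiltonians and orbits in canonical coordinates\<close>

lemma hamiltonian_in_chart:
  assumes "smooth_map (cotangent_atlas A) (std_atlas UNIV) H" "c \<in> A"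
  shows "smooth_on (cimg c \<times> UNIV) (H \<circ> cinv (cotangent_chart A c))"
proof -
  have "cotangent_chart A c \<in> cotangent_atlas A" using assms(2) by (simp add: cotangent_atlas_def)
  with assms(1) have "smooth_on (cmap (cotangent_chart A c) ` {x \<in> cdom (cotangent_chart A c). H x \<in> UNIV})
      ((\<lambda>x. x) \<circ> H \<circ> cinv (cotangent_chart A c))"
    unfolding smooth_map_def std_atlas_def by auto
  then show ?thesis
    using cimg_cotangent_chart[OF assms(2)] by (simp add: comp_def cimg_def)
qed

text \<open>Canonical charts are linear on fibres: adding \<open>s * \<eta>\<close> to the covector
  translates the coordinates by \<open>s *\<^sub>R (0, p)\<close>, with \<open>p\<close> the
  coordinates of \<open>\<eta>\<close>. The fibre derivative is therefore a directional derivative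
  in a momentum direction.\<close>

lemma fiber_derivative_in_chart:
  assumes "smooth_map (cotangent_atlas A) (std_atlas UNIV) H" and c: "c \<in> A"
    and z: "z \<in> cdom (cotangent_chart A c)" and \<eta>: "\<eta> \<in> cotangent_space A (fst z)"
  obtains p where "fiber_derivative H z \<eta> =
    frechet_derivative (H \<circ> cinv (cotangent_chart A c)) (at (cmap (cotangent_chart A c) z)) (0, p)"
proof -
  interpret T: atlas "cotangent_atlas A" by (rule atlas_cotangent)
  define cc where "cc = cotangent_chart A c"
  have cc: "cc \<in> cotangent_atlas A" using c by (simp add: cotangent_atlas_def cc_def)
  obtain x \<xi> where zz: "z = (x, \<xi>)" by fastforce
  have x: "x \<in> cdom c" and \<xi>: "\<xi> \<in> cotangent_space A x"
    using z unfolding zz cdom_cotangent_chart_iff[OF c] by simp_all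
  define p where "p = (\<Sum>b\<in>Basis. \<eta> (coord_vector A x c b) *\<^sub>R b)"
  define h where "h = H \<circ> cinv cc"
  have "H (x, \<lambda>v. \<xi> v + s * \<eta> v) = h (cmap cc z + s *\<^sub>R (0, p))" for s
  proof -
    have "(\<lambda>v. \<xi> v + s * \<eta> v) \<in> cotangent_space A x"
      using \<xi> \<eta> unfolding cotangent_space_def zz by (simp add: distrib_left mult.left_commute)
    then have "(x, \<lambda>v. \<xi> v + s * \<eta> v) \<in> cdom cc"
      using x unfolding cc_def cdom_cotangent_chart_iff[OF c] by simp
    then have "H (x, \<lambda>v. \<xi> v + s * \<eta> v) = h (cmap cc (x, \<lambda>v. \<xi> v + s * \<eta> v))"
      by (simp add: h_def T.cinv_cmap[OF cc])
    also have "cmap cc (x, \<lambda>v. \<xi> v + s * \<eta> v) = cmap cc z + s *\<^sub>R (0, p)"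
      unfolding cc_def zz p_def by (simp add: cotangent_chart_simps algebra_simps sum.distrib scaleR_sum_right)
    finally show ?thesis .
  qed
  then have fd: "fiber_derivative H z \<eta> = deriv (\<lambda>s. h (cmap cc z + s *\<^sub>R (0, p))) 0"
    by (simp add: fiber_derivative_def zz)
  have "cmap cc z \<in> cimg c \<times> UNIV" using T.cmap_in_cimg[of z cc] z cimg_cotangent_chart[OF c] by (simp add: cc_def)
  then have D: "(h has_derivative frechet_derivative h (at (cmap cc z))) (at (cmap cc z))"
    unfolding h_def cc_def by (intro smooth_on_has_derivative[OF hamiltonian_in_chart[OF assms(1) c]])
  have D1: "((\<lambda>s. h (cmap cc z + s *\<^sub>R (0, p))) has_derivative
      (\<lambda>s. frechet_derivative h (at (cmap cc z)) (s *\<^sub>R (0, p)))) (at 0)"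
    by (rule has_derivative_compose[where g = h and f = "\<lambda>s. cmap cc z + s *\<^sub>R (0, p)"])
       (use D in \<open>auto intro!: derivative_eq_intros simp: zero_prod_def[symmetric]\<close>)
  have "((\<lambda>s. h (cmap cc z + s *\<^sub>R (0, p))) has_real_derivative
      frechet_derivative h (at (cmap cc z)) (0, p)) (at 0)"
  proof -
    have "frechet_derivative h (at (cmap cc z)) (s *\<^sub>R (0, p)) = frechet_derivative h (at (cmap cc z)) (0, p) * s" for s
      unfolding linear_scale[OF has_derivative_linear[OF D]] by (simp add: mult.commute)
    with D1 show ?thesis unfolding has_field_derivative_def by (simp only:)
  qed
  then have "fiber_derivative H z \<eta> = frechet_derivative h (at (cmap cc z)) (0, p)"
    using fd DERIV_imp_deriv by metis
  then show ?thesis using that unfolding h_def cc_def by blast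
qed

text \<open>A function of the position contributes nothing to q' and minus its gradient to p'. The
  whole perturbation argument rests on this shape.\<close>

lemma hamiltonian_vector_add_potential:
  assumes "smooth_map (cotangent_atlas A) (std_atlas UNIV) H" and c: "c \<in> A"
    and u: "u \<in> smooth_functions A" and y: "y \<in> cimg c \<times> UNIV"
  shows "hamiltonian_vector ((\<lambda>z. H z + u (fst z)) \<circ> cinv (cotangent_chart A c)) y =
    hamiltonian_vector (H \<circ> cinv (cotangent_chart A c)) y - (0, grad (u \<circ> cinv c) (fst y))"
proof -
  define h where "h = H \<circ> cinv (cotangent_chart A c)"
  define k where "k = (\<lambda>z. H z + u (fst z)) \<circ> cinv (cotangent_chart A c)"
  have op: "open (cimg c \<times> (UNIV :: 'e set))" using open_cimg[OF c] by (simp add: open_Times)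
  have Dh: "(h has_derivative frechet_derivative h (at y)) (at y)"
    unfolding h_def by (rule smooth_on_has_derivative[OF hamiltonian_in_chart[OF assms(1) c] y])
  have fy: "fst y \<in> cimg c" using y by auto
  have Du: "(u \<circ> cinv c has_derivative frechet_derivative (u \<circ> cinv c) (at (fst y))) (at (fst y))"
    by (rule smooth_on_has_derivative[OF smooth_in_chart[OF u c] fy])
  have "((\<lambda>w. h w + (u \<circ> cinv c) (fst w)) has_derivative
      (\<lambda>v. frechet_derivative h (at y) v + frechet_derivative (u \<circ> cinv c) (at (fst y)) (fst v))) (at y)"
    by (intro has_derivative_add Dh has_derivative_compose[OF has_derivative_fst[OF has_derivative_ident] Du])
  then have "(k has_derivative
      (\<lambda>v. frechet_derivative h (at y) v + frechet_derivative (u \<circ> cinv c) (at (fst y)) (fst v))) (at y)"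
    by (rule has_derivative_transform_within_open[OF _ op y])
       (auto simp: h_def k_def cotangent_chart_inverse(3)[OF c])
  from frechet_derivative_at[OF this]
  have Dk: "frechet_derivative k (at y) v = frechet_derivative h (at y) v + frechet_derivative (u \<circ> cinv c) (at (fst y)) (fst v)" for v
    by (rule fun_cong[OF sym])
  have "frechet_derivative (u \<circ> cinv c) (at (fst y)) 0 = 0"
    using linear_0[OF has_derivative_linear[OF Du]] .
  then show ?thesis
    unfolding h_def[symmetric] k_def[symmetric]
    by (simp add: hamiltonian_vector_def Dk grad_def sum.distrib scaleR_add_left)
qed

lemma orbit_in_chart:
  assumes "smooth_map (cotangent_atlas A) (std_atlas UNIV) H" and c: "c \<in> A"
    and u: "u \<in> smooth_functions A"
    and orb: "hamiltonian_orbit A (\<lambda>z. H z + u (fst z)) I \<theta>"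
    and t: "t \<in> I" "\<theta> t \<in> cdom (cotangent_chart A c)"
  defines "y \<equiv> cmap (cotangent_chart A c) \<circ> \<theta>"
  shows "(y has_vector_derivative hamiltonian_vector (H \<circ> cinv (cotangent_chart A c)) (y t)
    - (0, grad (u \<circ> cinv c) (fst (y t)))) (at t)"
proof -
  have "cotangent_chart A c \<in> cotangent_atlas A" using c by (simp add: cotangent_atlas_def)
  then have "(y has_vector_derivative hamiltonian_vector ((\<lambda>z. H z + u (fst z)) \<circ> cinv (cotangent_chart A c)) (y t)) (at t)"
    using orb t unfolding hamiltonian_orbit_def y_def by fastforce
  moreover have "y t \<in> cimg c \<times> UNIV"
    using t(2) cimg_cotangent_chart[OF c] unfolding y_def by (auto simp: cimg_def[of "cotangent_chart A c"])
  ultimately show ?thesis using hamiltonian_vector_add_potential[OF assms(1) c u] by simp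
qed

end

section \<open>Baire's theorem for the space of potentials\<close>

text \<open>Uniform convergence of the finitely many partial derivatives amounts to uniform
  convergence of the derivatives as linear maps, which the theorem on differentiating a sequence
  requires.\<close>

lemma limit_has_derivative:
  fixes f :: "nat \<Rightarrow> 'e::euclidean_space \<Rightarrow> real"
  assumes S: "open S" "x \<in> S"
    and f: "\<And>n. smooth_on S (f n)"
    and lim: "\<And>y. y \<in> S \<Longrightarrow> (\<lambda>n. f n y) \<longlonglongrightarrow> g y"
    and unif: "\<And>b e. b \<in> Basis \<Longrightarrow> e > 0 \<Longrightarrow>
      \<forall>\<^sub>F n in sequentially. \<forall>y\<in>S. \<bar>frechet_derivative (f n) (at y) b - g' b y\<bar> \<le> e"
  shows "(g has_derivative (\<lambda>v. \<Sum>b\<in>Basis. (v \<bullet> b) * g' b x)) (at x)"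
proof -
  obtain r where r: "r > 0" "ball x r \<subseteq> S" using S open_contains_ball by blast
  have "\<exists>k. \<forall>y\<in>ball x r. (\<lambda>n. f n y) \<longlonglongrightarrow> k y \<and>
      (k has_derivative (\<lambda>v. \<Sum>b\<in>Basis. (v \<bullet> b) * g' b y)) (at y within ball x r)"
  proof (rule has_derivative_sequence[where f' = "\<lambda>n y. frechet_derivative (f n) (at y)"])
    show "x \<in> ball x r" using r by simp
    show "(\<lambda>n. f n x) \<longlonglongrightarrow> g x" using lim S by blast
    show "(f n has_derivative frechet_derivative (f n) (at y)) (at y within ball x r)" if "y \<in> ball x r" for n y
      using smooth_on_has_derivative[OF f[of n]] that r has_derivative_at_withinI by blast
    fix e :: real assume e: "e > 0"
    \<comment> \<open>Each of the \<open>DIM('e)\<close> partial derivatives gets an equal share of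
      the error.\<close>
    define e' where "e' = e / DIM('e)"
    have e': "e' > 0" using e by (simp add: e'_def)
    have "\<forall>\<^sub>F n in sequentially. \<forall>b\<in>Basis. \<forall>y\<in>S. \<bar>frechet_derivative (f n) (at y) b - g' b y\<bar> \<le> e'"
      by (rule eventually_ball_finite) (use unif e' in auto)
    then show "\<forall>\<^sub>F n in sequentially. \<forall>y\<in>ball x r. \<forall>h.
        norm (frechet_derivative (f n) (at y) h - (\<Sum>b\<in>Basis. (h \<bullet> b) * g' b y)) \<le> e * norm h"
    proof eventually_elim
      case (elim n)
      show ?case
      proof (intro ballI allI)
        fix y h assume "y \<in> ball x r"
        then have y: "y \<in> S" using r by blast
        have "frechet_derivative (f n) (at y) h = (\<Sum>b\<in>Basis. (h \<bullet> b) * frechet_derivative (f n) (at y) b)"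
          using linear_sum_Basis[OF linear_frechet_derivative[OF smooth_on_differentiable[OF f y]], of n h]
          by (simp only: real_scaleR_def)
        then have "norm (frechet_derivative (f n) (at y) h - (\<Sum>b\<in>Basis. (h \<bullet> b) * g' b y))
          = \<bar>\<Sum>b\<in>Basis. (h \<bullet> b) * (frechet_derivative (f n) (at y) b - g' b y)\<bar>"
          by (simp add: sum_subtractf right_diff_distrib)
        also have "\<dots> \<le> (\<Sum>b\<in>Basis. \<bar>(h \<bullet> b) * (frechet_derivative (f n) (at y) b - g' b y)\<bar>)"
          by (rule sum_abs)
        also have "\<dots> \<le> (\<Sum>b::'e\<in>Basis. norm h * e')"
          by (intro sum_mono) (use elim y e' in \<open>auto simp: abs_mult intro!: mult_mono Basis_le_norm\<close>)
        also have "\<dots> = e * norm h" by (simp add: e'_def)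
        finally show "norm (frechet_derivative (f n) (at y) h - (\<Sum>b\<in>Basis. (h \<bullet> b) * g' b y)) \<le> e * norm h" .
      qed
    qed
  qed simp
  then obtain k where k: "\<And>y. y \<in> ball x r \<Longrightarrow> (\<lambda>n. f n y) \<longlonglongrightarrow> k y"
    "(k has_derivative (\<lambda>v. \<Sum>b\<in>Basis. (v \<bullet> b) * g' b x)) (at x within ball x r)"
    using r by (meson centre_in_ball)
  have "(k has_derivative (\<lambda>v. \<Sum>b\<in>Basis. (v \<bullet> b) * g' b x)) (at x)"
    using k(2) r at_within_open[of x "ball x r"] by simp
  then show ?thesis
  proof (rule has_derivative_transform_within_open)
    show "k y = g y" if "y \<in> ball x r" for y
      using LIMSEQ_unique[OF k(1)[OF that] lim] that r by blast
  qed (use r in auto)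
qed

section \<open>Seminorm neighbourhoods and completeness\<close>

context atlas
begin

definition indices :: "(('m, 'e) chart \<times> 'e set \<times> 'e list) set" where
  "indices = {(c, K, bs). c \<in> A \<and> compact K \<and> K \<subseteq> cimg c \<and> set bs \<subseteq> Basis}"

text \<open>A closed ball for the seminorms listed in \<open>F\<close>. The sets of the subbase use
  a strict inequality; with \<le> the balls are preserved by pointwise limits of derivatives, which
  the Baire argument needs.\<close>

definition nb :: "(('m, 'e) chart \<times> 'e set \<times> 'e list) set \<Rightarrow> real \<Rightarrow> ('m \<Rightarrow> real) \<Rightarrow> ('m \<Rightarrow> real) set" where
  "nb F e u = {v \<in> smooth_functions A. \<forall>(c, K, bs)\<in>F. \<forall>y\<in>K.
     \<bar>iter_deriv bs (v \<circ> cinv c) y - iter_deriv bs (u \<circ> cinv c) y\<bar> \<le> e}"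

lemma nbD:
  "v \<in> nb F e u \<Longrightarrow> (c, K, bs) \<in> F \<Longrightarrow> y \<in> K \<Longrightarrow>
   \<bar>iter_deriv bs (v \<circ> cinv c) y - iter_deriv bs (u \<circ> cinv c) y\<bar> \<le> e"
  unfolding nb_def by fast

lemma nbI:
  assumes "v \<in> smooth_functions A"
    and "\<And>c K bs y. (c, K, bs) \<in> F \<Longrightarrow> y \<in> K \<Longrightarrow> \<bar>iter_deriv bs (v \<circ> cinv c) y - iter_deriv bs (u \<circ> cinv c) y\<bar> \<le> e"
  shows "v \<in> nb F e u"
  unfolding nb_def using assms by fast

lemma nb_smooth: "v \<in> nb F e u \<Longrightarrow> v \<in> smooth_functions A"
  by (simp add: nb_def)

lemma nb_refl: "u \<in> smooth_functions A \<Longrightarrow> e \<ge> 0 \<Longrightarrow> u \<in> nb F e u"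
  by (rule nbI) simp_all

lemma nb_mono: "F' \<subseteq> F \<Longrightarrow> e \<le> e' \<Longrightarrow> nb F e u \<subseteq> nb F' e' u"
proof
  fix v assume F: "F' \<subseteq> F" "e \<le> e'" and v: "v \<in> nb F e u"
  show "v \<in> nb F' e' u"
  proof (rule nbI[OF nb_smooth[OF v]])
    fix c K bs y assume "(c, K, bs) \<in> F'" "y \<in> K"
    then show "\<bar>iter_deriv bs (v \<circ> cinv c) y - iter_deriv bs (u \<circ> cinv c) y\<bar> \<le> e'"
      using nbD[OF v, of c K bs y] F by auto
  qed
qed

lemma nb_triangle:
  assumes "v \<in> nb F e u" "w \<in> nb F e' v" shows "w \<in> nb F (e + e') u"
proof (rule nbI[OF nb_smooth[OF assms(2)]])
  fix c K bs y assume j: "(c, K, bs) \<in> F" "y \<in> K"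
  show "\<bar>iter_deriv bs (w \<circ> cinv c) y - iter_deriv bs (u \<circ> cinv c) y\<bar> \<le> e + e'"
    using nbD[OF assms(1) j] nbD[OF assms(2) j] by linarith
qed

lemma iter_deriv_continuous_on:
  assumes "u \<in> smooth_functions A" "(c, K, bs) \<in> indices"
  shows "continuous_on K (iter_deriv bs (u \<circ> cinv c))"
  using assms smooth_in_chart iter_deriv_smooth_on smooth_on_continuous continuous_on_subset
  unfolding indices_def by blast

abbreviation potentials :: "('m \<Rightarrow> real) topology" where
  "potentials \<equiv> smooth_functions_topology A"

definition subbase_ball where
  "subbase_ball c K bs u e = {v \<in> smooth_functions A. \<forall>y\<in>K.
     \<bar>iter_deriv bs (v \<circ> cinv c) y - iter_deriv bs (u \<circ> cinv c) y\<bar> < (e::real)}"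

definition subbase :: "('m \<Rightarrow> real) set set" where
  "subbase = insert (smooth_functions A)
     {subbase_ball c K bs u e | c K bs u e. (c, K, bs) \<in> indices \<and> u \<in> smooth_functions A \<and> 0 < e}"

lemma potentials_eq: "potentials = topology_generated_by subbase"
  unfolding smooth_functions_topology_def subbase_def subbase_ball_def indices_def
  by (rule arg_cong[of _ _ topology_generated_by], rule arg_cong[of _ _ "insert _"]) auto

lemma topspace_potentials: "topspace potentials = smooth_functions A"
  unfolding potentials_eq topology_generated_by_topspace subbase_def subbase_ball_def by auto

lemma openin_subbase: "U \<in> subbase \<Longrightarrow> openin potentials U"
  unfolding potentials_eq by (rule topology_generated_by_Basis)

text \<open>Compactness turns the strict bound at each point of \<open>K\<close> into a bound
  \<open>m\<close> below \<open>\<epsilon>\<close> for all points. Half of the gap is then a safe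
  radius around \<open>u\<close>, since it keeps the sum with \<open>m\<close> strictly below
  \<open>\<epsilon>\<close>.\<close>

lemma subbase_contains_nb:
  assumes "U \<in> subbase" "u \<in> U"
  obtains F e where "finite F" "F \<subseteq> indices" "e > 0" "nb F e u \<subseteq> U"
proof (cases "U = smooth_functions A")
  case True
  then show ?thesis using that[of "{}" 1] nb_smooth by auto
next
  case False
  then obtain c K bs u\<^sub>0 \<epsilon> where U: "U = subbase_ball c K bs u\<^sub>0 \<epsilon>" and j: "(c, K, bs) \<in> indices"
    and u0: "u\<^sub>0 \<in> smooth_functions A" and \<epsilon>: "0 < \<epsilon>"
    using assms(1) unfolding subbase_def by blast
  have u: "u \<in> smooth_functions A" using assms(2) U by (simp add: subbase_ball_def)
  define g where "g y = \<bar>iter_deriv bs (u \<circ> cinv c) y - iter_deriv bs (u\<^sub>0 \<circ> cinv c) y\<bar>" for y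
  have cont: "continuous_on K g"
    unfolding g_def by (intro continuous_intros iter_deriv_continuous_on u u0 j)
  have less: "g y < \<epsilon>" if "y \<in> K" for y using assms(2) that unfolding U subbase_ball_def g_def by blast
  have "compact K" using j by (simp add: indices_def)
  obtain m where m: "m < \<epsilon>" "\<And>y. y \<in> K \<Longrightarrow> g y \<le> m"
  proof (cases "K = {}")
    case True then show ?thesis using that[of 0] \<epsilon> by simp
  next
    case False
    then show ?thesis
      using continuous_attains_sup[OF \<open>compact K\<close> False cont] less that by blast
  qed
  show ?thesis
  proof (rule that[of "{(c, K, bs)}" "(\<epsilon> - m) / 2"])
    show "nb {(c, K, bs)} ((\<epsilon> - m) / 2) u \<subseteq> U"
    proof
      fix v assume v: "v \<in> nb {(c, K, bs)} ((\<epsilon> - m) / 2) u"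
      have "\<bar>iter_deriv bs (v \<circ> cinv c) y - iter_deriv bs (u\<^sub>0 \<circ> cinv c) y\<bar> < \<epsilon>" if "y \<in> K" for y
      proof -
        have "\<bar>iter_deriv bs (v \<circ> cinv c) y - iter_deriv bs (u \<circ> cinv c) y\<bar> \<le> (\<epsilon> - m) / 2"
          using nbD[OF v _ that] by simp
        moreover have "(\<epsilon> - m) / 2 + m < \<epsilon>" using m(1) by (simp add: field_simps)
        ultimately show ?thesis using m(2)[OF that] unfolding g_def by linarith
      qed
      then show "v \<in> U" using nb_smooth[OF v] by (simp add: U subbase_ball_def)
    qed
  qed (use j m in auto)
qed

lemma openin_contains_nb:
  assumes "openin potentials U" "u \<in> U"
  shows "\<exists>F e. finite F \<and> F \<subseteq> indices \<and> e > 0 \<and> nb F e u \<subseteq> U"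
proof -
  have "generate_topology_on subbase U"
    using assms(1) unfolding potentials_eq by (rule openin_topology_generated_by)
  then show ?thesis
    using assms(2)
  proof (induction arbitrary: u rule: generate_topology_on.induct)
    case (Int a b)
    have u: "u \<in> a" "u \<in> b" using Int.prems by simp_all
    obtain F e where F: "finite F" "F \<subseteq> indices" "e > 0" "nb F e u \<subseteq> a" using Int.IH(1)[OF u(1)] by (elim exE conjE)
    obtain F' e' where F': "finite F'" "F' \<subseteq> indices" "e' > 0" "nb F' e' u \<subseteq> b" using Int.IH(2)[OF u(2)] by (elim exE conjE)
    have "nb (F \<union> F') (min e e') u \<subseteq> a \<inter> b"
      using F(4) F'(4) nb_mono[of F "F \<union> F'" "min e e'" e u] nb_mono[of F' "F \<union> F'" "min e e'" e' u] by auto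
    then show ?case using F F' by (intro exI[of _ "F \<union> F'"] exI[of _ "min e e'"]) simp
  next
    case (UN K)
    then obtain k where "k \<in> K" "u \<in> k" by blast
    then show ?case using UN.IH[of k u] by (meson Union_upper order_trans)
  next
    case (Basis s)
    then show ?case using subbase_contains_nb by metis
  qed simp
qed

lemma nb_contains_open:
  assumes "finite F" "F \<subseteq> indices" "e > 0" "u \<in> smooth_functions A"
  shows "\<exists>U. openin potentials U \<and> u \<in> U \<and> U \<subseteq> nb F e u"
  using assms(1,2)
proof (induction F)
  case empty
  have "openin potentials (smooth_functions A)"
    by (rule openin_subbase) (simp add: subbase_def)
  then show ?case using assms(4) by (intro exI[of _ "smooth_functions A"]) (simp add: nb_def)
next
  case (insert j F)
  obtain c K bs where j: "j = (c, K, bs)" using prod_cases3 by blast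
  obtain U where U: "openin potentials U" "u \<in> U" "U \<subseteq> nb F e u" using insert by auto
  define B where "B = subbase_ball c K bs u e"
  have "B \<in> subbase" using insert.prems assms(3,4) unfolding subbase_def B_def j by blast
  then have "openin potentials (U \<inter> B)" using U(1) openin_subbase by blast
  moreover have "u \<in> U \<inter> B" using U(2) assms(3,4) by (simp add: B_def subbase_ball_def)
  moreover have "U \<inter> B \<subseteq> nb (insert j F) e u"
  proof
    fix v assume v: "v \<in> U \<inter> B"
    then have vF: "v \<in> nb F e u" using U(3) by blast
    show "v \<in> nb (insert j F) e u"
    proof (rule nbI[OF nb_smooth[OF vF]])
      fix c' K' bs' y assume j': "(c', K', bs') \<in> insert j F" "y \<in> K'"
      show "\<bar>iter_deriv bs' (v \<circ> cinv c') y - iter_deriv bs' (u \<circ> cinv c') y\<bar> \<le> e"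
      proof (cases "(c', K', bs') \<in> F")
        case True then show ?thesis using nbD[OF vF _ j'(2)] by blast
      next
        case False
        then have "c' = c" "K' = K" "bs' = bs" using j' j by auto
        then show ?thesis using v j'(2) unfolding B_def subbase_ball_def by fastforce
      qed
    qed
  qed
  ultimately show ?case by blast
qed

lemma closedin_potentialsI:
  assumes "X \<subseteq> smooth_functions A"
    and "\<And>u. u \<in> smooth_functions A - X \<Longrightarrow> \<exists>F e. finite F \<and> F \<subseteq> indices \<and> e > 0 \<and> nb F e u \<inter> X = {}"
  shows "closedin potentials X"
proof -
  have "openin potentials (smooth_functions A - X)"
  proof (subst openin_subopen, intro ballI)
    fix u assume u: "u \<in> smooth_functions A - X"
    from assms(2)[OF this] obtain F e where F: "finite F" "F \<subseteq> indices" "e > 0" "nb F e u \<inter> X = {}" by blast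
    from nb_contains_open[OF F(1-3)] u obtain U where U: "openin potentials U" "u \<in> U" "U \<subseteq> nb F e u" by blast
    then have "U \<subseteq> smooth_functions A - X" using F(4) nb_smooth by blast
    with U show "\<exists>T. openin potentials T \<and> u \<in> T \<and> T \<subseteq> smooth_functions A - X" by blast
  qed
  then show ?thesis using assms(1) by (simp add: closedin_def topspace_potentials)
qed

text \<open>In each chart of the covering family, all derivatives converge locally uniformly; by
  \<open>limit_has_derivative\<close> their limits form a consistent family, and
  \<open>derivative_family_smooth\<close> identifies them as the derivatives of the pointwise limit.
  The neighbourhood in the Cauchy condition may depend on the derivative.\<close>

lemma smooth_functions_complete:
  assumes B: "B \<subseteq> A" "carrier_of A \<subseteq> carrier_of B"
    and w: "\<And>n. w n \<in> smooth_functions A"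
    and cauchy: "\<And>c y bs. c \<in> B \<Longrightarrow> y \<in> cimg c \<Longrightarrow> set bs \<subseteq> Basis \<Longrightarrow>
      \<exists>V. open V \<and> y \<in> V \<and> (\<forall>e>0. \<exists>N. \<forall>m\<ge>N. \<forall>n\<ge>N. \<forall>x\<in>V.
        \<bar>iter_deriv bs (w m \<circ> cinv c) x - iter_deriv bs (w n \<circ> cinv c) x\<bar> \<le> e)"
  obtains u where "u \<in> smooth_functions A"
    "\<And>c bs y. c \<in> B \<Longrightarrow> set bs \<subseteq> Basis \<Longrightarrow> y \<in> cimg c \<Longrightarrow>
       (\<lambda>n. iter_deriv bs (w n \<circ> cinv c) y) \<longlonglongrightarrow> iter_deriv bs (u \<circ> cinv c) y"
proof -
  define g where "g c bs y = lim (\<lambda>n. iter_deriv bs (w n \<circ> cinv c) y)"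
    for c :: "('m, 'e) chart" and bs y
  have lim: "(\<lambda>n. iter_deriv bs (w n \<circ> cinv c) y) \<longlonglongrightarrow> g c bs y"
    if c: "c \<in> B" and y: "y \<in> cimg c" and bs: "set bs \<subseteq> Basis" for c bs y
  proof -
    obtain V where V: "y \<in> V" and VC: "\<And>e. e > 0 \<Longrightarrow> \<exists>N. \<forall>m\<ge>N. \<forall>n\<ge>N. \<forall>x\<in>V.
        \<bar>iter_deriv bs (w m \<circ> cinv c) x - iter_deriv bs (w n \<circ> cinv c) x\<bar> \<le> e"
      using cauchy[OF c y bs] by blast
    have "Cauchy (\<lambda>n. iter_deriv bs (w n \<circ> cinv c) y)"
    proof (rule metric_CauchyI)
      fix e :: real assume "e > 0"
      then have e2: "e / 2 > 0" by simp
      from VC[OF e2] obtain N where N: "\<forall>m\<ge>N. \<forall>n\<ge>N. \<forall>x\<in>V.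
        \<bar>iter_deriv bs (w m \<circ> cinv c) x - iter_deriv bs (w n \<circ> cinv c) x\<bar> \<le> e / 2" by blast
      show "\<exists>N. \<forall>m\<ge>N. \<forall>n\<ge>N. dist (iter_deriv bs (w m \<circ> cinv c) y) (iter_deriv bs (w n \<circ> cinv c) y) < e"
      proof (intro exI[of _ N] allI impI)
        fix m n assume "m \<ge> N" "n \<ge> N"
        then have "\<bar>iter_deriv bs (w m \<circ> cinv c) y - iter_deriv bs (w n \<circ> cinv c) y\<bar> \<le> e / 2"
          using N V by blast
        then show "dist (iter_deriv bs (w m \<circ> cinv c) y) (iter_deriv bs (w n \<circ> cinv c) y) < e"
          using \<open>e > 0\<close> by (simp add: dist_real_def)
      qed
    qed
    then show ?thesis unfolding g_def
      using convergent_LIMSEQ_iff Cauchy_convergent_iff by blast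
  qed
  have unif: "\<exists>V. open V \<and> y \<in> V \<and> V \<subseteq> cimg c \<and> (\<forall>e>0. \<forall>\<^sub>F n in sequentially. \<forall>x\<in>V.
        \<bar>iter_deriv bs (w n \<circ> cinv c) x - g c bs x\<bar> \<le> e)"
    if c: "c \<in> B" and y: "y \<in> cimg c" and bs: "set bs \<subseteq> Basis" for c bs y
  proof -
    obtain V where V: "open V" "y \<in> V" and VC: "\<And>e. e > 0 \<Longrightarrow> \<exists>N. \<forall>m\<ge>N. \<forall>n\<ge>N. \<forall>x\<in>V.
        \<bar>iter_deriv bs (w m \<circ> cinv c) x - iter_deriv bs (w n \<circ> cinv c) x\<bar> \<le> e"
      using cauchy[OF c y bs] by blast
    have cA: "c \<in> A" using c B(1) by blast
    have "\<forall>\<^sub>F n in sequentially. \<forall>x\<in>V \<inter> cimg c. \<bar>iter_deriv bs (w n \<circ> cinv c) x - g c bs x\<bar> \<le> e" if e: "e > 0" for e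
    proof -
      obtain N where N: "\<And>m n x. m \<ge> N \<Longrightarrow> n \<ge> N \<Longrightarrow> x \<in> V \<Longrightarrow>
        \<bar>iter_deriv bs (w m \<circ> cinv c) x - iter_deriv bs (w n \<circ> cinv c) x\<bar> \<le> e" using VC[OF e] by blast
      have "\<bar>iter_deriv bs (w m \<circ> cinv c) x - g c bs x\<bar> \<le> e" if "m \<ge> N" "x \<in> V \<inter> cimg c" for m x
      proof (rule Lim_bounded)
        show "(\<lambda>n. \<bar>iter_deriv bs (w m \<circ> cinv c) x - iter_deriv bs (w n \<circ> cinv c) x\<bar>) \<longlonglongrightarrow> \<bar>iter_deriv bs (w m \<circ> cinv c) x - g c bs x\<bar>"
          using lim[OF c _ bs] that by (intro tendsto_intros) auto
        show "\<forall>n\<ge>N. \<bar>iter_deriv bs (w m \<circ> cinv c) x - iter_deriv bs (w n \<circ> cinv c) x\<bar> \<le> e"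
          using N that by blast
      qed
      then show ?thesis unfolding eventually_sequentially by blast
    qed
    then show ?thesis
      using V y open_cimg[OF cA] by (intro exI[of _ "V \<inter> cimg c"]) auto
  qed
  have D: "(g c bs has_derivative (\<lambda>v. \<Sum>b\<in>Basis. (v \<bullet> b) * g c (b # bs) y)) (at y)"
    if c: "c \<in> B" and bs: "set bs \<subseteq> Basis" and y: "y \<in> cimg c" for c bs y
  proof -
    have cA: "c \<in> A" using c B(1) by blast
    have "\<forall>b\<in>Basis. \<exists>V. open V \<and> y \<in> V \<and> V \<subseteq> cimg c \<and> (\<forall>e>0. \<forall>\<^sub>F n in sequentially. \<forall>x\<in>V.
        \<bar>iter_deriv (b # bs) (w n \<circ> cinv c) x - g c (b # bs) x\<bar> \<le> e)"
    proof
      fix b :: 'e assume "b \<in> Basis"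
      then have "set (b # bs) \<subseteq> Basis" using bs by simp
      from unif[OF c y this] show "\<exists>V. open V \<and> y \<in> V \<and> V \<subseteq> cimg c \<and> (\<forall>e>0. \<forall>\<^sub>F n in sequentially. \<forall>x\<in>V.
        \<bar>iter_deriv (b # bs) (w n \<circ> cinv c) x - g c (b # bs) x\<bar> \<le> e)" .
    qed
    from bchoice[OF this] obtain V where V': "\<forall>b\<in>Basis. open (V b) \<and> y \<in> V b \<and> V b \<subseteq> cimg c \<and>
       (\<forall>e>0. \<forall>\<^sub>F n in sequentially. \<forall>x\<in>V b. \<bar>iter_deriv (b # bs) (w n \<circ> cinv c) x - g c (b # bs) x\<bar> \<le> e)"
      by (elim exE)
    then have V: "\<And>b. b \<in> Basis \<Longrightarrow> open (V b) \<and> y \<in> V b \<and> V b \<subseteq> cimg c \<and>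
       (\<forall>e>0. \<forall>\<^sub>F n in sequentially. \<forall>x\<in>V b. \<bar>iter_deriv (b # bs) (w n \<circ> cinv c) x - g c (b # bs) x\<bar> \<le> e)"
      by (rule bspec)
    \<comment> \<open>The neighbourhoods of uniform convergence differ from one partial derivative
      to the next; finitely many of them are intersected.\<close>
    define S where "S = (\<Inter>b\<in>Basis. V b)"
    have SV: "S \<subseteq> V b" if "b \<in> Basis" for b using that by (auto simp: S_def)
    have Sc: "S \<subseteq> cimg c" using SV V nonempty_Basis by blast
    show ?thesis
    proof (rule limit_has_derivative[of S _ "\<lambda>n. iter_deriv bs (w n \<circ> cinv c)"])
      show "open S" unfolding S_def using V by (intro open_INT) auto
      show "y \<in> S" unfolding S_def using V by auto
      show "smooth_on S (iter_deriv bs (w n \<circ> cinv c))" for n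
        by (rule smooth_on_subset[OF iter_deriv_smooth_on[OF smooth_in_chart[OF w cA]] Sc])
      show "(\<lambda>n. iter_deriv bs (w n \<circ> cinv c) x) \<longlonglongrightarrow> g c bs x" if "x \<in> S" for x
        using lim[OF c _ bs] that Sc by blast
      fix b :: 'e and e :: real assume "b \<in> Basis" "e > 0"
      then have "\<forall>\<^sub>F n in sequentially. \<forall>x\<in>V b. \<bar>iter_deriv (b # bs) (w n \<circ> cinv c) x - g c (b # bs) x\<bar> \<le> e"
        using V by blast
      then show "\<forall>\<^sub>F n in sequentially. \<forall>x\<in>S. \<bar>frechet_derivative (iter_deriv bs (w n \<circ> cinv c)) (at x) b - g c (b # bs) x\<bar> \<le> e"
        by eventually_elim (use SV[OF \<open>b \<in> Basis\<close>] in auto)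
    qed
  qed
  define u where "u = restrict (\<lambda>x. lim (\<lambda>n. w n x)) (carrier_of A)"
  have ug: "g c [] y = (u \<circ> cinv c) y" if "c \<in> B" "y \<in> cimg c" for c y
    using that B(1) cinv_in_cdom[OF that(2)] unfolding u_def g_def carrier_of_def by auto
  have opn: "open (cimg c)" if "c \<in> B" for c
    by (rule open_cimg[OF subsetD[OF B(1) that]])
  have smg: "smooth_on (cimg c) (g c [])" if "c \<in> B" for c
    using derivative_family_smooth(1)[where g = "g c" and bs = "[]", OF opn[OF that] D[OF that]] by simp
  have itg: "iter_deriv bs (g c []) y = g c bs y" if "c \<in> B" "set bs \<subseteq> Basis" "y \<in> cimg c" for c bs y
    by (rule derivative_family_smooth(2)[where g = "g c", OF opn[OF that(1)] D[OF that(1)] that(2,3)])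
  have smu: "smooth_on (cimg c) (u \<circ> cinv c)" if c: "c \<in> B" for c
    by (rule smooth_on_cong[OF opn[OF c] ug[OF c] smg[OF c]])
  show ?thesis
  proof
    show "u \<in> smooth_functions A"
      by (rule smooth_functionsI[OF _ B smu]) (simp_all add: u_def)
    show "(\<lambda>n. iter_deriv bs (w n \<circ> cinv c) y) \<longlonglongrightarrow> iter_deriv bs (u \<circ> cinv c) y"
      if c: "c \<in> B" and bs: "set bs \<subseteq> Basis" and y: "y \<in> cimg c" for c bs y
    proof -
      from iter_deriv_cong[where g = "u \<circ> cinv c", OF opn[OF c] ug[OF c] smg[OF c] y]
      show ?thesis using lim[OF c y bs] itg[OF c bs y] by simp
    qed
  qed
qed

text \<open>The atlas may be uncountable, so the topology need not visibly be metrizable. This is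
  harmless: completeness only needs the countably many seminorms of the charts which occur.\<close>

lemma potentials_baire:
  assumes A0: "A\<^sub>0 \<subseteq> A" "countable A\<^sub>0" "carrier_of A \<subseteq> carrier_of A\<^sub>0"
    and J: "countable J" "J \<subseteq> indices"
    and X: "countable \<X>"
    and closed: "\<And>X u. X \<in> \<X> \<Longrightarrow> u \<in> smooth_functions A - X \<Longrightarrow>
      \<exists>F e. finite F \<and> F \<subseteq> J \<and> e > 0 \<and> nb F e u \<inter> X = {}"
    and nowhere: "\<And>X u F e. X \<in> \<X> \<Longrightarrow> u \<in> smooth_functions A \<Longrightarrow> finite F \<Longrightarrow> F \<subseteq> indices \<Longrightarrow> e > 0 \<Longrightarrow>
      \<exists>v\<in>nb F e u. v \<notin> X"
    and u0: "u\<^sub>0 \<in> smooth_functions A" and F0: "finite F\<^sub>0" "F\<^sub>0 \<subseteq> indices" and e0: "e\<^sub>0 > 0"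
  shows "\<exists>v\<in>nb F\<^sub>0 e\<^sub>0 u\<^sub>0. v \<notin> \<Union>\<X>"
proof (cases "\<X> = {}")
  case True
  then show ?thesis using nb_refl[OF u0] e0 by (intro bexI[of _ u\<^sub>0]) auto
next
  case False
  define X where "X = from_nat_into \<X>"
  have X_in: "X n \<in> \<X>" for n unfolding X_def by (rule from_nat_into[OF False])
  have X_range: "\<exists>n. Y = X n" if "Y \<in> \<X>" for Y
    using range_from_nat_into[OF False assms(6)] that unfolding X_def by blast
  let ?exhausts = "\<lambda>c C. (\<forall>n::nat. compact (C n) \<and> C n \<subseteq> cimg c) \<and> (\<forall>y\<in>cimg c. \<exists>n. y \<in> interior (C n))"
  have "\<forall>c\<in>A. \<exists>C. ?exhausts c C"
  proof
    fix c assume "c \<in> A"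
    then obtain C where C: "\<And>n::nat. compact (C n)" "\<And>n. C n \<subseteq> cimg c" "\<And>n. C n \<subseteq> interior (C (Suc n))" "\<Union>(range C) = cimg c"
      using open_Union_compact_subsets[OF open_cimg] by metis
    then have "\<forall>y\<in>cimg c. \<exists>n. y \<in> interior (C n)" by blast
    with C show "\<exists>C. ?exhausts c C" by blast
  qed
  from bchoice[OF this] obtain C where "\<forall>c\<in>A. ?exhausts c (C c)" by (elim exE)
  then have C: "\<And>c n. c \<in> A \<Longrightarrow> compact (C c n) \<and> C c n \<subseteq> cimg c"
    "\<And>c y. c \<in> A \<Longrightarrow> y \<in> cimg c \<Longrightarrow> \<exists>n. y \<in> interior (C c n)" by blast+
  \<comment> \<open>The charts of \<open>J\<close> and \<open>F\<^sub>0\<close> join the cover, so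
    that the limit is under control in every chart which a ball of the construction
    mentions.\<close>
  define B where "B = A\<^sub>0 \<union> fst ` (J \<union> F\<^sub>0)"
  have B: "B \<subseteq> A" "countable B" "carrier_of A \<subseteq> carrier_of B"
  proof -
    have "fst ` (J \<union> F\<^sub>0) \<subseteq> A" using J(2) F0(2) unfolding indices_def by auto
    then show "B \<subseteq> A" using A0(1) unfolding B_def by blast
    show "countable B" using A0(2) J(1) F0(1) unfolding B_def by (simp add: countable_finite)
    show "carrier_of A \<subseteq> carrier_of B" using A0(3) unfolding B_def carrier_of_def by blast
  qed
  \<comment> \<open>These seminorms bound every derivative on the members of a compact exhaustion of
    every chart of \<open>B\<close>. Being Cauchy in all of them gives the local uniformity that
    completeness asks for.\<close>
  define E where "E = (\<lambda>(c, n, bs). (c, C c n, bs)) ` (B \<times> (UNIV :: nat set) \<times> lists (Basis :: 'e set))"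
  define J' where "J' = J \<union> F\<^sub>0 \<union> E"
  have J'_count: "countable J'"
    unfolding J'_def E_def using J(1) F0(1) B(2) by (intro countable_Un countable_image countable_SIGMA countable_lists) (auto simp: countable_finite)
  have "E \<subseteq> indices" using B(1) C(1) unfolding E_def indices_def by fastforce
  then have J'_ind: "J' \<subseteq> indices" using J(2) F0(2) unfolding J'_def by blast
  define G where "G i = {j \<in> J'. to_nat_on J' j < i}" for i
  have G_fin: "finite (G i)" for i
    by (rule inj_on_finite[of "to_nat_on J'" _ "{..<i}"])
       (use inj_on_to_nat_on[OF J'_count] in \<open>auto simp: G_def intro: inj_on_subset\<close>)
  define P where "P = (\<lambda>(i::nat) (u, F, e). u \<in> smooth_functions A \<and> finite F \<and> F\<^sub>0 \<subseteq> F \<and> F \<subseteq> J' \<and> (0::real) < e \<and> (i = 0 \<longrightarrow> u = u\<^sub>0 \<and> F = F\<^sub>0 \<and> e = e\<^sub>0))"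
  \<comment> \<open>A step from one closed ball to the next: the centre moves by at most half the
    radius and the radius is at least halved, so the balls are nested. The new ball misses
    \<open>X i\<close>, and \<open>G i\<close> brings in more seminorms, so that each one of
    \<open>J'\<close> is eventually controlled.\<close>
  define Q where "Q = (\<lambda>i (u, F, e) (u', F', e'). F \<union> G i \<subseteq> F' \<and> e' \<le> e / 2 \<and> u' \<in> nb F (e / 2) u \<and> nb F' e' u' \<inter> X i = {})"
  have "\<exists>f. \<forall>i. P i (f i) \<and> Q i (f i) (f (Suc i))"
  proof (rule dependent_nat_choice)
    show "\<exists>s. P 0 s"
      by (rule exI[of _ "(u\<^sub>0, F\<^sub>0, e\<^sub>0)"]) (use u0 F0 e0 J'_def in \<open>auto simp: P_def\<close>)
    fix s i assume s: "P i s"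
    obtain u F e where s_eq: "s = (u, F, e)" using prod_cases3 by blast
    have ps: "u \<in> smooth_functions A" "finite F" "F\<^sub>0 \<subseteq> F" "F \<subseteq> J'" "0 < e" using s unfolding P_def s_eq by auto
    have "e / 2 > 0" using ps by simp
    then obtain v where v: "v \<in> nb F (e / 2) u" "v \<notin> X i"
      using nowhere[OF X_in ps(1,2)] ps(4) J'_ind by blast
    then obtain F' e' where F': "finite F'" "F' \<subseteq> J" "e' > 0" "nb F' e' v \<inter> X i = {}"
      using closed[OF X_in[of i], of v] nb_smooth by blast
    have "nb (F \<union> G i \<union> F') (min e' (e / 2)) v \<inter> X i = {}"
      using nb_mono[of F' "F \<union> G i \<union> F'" "min e' (e / 2)" e' v] F'(4) by fastforce
    moreover have "F \<union> G i \<union> F' \<subseteq> J'" using ps(4) F'(2) unfolding G_def J'_def by blast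
    ultimately have "P (Suc i) (v, F \<union> G i \<union> F', min e' (e / 2)) \<and> Q i s (v, F \<union> G i \<union> F', min e' (e / 2))"
      using ps F' v nb_smooth[OF v(1)] G_fin by (auto simp: P_def Q_def s_eq)
    then show "\<exists>s'. P (Suc i) s' \<and> Q i s s'" by blast
  qed
  then obtain f where f: "\<And>i. P i (f i)" "\<And>i. Q i (f i) (f (Suc i))" by blast
  define w F e where "w i = fst (f i)" and "F i = fst (snd (f i))" and "e i = snd (snd (f i))" for i
  have f_eq: "f i = (w i, F i, e i)" for i by (simp add: w_def F_def e_def)
  have w: "w i \<in> smooth_functions A" and e: "e i > 0" and FJ: "F i \<subseteq> J'" for i
    using f(1)[of i] unfolding f_eq P_def by auto
  have init: "w 0 = u\<^sub>0" "F 0 = F\<^sub>0" "e 0 = e\<^sub>0" using f(1)[of 0] unfolding f_eq P_def by auto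
  have step: "F i \<subseteq> F (Suc i)" "G i \<subseteq> F (Suc i)" "e (Suc i) \<le> e i / 2" "w (Suc i) \<in> nb (F i) (e i / 2) (w i)"
    "nb (F (Suc i)) (e (Suc i)) (w (Suc i)) \<inter> X i = {}" for i
    using f(2)[of i] unfolding f_eq Q_def by auto
  have nested1: "nb (F (Suc i)) (e (Suc i)) (w (Suc i)) \<subseteq> nb (F i) (e i) (w i)" for i
  proof
    fix v assume "v \<in> nb (F (Suc i)) (e (Suc i)) (w (Suc i))"
    then have "v \<in> nb (F i) (e i / 2) (w (Suc i))" using nb_mono[OF step(1,3)[of i]] by blast
    from nb_triangle[OF step(4) this] show "v \<in> nb (F i) (e i) (w i)" by simp
  qed
  have nested: "w m \<in> nb (F i) (e i) (w i)" if "i \<le> m" for i m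
  proof -
    have "nb (F m) (e m) (w m) \<subseteq> nb (F i) (e i) (w i)"
      using that by (induction m rule: dec_induct) (use nested1 in blast)+
    then show ?thesis using nb_refl[OF w[of m], of "e m"] e[of m] by fastforce
  qed
  have F_mono: "F i \<subseteq> F m" if "i \<le> m" for i m
    using that by (induction m rule: dec_induct) (use step(1) in blast)+
  have e_le: "e i \<le> e\<^sub>0 * (1 / 2) ^ i" for i
  proof (induction i)
    case (Suc i) then show ?case using step(3)[of i] by simp
  qed (simp add: init)
  \<comment> \<open>The factor 2 is for two later centres, each within \<open>e i\<close> of
    \<open>w i\<close>.\<close>
  have e_small: "\<exists>N. \<forall>i\<ge>N. 2 * e i \<le> \<delta>" if "\<delta> > 0" for \<delta>
  proof -
    have "(\<lambda>i. 2 * (e\<^sub>0 * (1 / 2) ^ i)) \<longlonglongrightarrow> 2 * (e\<^sub>0 * 0)"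
      by (intro tendsto_intros LIMSEQ_power_zero) simp
    then have "\<forall>\<^sub>F i in sequentially. 2 * (e\<^sub>0 * (1 / 2) ^ i) < \<delta>"
      using that by (intro order_tendstoD) simp_all
    then obtain N where "\<forall>i\<ge>N. 2 * (e\<^sub>0 * (1 / 2) ^ i) < \<delta>" unfolding eventually_sequentially by blast
    then have "2 * e i \<le> \<delta>" if "i \<ge> N" for i using e_le[of i] that by fastforce
    then show ?thesis by blast
  qed
  have cauchy: "\<exists>N. \<forall>m\<ge>N. \<forall>n\<ge>N. \<forall>x\<in>K.
      \<bar>iter_deriv bs (w m \<circ> cinv c) x - iter_deriv bs (w n \<circ> cinv c) x\<bar> \<le> \<delta>" if j: "(c, K, bs) \<in> J'" and \<delta>: "\<delta> > 0" for c K bs \<delta>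
  proof -
    obtain N where N: "\<And>i. i \<ge> N \<Longrightarrow> 2 * e i \<le> \<delta>" using e_small[OF \<delta>] by blast
    \<comment> \<open>The index with number \<open>m\<close> belongs to \<open>G (Suc m)\<close>,
      which enters the list of seminorms one step later, at \<open>Suc (Suc m)\<close>.\<close>
    define i where "i = max N (Suc (Suc (to_nat_on J' (c, K, bs))))"
    have "(c, K, bs) \<in> G (Suc (to_nat_on J' (c, K, bs)))" using j by (simp add: G_def)
    then have ji: "(c, K, bs) \<in> F i"
      using step(2)[of "Suc (to_nat_on J' (c, K, bs))"] F_mono[of "Suc (Suc (to_nat_on J' (c, K, bs)))" i] unfolding i_def by auto
    have "\<bar>iter_deriv bs (w m \<circ> cinv c) x - iter_deriv bs (w n \<circ> cinv c) x\<bar> \<le> \<delta>" if "m \<ge> i" "n \<ge> i" "x \<in> K" for m n x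
      using nbD[OF nested[OF that(1)] ji that(3)] nbD[OF nested[OF that(2)] ji that(3)] N[of i] by (simp add: i_def)
    then show ?thesis by blast
  qed
  obtain u where u: "u \<in> smooth_functions A" "\<And>c bs y. c \<in> B \<Longrightarrow> set bs \<subseteq> Basis \<Longrightarrow> y \<in> cimg c \<Longrightarrow>
       (\<lambda>n. iter_deriv bs (w n \<circ> cinv c) y) \<longlonglongrightarrow> iter_deriv bs (u \<circ> cinv c) y"
  proof (rule smooth_functions_complete[OF B(1,3) w])
    fix c y and bs :: "'e list" assume c: "c \<in> B" and y: "y \<in> cimg c" and bs: "set bs \<subseteq> Basis"
    have cA: "c \<in> A" using c B(1) by blast
    obtain n where n: "y \<in> interior (C c n)" using C(2)[OF cA y] by blast
    have "(c, n, bs) \<in> B \<times> UNIV \<times> lists Basis" using c bs by auto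
    then have "(c, C c n, bs) \<in> E" unfolding E_def by (intro image_eqI[of _ _ "(c, n, bs)"]) simp_all
    then have j: "(c, C c n, bs) \<in> J'" by (simp add: J'_def)
    have "\<forall>\<delta>>0. \<exists>N. \<forall>m\<ge>N. \<forall>k\<ge>N. \<forall>x\<in>interior (C c n). \<bar>iter_deriv bs (w m \<circ> cinv c) x - iter_deriv bs (w k \<circ> cinv c) x\<bar> \<le> \<delta>"
      using cauchy[OF j] interior_subset by (meson subsetD)
    then show "\<exists>V. open V \<and> y \<in> V \<and> (\<forall>\<delta>>0. \<exists>N. \<forall>m\<ge>N. \<forall>n\<ge>N. \<forall>x\<in>V.
        \<bar>iter_deriv bs (w m \<circ> cinv c) x - iter_deriv bs (w n \<circ> cinv c) x\<bar> \<le> \<delta>)"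
      using n open_interior by blast
  qed blast
  have u_nb: "u \<in> nb (F i) (e i) (w i)" for i
  proof (rule nbI[OF u(1)])
    fix c K bs y assume j: "(c, K, bs) \<in> F i" and y: "y \<in> K"
    have jJ: "(c, K, bs) \<in> J'" using FJ j by blast
    have "c \<in> B" using jJ unfolding J'_def B_def E_def by force
    moreover have "set bs \<subseteq> Basis" "y \<in> cimg c" using jJ J'_ind y unfolding indices_def by auto
    ultimately have "(\<lambda>n. iter_deriv bs (w n \<circ> cinv c) y) \<longlonglongrightarrow> iter_deriv bs (u \<circ> cinv c) y" by (rule u(2))
    then have "(\<lambda>n. \<bar>iter_deriv bs (w n \<circ> cinv c) y - iter_deriv bs (w i \<circ> cinv c) y\<bar>)
      \<longlonglongrightarrow> \<bar>iter_deriv bs (u \<circ> cinv c) y - iter_deriv bs (w i \<circ> cinv c) y\<bar>"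
      by (intro tendsto_intros)
    then show "\<bar>iter_deriv bs (u \<circ> cinv c) y - iter_deriv bs (w i \<circ> cinv c) y\<bar> \<le> e i"
      by (rule Lim_bounded[of _ _ i]) (use nbD[OF nested _ y] j in blast)
  qed
  have "u \<notin> X i" for i using step(5)[of i] u_nb[of "Suc i"] by blast
  then have "u \<notin> \<Union>\<X>" using X_range by blast
  moreover have "u \<in> nb F\<^sub>0 e\<^sub>0 u\<^sub>0" using u_nb[of 0] by (simp add: init)
  ultimately show ?thesis by blast
qed

end

section \<open>Potentials with an orbit segment in a given compact set\<close>

context atlas
begin

text \<open>Hamilton's equations for \<open>h + u\<close> in the coordinates of \<open>c\<close>,
  with one-sided derivatives at the two ends. On a closed time interval and in a compact
  \<open>Q\<close>, a uniform limit of such segments can again be one.\<close>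

definition segments ::
  "('m, 'e) chart \<Rightarrow> ('e \<times> 'e \<Rightarrow> real) \<Rightarrow> ('e \<times> 'e) set \<Rightarrow> real \<Rightarrow> ('m \<Rightarrow> real) set" where
  "segments c h Q \<tau> = {u \<in> smooth_functions A. \<exists>y. \<forall>t\<in>{0..\<tau>}. y t \<in> Q \<and>
     (y has_vector_derivative hamiltonian_vector h (y t) - (0, grad (u \<circ> cinv c) (fst (y t)))) (at t within {0..\<tau>})}"

text \<open>Hamilton's equations see a potential only through its gradient over the projection of
  \<open>Q\<close>. So these finitely many seminorms decide closedness, and countably many pieces
  lead to countably many seminorms.\<close>

definition first_indices :: "('m, 'e) chart \<Rightarrow> ('e \<times> 'e) set \<Rightarrow> (('m, 'e) chart \<times> 'e set \<times> 'e list) set" where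
  "first_indices c Q = (\<lambda>b. (c, fst ` Q, [b])) ` Basis"

lemma first_indices_finite: "finite (first_indices c Q)"
  by (simp add: first_indices_def)

lemma first_indices_subset:
  assumes "c \<in> A" "compact Q" "Q \<subseteq> cimg c \<times> UNIV"
  shows "first_indices c Q \<subseteq> indices"
proof -
  have "compact (fst ` Q)" using assms(2) by (intro compact_continuous_image continuous_intros)
  moreover have "fst ` Q \<subseteq> cimg c" using assms(3) by auto
  ultimately show ?thesis using assms(1) by (auto simp: first_indices_def indices_def)
qed

lemma grad_diff_le:
  assumes "v \<in> nb (first_indices c Q) \<delta> u" "y \<in> Q"
  shows "norm (grad (v \<circ> cinv c) (fst y) - grad (u \<circ> cinv c) (fst y)) \<le> real DIM('e) * \<delta>"
proof -
  have "grad (v \<circ> cinv c) (fst y) - grad (u \<circ> cinv c) (fst y) =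
    (\<Sum>b\<in>Basis. (frechet_derivative (v \<circ> cinv c) (at (fst y)) b - frechet_derivative (u \<circ> cinv c) (at (fst y)) b) *\<^sub>R b)"
    by (simp add: grad_def sum_subtractf scaleR_left_diff_distrib)
  also have "norm \<dots> \<le> (\<Sum>b::'e\<in>Basis. \<delta>)"
  proof (rule sum_norm_le)
    fix b :: 'e assume b: "b \<in> Basis"
    have "(c, fst ` Q, [b]) \<in> first_indices c Q" using b by (simp add: first_indices_def)
    from nbD[OF assms(1) this, of "fst y"] assms(2)
    show "norm ((frechet_derivative (v \<circ> cinv c) (at (fst y)) b - frechet_derivative (u \<circ> cinv c) (at (fst y)) b) *\<^sub>R b) \<le> \<delta>"
      using b by simp
  qed
  finally show ?thesis by simp
qed

lemma continuous_on_field: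
  assumes "c \<in> A" "Q \<subseteq> cimg c \<times> UNIV" "smooth_on (cimg c \<times> UNIV) h" "u \<in> smooth_functions A"
  shows "continuous_on Q (\<lambda>y. hamiltonian_vector h y - (0, grad (u \<circ> cinv c) (fst y)))"
proof -
  have op: "open (cimg c)" "open (cimg c \<times> (UNIV :: 'e set))" using open_cimg[OF assms(1)] by (auto simp: open_Times)
  have "smooth_on (cimg c \<times> UNIV) (\<lambda>y. hamiltonian_vector h y - (0, grad (u \<circ> cinv c) (fst y)))"
    by (intro smooth_on_diff smooth_on_Pair smooth_on_const op smooth_on_hamiltonian_vector assms(3)
       smooth_on_comp_fst smooth_on_grad smooth_in_chart[OF assms(4,1)])
  from smooth_on_continuous[OF this] show ?thesis using continuous_on_subset assms(2) by blast
qed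

text \<open>A limit of potentials with orbit segments in \<open>Q\<close> has one as well, by the theorem of Arzela
  and Ascoli. Only the convergence of the gradients over \<open>Q\<close> matters.\<close>

lemma segments_closed:
  assumes c: "c \<in> A" and Q: "compact Q" "Q \<subseteq> cimg c \<times> UNIV"
    and h: "smooth_on (cimg c \<times> UNIV) h" and \<tau>: "\<tau> > 0"
    and u: "u \<in> smooth_functions A - segments c h Q \<tau>"
  shows "\<exists>e>0. nb (first_indices c Q) e u \<inter> segments c h Q \<tau> = {}"
proof (rule ccontr)
  assume neg: "\<not> ?thesis"
  define Z where "Z w y = hamiltonian_vector h y - (0, grad (w \<circ> cinv c) (fst y))" for w y
  define d where "d = real DIM('e)"
  have ex: "\<exists>v y. v \<in> nb (first_indices c Q) (1 / real (Suc m)) u \<and>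
     (\<forall>t\<in>{0..\<tau>}. y t \<in> Q \<and> (y has_vector_derivative Z v (y t)) (at t within {0..\<tau>}))" for m
  proof -
    have "(1 / real (Suc m)) > 0" by simp
    then have "nb (first_indices c Q) (1 / real (Suc m)) u \<inter> segments c h Q \<tau> \<noteq> {}" using neg by blast
    then show ?thesis unfolding segments_def Z_def by blast
  qed
  then obtain v ys where v: "\<And>m. v m \<in> nb (first_indices c Q) (1 / real (Suc m)) u"
    and ys: "\<And>m t. t \<in> {0..\<tau>} \<Longrightarrow> ys m t \<in> Q"
    and ys': "\<And>m t. t \<in> {0..\<tau>} \<Longrightarrow> (ys m has_vector_derivative Z (v m) (ys m t)) (at t within {0..\<tau>})"
    by metis
  have uS: "u \<in> smooth_functions A" using u by blast
  have Zdiff: "norm (Z (v m) y - Z u y) \<le> d / real (Suc m)" if "y \<in> Q" for m y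
  proof -
    have "Z (v m) y - Z u y = (0, - (grad (v m \<circ> cinv c) (fst y) - grad (u \<circ> cinv c) (fst y)))"
      by (simp add: Z_def)
    then have "norm (Z (v m) y - Z u y) = norm (grad (v m \<circ> cinv c) (fst y) - grad (u \<circ> cinv c) (fst y))"
      by (simp add: norm_Pair norm_minus_commute)
    then show ?thesis using grad_diff_le[OF v that, of m] by (simp add: d_def)
  qed
  have contZ: "continuous_on Q (Z u)"
    unfolding Z_def by (rule continuous_on_field[OF c Q(2) h uS])
  obtain C where C: "\<And>y. y \<in> Q \<Longrightarrow> norm (Z u y) \<le> C"
    using compact_imp_bounded[OF compact_continuous_image[OF contZ Q(1)]] unfolding bounded_iff by auto
  \<comment> \<open>A common speed limit for all segments: \<open>C\<close> bounds
    \<open>Z u\<close> on \<open>Q\<close>, and \<open>d\<close> bounds the deviation of every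
    \<open>Z (v m)\<close> from it; the absolute value and the summand 1 make \<open>L\<close>
    positive.\<close>
  define L where "L = \<bar>C\<bar> + d + 1"
  have L: "L > 0" by (simp add: L_def d_def)
  have ZL: "norm (Z (v m) y) \<le> L" if "y \<in> Q" for m y
  proof -
    have "norm (Z (v m) y) \<le> norm (Z u y) + norm (Z (v m) y - Z u y)" by (rule norm_triangle_sub)
    also have "\<dots> \<le> \<bar>C\<bar> + d"
    proof (rule add_mono)
      show "norm (Z u y) \<le> \<bar>C\<bar>" using C[OF that] by simp
      have "d / real (Suc m) \<le> d" by (simp add: d_def field_simps)
      then show "norm (Z (v m) y - Z u y) \<le> d" using Zdiff[OF that, of m] by linarith
    qed
    finally show ?thesis by (simp add: L_def)
  qed
  have Lip: "norm (ys m s - ys m t) \<le> L * norm (s - t)" if "s \<in> {0..\<tau>}" "t \<in> {0..\<tau>}" for m s t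
  proof (rule differentiable_bound[OF convex_real_interval(5)])
    show "(ys m has_derivative (\<lambda>h. h *\<^sub>R Z (v m) (ys m r))) (at r within {0..\<tau>})" if "r \<in> {0..\<tau>}" for r
      using ys'[OF that] by (simp add: has_vector_derivative_def)
    show "onorm (\<lambda>h. h *\<^sub>R Z (v m) (ys m r)) \<le> L" if "r \<in> {0..\<tau>}" for r
    proof (rule onorm_bound)
      show "norm (h *\<^sub>R Z (v m) (ys m r)) \<le> L * norm h" for h
        using mult_left_mono[OF ZL[OF ys[OF that], of m m], of "norm h"] by (simp add: mult.commute)
    qed (use L in simp)
  qed (use that in auto)
  obtain Bd where Bd: "\<And>y. y \<in> Q \<Longrightarrow> norm y \<le> Bd"
    using compact_imp_bounded[OF Q(1)] unfolding bounded_iff by auto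
  obtain g k where g: "continuous_on {0..\<tau>} g" and k: "strict_mono (k :: nat \<Rightarrow> nat)"
    and conv: "\<And>e. 0 < e \<Longrightarrow> \<exists>N. \<forall>n x. n \<ge> N \<and> x \<in> {0..\<tau>} \<longrightarrow> norm (ys (k n) x - g x) < e"
  proof (rule Arzela_Ascoli[of "{0..\<tau>}" ys Bd])
    show "norm (ys n x) \<le> Bd" if "x \<in> {0..\<tau>}" for n x using Bd ys that by blast
    fix x e :: real assume x: "x \<in> {0..\<tau>}" and e: "0 < e"
    show "\<exists>d>0. \<forall>n y. y \<in> {0..\<tau>} \<and> norm (x - y) < d \<longrightarrow> norm (ys n x - ys n y) < e"
    proof (intro exI[of _ "e / L"] conjI allI impI)
      fix n y assume y: "y \<in> {0..\<tau>} \<and> norm (x - y) < e / L"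
      then have "norm (ys n x - ys n y) \<le> L * norm (x - y)" using Lip x by blast
      also have "\<dots> < e" using y L by (simp add: field_simps)
      finally show "norm (ys n x - ys n y) < e" .
    qed (use e L in simp)
  qed (blast, blast)
  have lim: "(\<lambda>n. ys (k n) t) \<longlonglongrightarrow> g t" if "t \<in> {0..\<tau>}" for t
    unfolding LIMSEQ_iff using conv that by meson
  have gQ: "g t \<in> Q" if "t \<in> {0..\<tau>}" for t
    by (rule closed_sequentially[OF compact_imp_closed[OF Q(1)] _ lim[OF that]]) (use ys that in blast)
  have unifZ: "uniformly_continuous_on Q (Z u)" by (rule compact_uniformly_continuous[OF contZ Q(1)])
  \<comment> \<open>The limit solves the limit equation because the velocities converge uniformly:
    half of the error comes from the gradients of \<open>v (k n)\<close>, half from the uniform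
    continuity of \<open>Z u\<close> between \<open>ys (k n) t\<close> and \<open>g t\<close>. The
    theorem on sequences yields its own limit \<open>g2\<close>, identified with \<open>g\<close>
    afterwards.\<close>
  have ex2: "\<exists>g2. \<forall>t\<in>{0..\<tau>}. (\<lambda>n. ys (k n) t) \<longlonglongrightarrow> g2 t \<and> (g2 has_derivative (\<lambda>h. h *\<^sub>R Z u (g t))) (at t within {0..\<tau>})"
  proof (rule has_derivative_sequence[where f' = "\<lambda>n t h. h *\<^sub>R Z (v (k n)) (ys (k n) t)" and ?x0.0 = 0])
    show "(ys (k n) has_derivative (\<lambda>h. h *\<^sub>R Z (v (k n)) (ys (k n) t))) (at t within {0..\<tau>})" if "t \<in> {0..\<tau>}" for n t
      using ys'[OF that] by (simp add: has_vector_derivative_def)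
    show "(\<lambda>n. ys (k n) 0) \<longlonglongrightarrow> g 0" using lim[of 0] \<tau> by simp
    fix e :: real assume e: "e > 0"
    obtain \<delta> where \<delta>: "\<delta> > 0" "\<And>x y. x \<in> Q \<Longrightarrow> y \<in> Q \<Longrightarrow> dist y x < \<delta> \<Longrightarrow> dist (Z u y) (Z u x) < e / 2"
      using unifZ[unfolded uniformly_continuous_on_def] e half_gt_zero by meson
    obtain N1 where N1: "\<And>n x. n \<ge> N1 \<Longrightarrow> x \<in> {0..\<tau>} \<Longrightarrow> norm (ys (k n) x - g x) < \<delta>" using conv[OF \<delta>(1)] by blast
    obtain N2 where N2: "2 * d / e < real N2" using reals_Archimedean2 by blast
    show "\<forall>\<^sub>F n in sequentially. \<forall>t\<in>{0..\<tau>}. \<forall>h. norm (h *\<^sub>R Z (v (k n)) (ys (k n) t) - h *\<^sub>R Z u (g t)) \<le> e * norm h"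
      unfolding eventually_sequentially
    proof (intro exI[of _ "max N1 N2"] allI impI ballI)
      fix n t h assume n: "max N1 N2 \<le> n" and t: "t \<in> {0..\<tau>}"
      have "n \<le> k n" by (rule seq_suble[OF k])
      then have "N2 \<le> k n" using n by simp
      then have "real N2 \<le> real (Suc (k n))" by simp
      then have "2 * d / e < real (Suc (k n))" using N2 by linarith
      then have "d / real (Suc (k n)) \<le> e / 2" using e by (simp add: field_simps)
      then have 1: "norm (Z (v (k n)) (ys (k n) t) - Z u (ys (k n) t)) \<le> e / 2"
        using Zdiff[OF ys[OF t], of "k n" "k n"] by linarith
      have 2: "norm (Z u (ys (k n) t) - Z u (g t)) \<le> e / 2"
        using \<delta>(2)[OF gQ[OF t] ys[OF t], of "k n"] N1[of n t] n t by (simp add: dist_norm)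
      have "norm (Z (v (k n)) (ys (k n) t) - Z u (g t)) \<le> e"
        using norm_triangle_le[of "Z (v (k n)) (ys (k n) t) - Z u (ys (k n) t)" "Z u (ys (k n) t) - Z u (g t)" e] 1 2 by simp
      then show "norm (h *\<^sub>R Z (v (k n)) (ys (k n) t) - h *\<^sub>R Z u (g t)) \<le> e * norm h"
        unfolding scaleR_right_diff_distrib[symmetric] norm_scaleR
        by (simp add: mult.commute[of "\<bar>h\<bar>"] mult_right_mono)
    qed
  qed (use \<tau> in auto)
  then obtain g2 where g2: "\<And>t. t \<in> {0..\<tau>} \<Longrightarrow> (\<lambda>n. ys (k n) t) \<longlonglongrightarrow> g2 t"
    "\<And>t. t \<in> {0..\<tau>} \<Longrightarrow> (g2 has_derivative (\<lambda>h. h *\<^sub>R Z u (g t))) (at t within {0..\<tau>})" by blast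
  have eq: "g t = g2 t" if "t \<in> {0..\<tau>}" for t using LIMSEQ_unique[OF lim[OF that] g2(1)[OF that]] .
  have "(g has_vector_derivative Z u (g t)) (at t within {0..\<tau>})" if "t \<in> {0..\<tau>}" for t
    unfolding has_vector_derivative_def
    by (rule has_derivative_transform[OF that eq g2(2)[OF that]])
  then have "u \<in> segments c h Q \<tau>"
    using uS gQ unfolding segments_def Z_def by blast
  then show False using u by blast
qed

end

section \<open>Orbit segments in a hypersurface are destroyed by small perturbations\<close>

text \<open>Taylor's formula for \<open>poly p\<close> around \<open>s\<close>, evaluated at
  distance \<open>- s\<close>. The remainder contains the derivative of order \<open>n\<close>,
  which is 0.\<close>

lemma poly_taylor_at_0:
  fixes p :: "real poly"
  assumes "degree p < n"
  shows "poly p 0 = (\<Sum>m<n. poly ((pderiv ^^ m) p) s * (- s) ^ m / fact m)"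
proof -
  have "\<forall>m x. ((\<lambda>x. poly ((pderiv ^^ m) p) (s + x)) has_real_derivative poly ((pderiv ^^ Suc m) p) (s + x)) (at x)"
    by (auto intro!: derivative_eq_intros DERIV_chain2[OF poly_DERIV])
  from Maclaurin_all_le[where diff = "\<lambda>m x. poly ((pderiv ^^ m) p) (s + x)", OF refl this, of "- s" n]
  obtain t where "poly p 0 = (\<Sum>m<n. poly ((pderiv ^^ m) p) s / fact m * (- s) ^ m) +
      poly ((pderiv ^^ n) p) (s + t) / fact n * (- s) ^ n" by auto
  moreover have "(pderiv ^^ n) p = 0"
    by (rule poly_eqI) (use assms in \<open>simp add: coeff_higher_pderiv coeff_eq_0\<close>)
  ultimately show ?thesis by simp
qed

lemma coeff_eq_higher_pderiv:
  fixes p :: "real poly"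
  shows "coeff p j = poly ((pderiv ^^ j) p) 0 / fact j"
proof -
  have "poly ((pderiv ^^ j) p) 0 = coeff ((pderiv ^^ j) p) 0" by (simp add: poly_0_coeff_0)
  also have "\<dots> = fact j * coeff p j" by (simp add: coeff_higher_pderiv pochhammer_fact)
  finally show ?thesis by simp
qed

text \<open>A coefficient is a derivative at 0 up to a factorial, and the derivatives at 0 are
  determined by those at \<open>s\<close>. The formula is the same for all polynomials of degree
  below \<open>n\<close>; it defines the map \<open>\<Psi>\<close> of the perturbation
  argument.\<close>

lemma coeff_via_taylor:
  fixes p :: "real poly"
  assumes "degree p < n"
  shows "coeff p j = (\<Sum>m<n. poly ((pderiv ^^ (m + j)) p) s * (- s) ^ m / fact m) / fact j"
proof -
  have "degree ((pderiv ^^ j) p) < n"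
    by (rule le_less_trans[OF _ assms], rule degree_le) (simp add: coeff_higher_pderiv coeff_eq_0)
  from poly_taylor_at_0[OF this, of s] show ?thesis
    unfolding coeff_eq_higher_pderiv[of p j] by (simp add: funpow_add)
qed

text \<open>The vector field to which the constraint \<open>f = 0\<close> reduces the dynamics \<open>y' = X y - c \<cdot> (0, g y)\<close>,
  whatever the coefficient \<open>c\<close>, and the successive derivatives of \<open>c\<close> with respect to a function
  \<open>s\<close> along the orbit, where \<open>s' = \<kappa> y\<close>.\<close>

definition constraint_coeff ::
  "('a::euclidean_space \<Rightarrow> real) \<Rightarrow> ('a \<Rightarrow> 'a) \<Rightarrow> ('a \<Rightarrow> 'a) \<Rightarrow> 'a \<Rightarrow> real" where
  "constraint_coeff f X g y = frechet_derivative f (at y) (X y) / frechet_derivative f (at y) (g y)"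

primrec constraint_deriv ::
  "('a::euclidean_space \<Rightarrow> real) \<Rightarrow> ('a \<Rightarrow> 'a) \<Rightarrow> ('a \<Rightarrow> 'a) \<Rightarrow> ('a \<Rightarrow> real) \<Rightarrow> nat \<Rightarrow> 'a \<Rightarrow> real" where
  "constraint_deriv f X g \<kappa> 0 = constraint_coeff f X g"
| "constraint_deriv f X g \<kappa> (Suc k) = (\<lambda>y. frechet_derivative (constraint_deriv f X g \<kappa> k) (at y)
     (X y - constraint_coeff f X g y *\<^sub>R g y) / \<kappa> y)"

lemma smooth_on_constraint_deriv:
  assumes W: "open W" and f: "smooth_on W f" and X: "smooth_on W X" and g: "smooth_on W g"
    and \<kappa>: "smooth_on W \<kappa>" "\<And>y. y \<in> W \<Longrightarrow> \<kappa> y \<noteq> 0"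
    and \<mu>: "\<And>y. y \<in> W \<Longrightarrow> frechet_derivative f (at y) (g y) \<noteq> 0"
  shows "smooth_on W (constraint_deriv f X g \<kappa> k)"
proof -
  have 0: "smooth_on W (constraint_coeff f X g)"
    unfolding constraint_coeff_def[abs_def]
    by (intro smooth_on_divide smooth_on_frechet_apply W f X g \<mu>)
  show ?thesis
  proof (induction k)
    case (Suc k)
    have "smooth_on W (\<lambda>y. X y - constraint_coeff f X g y *\<^sub>R g y)"
      by (intro smooth_on_diff smooth_on_scaleR W X g 0)
    then show ?case
      unfolding constraint_deriv.simps
      by (intro smooth_on_divide[OF W _ \<kappa>] smooth_on_frechet_apply[OF W Suc.IH])
  qed (simp add: 0)
qed

text \<open>Differentiating \<open>f (y t) = 0\<close> gives one linear equation for the coefficient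
  \<open>poly p (s t)\<close>, with the unique solution \<open>constraint_coeff\<close>. Substituted
  into the equation of motion, it removes \<open>p\<close> from the right-hand side; so
  differentiating the identity for order \<open>k\<close> along the orbit and dividing by
  \<open>s' = \<kappa>\<close> gives the one for \<open>Suc k\<close>.\<close>

lemma constraint_along_orbit:
  fixes p :: "real poly" and y :: "real \<Rightarrow> 'a::euclidean_space"
  assumes W: "open W" and f: "smooth_on W f" and X: "smooth_on W X" and g: "smooth_on W g"
    and \<kappa>: "smooth_on W \<kappa>" "\<And>y. y \<in> W \<Longrightarrow> \<kappa> y \<noteq> 0"
    and \<mu>: "\<And>y. y \<in> W \<Longrightarrow> frechet_derivative f (at y) (g y) \<noteq> 0"
    and T: "open T" and yW: "\<And>t. t \<in> T \<Longrightarrow> y t \<in> W" and f0: "\<And>t. t \<in> T \<Longrightarrow> f (y t) = 0"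
    and y': "\<And>t. t \<in> T \<Longrightarrow> (y has_vector_derivative X (y t) - poly p (s t) *\<^sub>R g (y t)) (at t)"
    and s': "\<And>t. t \<in> T \<Longrightarrow> (s has_real_derivative \<kappa> (y t)) (at t)"
    and t: "t \<in> T"
  shows "poly ((pderiv ^^ k) p) (s t) = constraint_deriv f X g \<kappa> k (y t)"
proof -
  have c0: "poly p (s t) = constraint_coeff f X g (y t)" if t: "t \<in> T" for t
  proof -
    have D: "(f has_derivative frechet_derivative f (at (y t))) (at (y t))"
      by (rule smooth_on_has_derivative[OF f yW[OF t]])
    have "((\<lambda>t. f (y t)) has_derivative (\<lambda>h. frechet_derivative f (at (y t)) (h *\<^sub>R (X (y t) - poly p (s t) *\<^sub>R g (y t))))) (at t)"
      by (rule has_derivative_compose[OF y'[OF t, unfolded has_vector_derivative_def] D])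
    moreover have "((\<lambda>t. f (y t)) has_derivative (\<lambda>h. 0)) (at t)"
      by (rule has_derivative_transform_within_open[OF has_derivative_const T t]) (simp add: f0)
    ultimately have "frechet_derivative f (at (y t)) (1 *\<^sub>R (X (y t) - poly p (s t) *\<^sub>R g (y t))) = 0"
      using has_derivative_unique by metis
    then have "frechet_derivative f (at (y t)) (X (y t)) = poly p (s t) * frechet_derivative f (at (y t)) (g (y t))"
      using has_derivative_linear[OF D] by (simp add: linear_diff linear_scale)
    then show ?thesis using \<mu>[OF yW[OF t]] by (simp add: constraint_coeff_def)
  qed
  show ?thesis
    using t
  proof (induction k arbitrary: t)
    case 0
    then show ?case using c0 by simp
  next
    case (Suc k)
    define G where "G = constraint_deriv f X g \<kappa>"
    have DG: "(G k has_derivative frechet_derivative (G k) (at (y t))) (at (y t))"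
      unfolding G_def
      by (rule smooth_on_has_derivative[OF smooth_on_constraint_deriv[OF W f X g \<kappa> \<mu>] yW[OF Suc.prems]])
    have "((\<lambda>t. G k (y t)) has_derivative (\<lambda>h. frechet_derivative (G k) (at (y t)) (h *\<^sub>R (X (y t) - poly p (s t) *\<^sub>R g (y t))))) (at t)"
      by (rule has_derivative_compose[OF y'[OF Suc.prems, unfolded has_vector_derivative_def] DG])
    moreover have "((\<lambda>t. G k (y t)) has_derivative (\<lambda>h. poly ((pderiv ^^ Suc k) p) (s t) * \<kappa> (y t) * h)) (at t)"
    proof (rule has_derivative_transform_within_open[OF _ T Suc.prems])
      show "((\<lambda>t. poly ((pderiv ^^ k) p) (s t)) has_derivative (\<lambda>h. poly ((pderiv ^^ Suc k) p) (s t) * \<kappa> (y t) * h)) (at t)"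
        using DERIV_chain2[OF poly_DERIV s'[OF Suc.prems], of "(pderiv ^^ k) p"] by (simp add: has_field_derivative_def)
      show "poly ((pderiv ^^ k) p) (s r) = G k (y r)" if "r \<in> T" for r
        using Suc.IH[OF that] by (simp add: G_def)
    qed
    ultimately have "(\<lambda>h. frechet_derivative (G k) (at (y t)) (h *\<^sub>R (X (y t) - poly p (s t) *\<^sub>R g (y t)))) =
        (\<lambda>h. poly ((pderiv ^^ Suc k) p) (s t) * \<kappa> (y t) * h)"
      by (rule has_derivative_unique)
    from fun_cong[OF this, of 1]
    have "frechet_derivative (G k) (at (y t)) (X (y t) - poly p (s t) *\<^sub>R g (y t)) = poly ((pderiv ^^ Suc k) p) (s t) * \<kappa> (y t)"
      by simp
    then show ?case
      using \<kappa>(2)[OF yW[OF Suc.prems]] c0[OF Suc.prems] by (simp add: G_def)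
  qed
qed

section \<open>Polynomial perturbations of a potential\<close>

context atlas
begin

text \<open>The summand is \<open>P (\<sigma> x)\<close> for the primitive without constant term of
  the polynomial with coefficients \<open>a\<close>; dividing by \<open>Suc (r b)\<close> makes
  \<open>P'\<close> have exactly these coefficients. The function \<open>r\<close> assigns an
  exponent to each coordinate of \<open>a\<close>.\<close>

definition polynomial_potential :: "('m \<Rightarrow> real) \<Rightarrow> ('m \<Rightarrow> real) \<Rightarrow> ('p::euclidean_space \<Rightarrow> nat) \<Rightarrow> 'p \<Rightarrow> 'm \<Rightarrow> real" where
  "polynomial_potential u \<sigma> r a = restrict (\<lambda>x. u x + (\<Sum>b\<in>Basis. (a \<bullet> b) * (\<sigma> x ^ Suc (r b) / Suc (r b)))) (carrier_of A)"

lemma polynomial_potential_in_chart: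
  assumes "d \<in> A" "q \<in> cimg d"
  shows "(u \<circ> cinv d) q + (\<Sum>b\<in>Basis. (a \<bullet> b) * ((\<sigma> \<circ> cinv d) q ^ Suc (r b) / Suc (r b))) = (polynomial_potential u \<sigma> r a \<circ> cinv d) q"
  using assms cinv_in_cdom[OF assms(2)] by (auto simp: polynomial_potential_def carrier_of_def)

lemma smooth_on_monomial:
  assumes "\<sigma> \<in> smooth_functions A" "d \<in> A"
  shows "smooth_on (cimg d) (\<lambda>q. (\<sigma> \<circ> cinv d) q ^ Suc n / Suc n)"
  using smooth_on_mult[OF open_cimg[OF assms(2)] smooth_on_power[OF open_cimg[OF assms(2)] smooth_in_chart[OF assms]] smooth_on_const]
  by (simp only: divide_inverse)

lemma polynomial_potential_smooth:
  assumes "u \<in> smooth_functions A" "\<sigma> \<in> smooth_functions A"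
  shows "polynomial_potential u \<sigma> r a \<in> smooth_functions A"
  unfolding smooth_functions_iff
proof (intro conjI ballI)
  show "polynomial_potential u \<sigma> r a \<in> extensional (carrier_of A)" by (simp add: polynomial_potential_def)
  fix d assume d: "d \<in> A"
  show "smooth_on (cimg d) (polynomial_potential u \<sigma> r a \<circ> cinv d)"
    by (rule smooth_on_cong[OF open_cimg[OF d]], erule polynomial_potential_in_chart[OF d])
      (intro smooth_on_add smooth_on_sum smooth_on_mult smooth_on_const smooth_on_monomial
        smooth_in_chart open_cimg assms d)
qed

lemma iter_deriv_polynomial_potential:
  assumes "u \<in> smooth_functions A" "\<sigma> \<in> smooth_functions A" "d \<in> A" "q \<in> cimg d"
  shows "iter_deriv bs (polynomial_potential u \<sigma> r a \<circ> cinv d) q = iter_deriv bs (u \<circ> cinv d) q +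
    (\<Sum>b\<in>Basis. (a \<bullet> b) * iter_deriv bs (\<lambda>q. (\<sigma> \<circ> cinv d) q ^ Suc (r b) / Suc (r b)) q)"
proof -
  note op = open_cimg[OF assms(3)]
  have sm: "smooth_on (cimg d) (u \<circ> cinv d)"
    "smooth_on (cimg d) (\<lambda>q. \<Sum>b\<in>Basis. (a \<bullet> b) * ((\<sigma> \<circ> cinv d) q ^ Suc (r b) / Suc (r b)))"
    by (intro smooth_on_sum smooth_on_mult smooth_on_const smooth_on_monomial smooth_in_chart op assms)+
  have "iter_deriv bs (polynomial_potential u \<sigma> r a \<circ> cinv d) q =
    iter_deriv bs (\<lambda>q. (u \<circ> cinv d) q + (\<Sum>b\<in>Basis. (a \<bullet> b) * ((\<sigma> \<circ> cinv d) q ^ Suc (r b) / Suc (r b)))) q"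
    by (rule iter_deriv_cong[OF op polynomial_potential_in_chart[OF assms(3)] smooth_on_add[OF op sm] assms(4), symmetric])
  also have "\<dots> = iter_deriv bs (u \<circ> cinv d) q + iter_deriv bs (\<lambda>q. \<Sum>b\<in>Basis. (a \<bullet> b) * ((\<sigma> \<circ> cinv d) q ^ Suc (r b) / Suc (r b))) q"
    by (rule iter_deriv_add[OF op sm assms(4)])
  also have "iter_deriv bs (\<lambda>q. \<Sum>b\<in>Basis. (a \<bullet> b) * ((\<sigma> \<circ> cinv d) q ^ Suc (r b) / Suc (r b))) q =
      (\<Sum>b\<in>Basis. (a \<bullet> b) * iter_deriv bs (\<lambda>q. (\<sigma> \<circ> cinv d) q ^ Suc (r b) / Suc (r b)) q)"
    by (rule iter_deriv_sum[OF op smooth_on_monomial[OF assms(2,3)] assms(4) finite_Basis])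
  finally show ?thesis .
qed

text \<open>The perturbation is linear in \<open>a\<close>, and each of its finitely many monomials
  in \<open>\<sigma>\<close> has bounded derivatives on the compact sets listed in
  \<open>F\<close>.\<close>

lemma polynomial_potential_near:
  fixes r :: "'p::euclidean_space \<Rightarrow> nat"
  assumes "u \<in> smooth_functions A" "\<sigma> \<in> smooth_functions A" "finite F" "F \<subseteq> indices" "e > 0"
  obtains \<delta> where "\<delta> > 0" "\<And>a::'p. norm a < \<delta> \<Longrightarrow> polynomial_potential u \<sigma> r a \<in> nb F e u"
proof -
  define S where "S = (\<lambda>(d :: ('m, 'e) chart, K :: 'e set, bs) q. \<Sum>b\<in>(Basis :: 'p set). \<bar>iter_deriv bs (\<lambda>q. (\<sigma> \<circ> cinv d) q ^ Suc (r b) / Suc (r b)) q\<bar>)"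
  have "\<exists>B\<ge>0. \<forall>q\<in>fst (snd j). S j q \<le> B" if "j \<in> F" for j
  proof -
    obtain d K bs where j: "j = (d, K, bs)" using prod_cases3 by blast
    have d: "d \<in> A" and K: "compact K" "K \<subseteq> cimg d" using that assms(4) by (auto simp: j indices_def)
    have "continuous_on K (S j)"
      unfolding S_def j prod.case
      by (intro continuous_intros continuous_on_subset[OF smooth_on_continuous[OF iter_deriv_smooth_on[OF smooth_on_monomial[OF assms(2) d]]] K(2)])
    from compact_imp_bounded[OF compact_continuous_image[OF this K(1)]]
    obtain B where "\<And>q. q \<in> K \<Longrightarrow> \<bar>S j q\<bar> \<le> B" unfolding bounded_iff by auto
    then show ?thesis by (intro exI[of _ "max B 0"]) (force simp: j)
  qed
  then obtain B where B: "\<And>j. j \<in> F \<Longrightarrow> B j \<ge> 0" "\<And>j q. j \<in> F \<Longrightarrow> q \<in> fst (snd j) \<Longrightarrow> S j q \<le> B j" by metis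
  \<comment> \<open>The sum over \<open>F\<close> dominates the bound for each single seminorm; the
    summand 1 keeps the denominator positive even if all bounds are 0.\<close>
  define \<delta> where "\<delta> = e / (sum B F + 1)"
  have pos: "sum B F + 1 > 0" using sum_nonneg[of F B] B(1) by fastforce
  show ?thesis
  proof
    show "\<delta> > 0" using pos assms(5) by (simp add: \<delta>_def)
    fix a :: 'p assume a: "norm a < \<delta>"
    show "polynomial_potential u \<sigma> r a \<in> nb F e u"
    proof (rule nbI[OF polynomial_potential_smooth[OF assms(1,2)]])
      fix d K bs q assume j: "(d, K, bs) \<in> F" and q: "q \<in> K"
      have d: "d \<in> A" "q \<in> cimg d" using j q assms(4) by (auto simp: indices_def)
      define D where "D b = iter_deriv bs (\<lambda>q. (\<sigma> \<circ> cinv d) q ^ Suc (r b) / Suc (r b)) q" for b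
      have "\<bar>iter_deriv bs (polynomial_potential u \<sigma> r a \<circ> cinv d) q - iter_deriv bs (u \<circ> cinv d) q\<bar> = \<bar>\<Sum>b\<in>Basis. (a \<bullet> b) * D b\<bar>"
        using iter_deriv_polynomial_potential[OF assms(1,2) d, of bs r a] by (simp add: D_def)
      also have "\<dots> \<le> (\<Sum>b\<in>Basis. \<bar>(a \<bullet> b) * D b\<bar>)" by (rule sum_abs)
      also have "\<dots> \<le> (\<Sum>b\<in>Basis. norm a * \<bar>D b\<bar>)"
        by (intro sum_mono) (simp add: abs_mult mult_right_mono Basis_le_norm)
      also have "\<dots> = norm a * S (d, K, bs) q" by (simp add: S_def D_def sum_distrib_left)
      also have "\<dots> \<le> norm a * (sum B F + 1)"
      proof (rule mult_left_mono)
        have "S (d, K, bs) q \<le> B (d, K, bs)" using B(2)[OF j] q by simp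
        also have "\<dots> \<le> sum B F" by (rule member_le_sum[OF j]) (use B(1) assms(3) in auto)
        finally show "S (d, K, bs) q \<le> sum B F + 1" by simp
      qed simp
      also have "\<dots> \<le> \<delta> * (sum B F + 1)" using a pos by (intro mult_right_mono) auto
      also have "\<dots> = e" using pos by (simp add: \<delta>_def)
      finally show "\<bar>iter_deriv bs (polynomial_potential u \<sigma> r a \<circ> cinv d) q - iter_deriv bs (u \<circ> cinv d) q\<bar> \<le> e" .
    qed
  qed
qed

lemma grad_polynomial_potential:
  fixes r :: "'p::euclidean_space \<Rightarrow> nat"
  assumes u: "u \<in> smooth_functions A" and \<sigma>: "\<sigma> \<in> smooth_functions A" and d: "d \<in> A" "q \<in> cimg d"
  shows "grad (polynomial_potential u \<sigma> r a \<circ> cinv d) q = grad (u \<circ> cinv d) q +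
    poly (\<Sum>b\<in>Basis. monom (a \<bullet> b) (r b)) ((\<sigma> \<circ> cinv d) q) *\<^sub>R grad (\<sigma> \<circ> cinv d) q"
proof -
  define P where "P = (\<Sum>b\<in>Basis. monom (a \<bullet> b) (r b))"
  define Du where "Du = frechet_derivative (u \<circ> cinv d) (at q)"
  define Ds where "Ds = frechet_derivative (\<sigma> \<circ> cinv d) (at q)"
  have u': "(u \<circ> cinv d has_derivative Du) (at q)" and s': "(\<sigma> \<circ> cinv d has_derivative Ds) (at q)"
    unfolding Du_def Ds_def by (rule smooth_on_has_derivative[OF smooth_in_chart[OF _ d(1)] d(2)]; fact)+
  have mono: "((\<lambda>q. (\<sigma> \<circ> cinv d) q ^ Suc n / Suc n) has_derivative (\<lambda>v. (\<sigma> \<circ> cinv d) q ^ n * Ds v)) (at q)" for n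
    using has_derivative_divide'[OF has_derivative_power[OF s', of "Suc n"] has_derivative_const[of "real (Suc n)"]]
    by (rule has_derivative_eq_rhs) (auto simp: fun_eq_iff field_simps simp del: of_nat_Suc)
  have "((\<lambda>q. (u \<circ> cinv d) q + (\<Sum>b\<in>Basis. (a \<bullet> b) * ((\<sigma> \<circ> cinv d) q ^ Suc (r b) / Suc (r b)))) has_derivative
      (\<lambda>v. Du v + (\<Sum>b\<in>Basis. (a \<bullet> b) * ((\<sigma> \<circ> cinv d) q ^ r b * Ds v)))) (at q)"
    by (intro has_derivative_add u' has_derivative_sum has_derivative_mult_right mono)
  from has_derivative_transform_within_open[OF this open_cimg[OF d(1)] d(2) polynomial_potential_in_chart[OF d(1)]]
  have "(polynomial_potential u \<sigma> r a \<circ> cinv d has_derivative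
      (\<lambda>v. Du v + (\<Sum>b\<in>Basis. (a \<bullet> b) * ((\<sigma> \<circ> cinv d) q ^ r b * Ds v)))) (at q)" .
  from frechet_derivative_at[OF this, symmetric]
  have "frechet_derivative (polynomial_potential u \<sigma> r a \<circ> cinv d) (at q) v =
      Du v + (\<Sum>b\<in>Basis. (a \<bullet> b) * ((\<sigma> \<circ> cinv d) q ^ r b * Ds v))" for v by (rule fun_cong)
  moreover have "(\<Sum>b\<in>Basis. (a \<bullet> b) * ((\<sigma> \<circ> cinv d) q ^ r b * Ds v)) = poly P ((\<sigma> \<circ> cinv d) q) * Ds v" for v
    by (simp add: P_def poly_sum poly_monom sum_distrib_right mult.assoc)
  ultimately show ?thesis
    unfolding P_def[symmetric] grad_def Du_def[symmetric] Ds_def[symmetric]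
    by (simp add: scaleR_left_distrib sum.distrib scaleR_sum_right)
qed

text \<open>If the perturbation with coefficients \<open>a\<close> admits a segment, then
  \<open>a\<close> is the value at some point of \<open>W\<close> of a smooth map
  \<open>\<Psi>\<close> which is built from \<open>u\<close>, \<open>\<sigma>\<close>,
  \<open>f\<close> and \<open>h\<close> alone. Such values form a null set, so there are arbitrarily
  small \<open>a\<close> without a segment.\<close>

lemma segments_nowhere_dense:
  fixes f :: "'e \<times> 'e \<Rightarrow> real"
  assumes c: "c \<in> A" and h: "smooth_on (cimg c \<times> UNIV) h" and W: "open W" "Q \<subseteq> W" "W \<subseteq> cimg c \<times> UNIV"
    and f: "smooth_on W f" "\<And>y. y \<in> Q \<Longrightarrow> f y = 0" and \<sigma>: "\<sigma> \<in> smooth_functions A"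
    and \<mu>: "\<And>y. y \<in> W \<Longrightarrow> frechet_derivative f (at y) (0, grad (\<sigma> \<circ> cinv c) (fst y)) \<noteq> 0"
    and \<kappa>: "\<And>y. y \<in> W \<Longrightarrow> frechet_derivative (\<sigma> \<circ> cinv c) (at (fst y)) (fst (hamiltonian_vector h y)) \<noteq> 0"
    and \<tau>: "\<tau> > 0"
    and u: "u \<in> smooth_functions A" and F: "finite F" "F \<subseteq> indices" and e: "e > 0"
  shows "\<exists>v\<in>nb F e u. v \<notin> segments c h Q \<tau>"
proof -
  \<comment> \<open>The number of coefficients of \<open>P'\<close> and at the same time the
    dimension of the parameter space, one more than that of phase space.\<close>
  define n where "n = DIM('e \<times> 'e \<times> real)"
  obtain r :: "'e \<times> 'e \<times> real \<Rightarrow> nat" where r: "bij_betw r Basis {0..<n}"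
    using ex_bij_betw_finite_nat[of "Basis :: ('e \<times> 'e \<times> real) set"] unfolding n_def by auto
  define s where "s y = (\<sigma> \<circ> cinv c) (fst y)" for y :: "'e \<times> 'e"
  define X where "X y = hamiltonian_vector h y - (0, grad (u \<circ> cinv c) (fst y))" for y
  define g where "g y = (0 :: 'e, grad (\<sigma> \<circ> cinv c) (fst y))" for y :: "'e \<times> 'e"
  define k where "k y = frechet_derivative (\<sigma> \<circ> cinv c) (at (fst y)) (fst (hamiltonian_vector h y))" for y
  define G where "G = constraint_deriv f X g k"
  define p where "p a = (\<Sum>b\<in>Basis. monom (a \<bullet> b) (r b))" for a :: "'e \<times> 'e \<times> real"
  \<comment> \<open>The coefficients which a segment through \<open>y\<close> would force on
    \<open>P'\<close>: the formula of \<open>coeff_via_taylor\<close> with \<open>G m\<close> in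
    place of the derivative of order \<open>m\<close> of \<open>P'\<close>.\<close>
  define \<Psi> where "\<Psi> y = (\<Sum>b\<in>Basis. ((\<Sum>m<n. G (m + r b) y * (- s y) ^ m / fact m) / fact (r b)) *\<^sub>R b)" for y
  have op: "open (cimg c)" "open (cimg c \<times> (UNIV :: 'e set))" using open_cimg[OF c] by (auto simp: open_Times)
  have sm_s: "smooth_on (cimg c \<times> UNIV) s"
    unfolding s_def[abs_def] by (rule smooth_on_comp_fst[OF op(1) smooth_in_chart[OF \<sigma> c]])
  have sm_g: "smooth_on (cimg c \<times> UNIV) g"
    unfolding g_def[abs_def]
    by (intro smooth_on_Pair smooth_on_const op smooth_on_comp_fst smooth_on_grad smooth_in_chart[OF \<sigma> c])
  have sm_X: "smooth_on (cimg c \<times> UNIV) X"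
    unfolding X_def[abs_def]
    by (intro smooth_on_diff smooth_on_Pair smooth_on_const op smooth_on_comp_fst smooth_on_grad smooth_in_chart[OF u c] smooth_on_hamiltonian_vector h)
  have sm_k: "smooth_on (cimg c \<times> UNIV) k"
  proof (rule smooth_on_cong[OF op(2)])
    show "smooth_on (cimg c \<times> UNIV) (\<lambda>y. grad (\<sigma> \<circ> cinv c) (fst y) \<bullet> fst (hamiltonian_vector h y))"
      by (intro smooth_on_inner smooth_on_fst smooth_on_comp_fst op smooth_on_grad smooth_in_chart[OF \<sigma> c] smooth_on_hamiltonian_vector h)
    show "grad (\<sigma> \<circ> cinv c) (fst y) \<bullet> fst (hamiltonian_vector h y) = k y" if "y \<in> cimg c \<times> UNIV" for y
      unfolding k_def by (rule inner_grad[OF smooth_on_differentiable[OF smooth_in_chart[OF \<sigma> c]]]) (use that in auto)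
  qed
  note sm = W(1) f(1) smooth_on_subset[OF sm_X W(3)] smooth_on_subset[OF sm_g W(3)] smooth_on_subset[OF sm_k W(3)]
  have k0: "k y \<noteq> 0" if "y \<in> W" for y using \<kappa>[OF that] by (simp add: k_def)
  have g0: "frechet_derivative f (at y) (g y) \<noteq> 0" if "y \<in> W" for y using \<mu>[OF that] by (simp add: g_def)
  have sm_G: "smooth_on W (G m)" for m
    unfolding G_def by (rule smooth_on_constraint_deriv[OF sm k0 g0])
  have sm_G': "smooth_on W (\<lambda>y. G m y * (- s y) ^ j / fact j)" for m j
    using smooth_on_mult[OF W(1) smooth_on_mult[OF W(1) sm_G smooth_on_power[OF W(1) smooth_on_minus[OF W(1) smooth_on_subset[OF sm_s W(3)]]]] smooth_on_const]
    by (simp only: divide_inverse)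
  have "smooth_on W (\<lambda>y. (\<Sum>m<n. G (m + j) y * (- s y) ^ m / fact m) * inverse (fact j))" for j
    by (intro smooth_on_mult[OF W(1)] smooth_on_sum[OF W(1)] sm_G' smooth_on_const)
  then have "smooth_on W (\<lambda>y. (\<Sum>m<n. G (m + j) y * (- s y) ^ m / fact m) / fact j)" for j
    by (simp only: divide_inverse)
  then have "smooth_on W \<Psi>"
    unfolding \<Psi>_def[abs_def] by (intro smooth_on_sum smooth_on_scaleR smooth_on_const W(1))
  then have "\<Psi> differentiable_on W"
    using smooth_on_differentiable by (auto simp: differentiable_on_def intro: differentiable_at_withinI)
  then have neg: "negligible (\<Psi> ` W)"
    by (intro negligible_differentiable_image_lowdim) simp_all
  obtain \<delta> where \<delta>: "\<delta> > 0" "\<And>a. norm a < \<delta> \<Longrightarrow> polynomial_potential u \<sigma> r a \<in> nb F e u"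
    using polynomial_potential_near[OF u \<sigma> F e] by blast
  \<comment> \<open>A nonempty ball is not negligible, so it contains coefficients outside of the
    null set.\<close>
  have "\<not> ball 0 \<delta> \<subseteq> \<Psi> ` W"
    using neg open_not_negligible[of "ball (0 :: 'e \<times> 'e \<times> real) \<delta>"] negligible_subset \<delta>(1) by auto
  then obtain a where a: "norm a < \<delta>" "a \<notin> \<Psi> ` W" by (auto simp: subset_iff)
  define w where "w = polynomial_potential u \<sigma> r a"
  have "w \<notin> segments c h Q \<tau>"
  proof
    assume "w \<in> segments c h Q \<tau>"
    then obtain y where yQ: "\<And>t. t \<in> {0..\<tau>} \<Longrightarrow> y t \<in> Q"
      and y': "\<And>t. t \<in> {0..\<tau>} \<Longrightarrow> (y has_vector_derivative hamiltonian_vector h (y t) - (0, grad (w \<circ> cinv c) (fst (y t)))) (at t within {0..\<tau>})"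
      unfolding segments_def by blast
    define T where "T = {0<..<\<tau>}"
    have TI: "t \<in> {0..\<tau>}" if "t \<in> T" for t using that by (auto simp: T_def)
    have yc: "fst (y t) \<in> cimg c" if "t \<in> T" for t using yQ[OF TI[OF that]] W(2,3) by auto
    have Y: "(y has_vector_derivative X (y t) - poly (p a) (s (y t)) *\<^sub>R g (y t)) (at t)" if t: "t \<in> T" for t
    proof -
      have "(y has_vector_derivative hamiltonian_vector h (y t) - (0, grad (w \<circ> cinv c) (fst (y t)))) (at t)"
        using y'[OF TI[OF t]] t at_within_interior[of t "{0..\<tau>}"] by (simp add: T_def)
      moreover have "hamiltonian_vector h (y t) - (0, grad (w \<circ> cinv c) (fst (y t))) = X (y t) - poly (p a) (s (y t)) *\<^sub>R g (y t)"
        unfolding w_def grad_polynomial_potential[OF u \<sigma> c yc[OF t]] X_def g_def s_def p_def by (simp add: algebra_simps)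
      ultimately show ?thesis by simp
    qed
    \<comment> \<open>The perturbation has no position component, so \<open>s\<close> moves at the
      speed \<open>k\<close> of the unperturbed system, in which \<open>a\<close> does not
      occur.\<close>
    have S: "((\<lambda>t. s (y t)) has_real_derivative k (y t)) (at t)" if t: "t \<in> T" for t
    proof -
      have D: "(\<sigma> \<circ> cinv c has_derivative frechet_derivative (\<sigma> \<circ> cinv c) (at (fst (y t)))) (at (fst (y t)))"
        by (rule smooth_on_has_derivative[OF smooth_in_chart[OF \<sigma> c] yc[OF t]])
      have "((\<lambda>t. (\<sigma> \<circ> cinv c) (fst (y t))) has_derivative
         (\<lambda>h'. frechet_derivative (\<sigma> \<circ> cinv c) (at (fst (y t))) (fst (h' *\<^sub>R (X (y t) - poly (p a) (s (y t)) *\<^sub>R g (y t)))))) (at t)"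
        by (rule has_derivative_compose[OF has_derivative_fst[OF Y[OF t, unfolded has_vector_derivative_def]] D])
      moreover have "frechet_derivative (\<sigma> \<circ> cinv c) (at (fst (y t))) (fst (h' *\<^sub>R (X (y t) - poly (p a) (s (y t)) *\<^sub>R g (y t)))) = k (y t) * h'" for h'
      proof -
        have "fst (h' *\<^sub>R (X (y t) - poly (p a) (s (y t)) *\<^sub>R g (y t))) = h' *\<^sub>R fst (hamiltonian_vector h (y t))"
          by (simp add: X_def g_def)
        then show ?thesis
          unfolding k_def by (simp only: linear_scale[OF has_derivative_linear[OF D]] real_scaleR_def mult.commute)
      qed
      ultimately show ?thesis
        unfolding has_field_derivative_def s_def[abs_def] by (simp only:)
    qed
    \<comment> \<open>Any interior time would do: the identities between derivatives hold on the
      open interval \<open>T\<close> and are read off at one point of it.\<close>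
    define t where "t = \<tau> / 2"
    have t: "t \<in> T" using \<tau> by (simp add: t_def T_def)
    have yW: "y t \<in> W" if "t \<in> T" for t using yQ[OF TI[OF that]] W(2) by blast
    have f0: "f (y t) = 0" if "t \<in> T" for t by (rule f(2)[OF yQ[OF TI[OF that]]])
    have T: "open T" by (simp add: T_def)
    have G: "poly ((pderiv ^^ m) (p a)) (s (y t)) = G m (y t)" for m
      unfolding G_def
      by (rule constraint_along_orbit[where s = "\<lambda>t. s (y t)", OF sm k0 g0 T yW f0 Y S t])
    have coeff_p: "coeff (p a) (r b) = a \<bullet> b" if "b \<in> Basis" for b
    proof -
      have "coeff (p a) (r b) = (\<Sum>b'\<in>Basis. if b' = b then a \<bullet> b' else 0)"
        unfolding p_def coeff_sum coeff_monom
        by (rule sum.cong) (use bij_betw_imp_inj_on[OF r] that in \<open>auto dest: inj_onD\<close>)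
      then show ?thesis using that by simp
    qed
    have "degree (p a) \<le> n - 1"
    proof (rule degree_le, intro allI impI)
      fix i assume "n - 1 < i"
      then have "r b \<noteq> i" if "b \<in> Basis" for b
        using bij_betwE[OF r] that by fastforce
      then show "coeff (p a) i = 0" unfolding p_def coeff_sum coeff_monom by (intro sum.neutral) auto
    qed
    moreover have "n > 0" by (simp add: n_def)
    ultimately have deg: "degree (p a) < n" by linarith
    have "\<Psi> (y t) = (\<Sum>b\<in>Basis. (a \<bullet> b) *\<^sub>R b)"
      unfolding \<Psi>_def
    proof (rule sum.cong[OF refl])
      fix b :: "'e \<times> 'e \<times> real" assume "b \<in> Basis"
      then have "(\<Sum>m<n. G (m + r b) (y t) * (- s (y t)) ^ m / fact m) / fact (r b) = a \<bullet> b"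
        using coeff_via_taylor[OF deg, of "r b" "s (y t)"] coeff_p[of b] G by simp
      then show "((\<Sum>m<n. G (m + r b) (y t) * (- s (y t)) ^ m / fact m) / fact (r b)) *\<^sub>R b = (a \<bullet> b) *\<^sub>R b" by simp
    qed
    then have "\<Psi> (y t) = a" by (simp add: euclidean_representation)
    then show False using a(2) yW[OF t] by blast
  qed
  then show ?thesis using \<delta>(2)[OF a(1)] unfolding w_def by blast
qed

end

section \<open>Submanifolds transversal to the vertical\<close>

context atlas
begin

text \<open>Makes the straightening charts of a submanifold available to the calculus of the locale,
  although they need not belong to the given atlas.\<close>

lemma atlas_insert_admissible:
  assumes "admissible_chart A d"
  shows "atlas (insert d A)"
proof
  have d: "inj_on (cmap d) (cdom d)" "open (cimg d)" "\<And>c. c \<in> A \<Longrightarrow> smooth_transition c d \<and> smooth_transition d c"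
    using assms unfolding admissible_chart_def by blast+
  have "smooth_on (cimg d) (cmap d \<circ> cinv d)"
    by (rule smooth_on_cong[OF d(2) _ smooth_on_ident]) (simp add: cinv_def cimg_def f_inv_into_f)
  then have dd: "smooth_transition d d"
    using d(2) by (simp add: smooth_transition_def cimg_def)
  fix c assume "c \<in> insert d A"
  then have c: "c = d \<or> c \<in> A" by blast
  then show "inj_on (cmap c) (cdom c)" using d(1) inj_chart[of c] by metis
  show "open (cimg c)" using c d(2) open_cimg[of c] by metis
  fix c' assume "c' \<in> insert d A"
  then have "c' = d \<or> c' \<in> A" by blast
  then show "smooth_transition c c'" using c dd d(3) transition[of c c'] by metis
qed

text \<open>The tangent map is computed in an arbitrarily chosen chart \<open>c'\<close>, so the
  position component is first seen to vanish there. It then vanishes in the given chart, because the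
  position part of a transition between canonical charts depends on the position only.\<close>

lemma vertical_in_chart:
  assumes c: "c \<in> A" and z: "z \<in> cdom (cotangent_chart A c)" and w: "w \<in> vertical_space A z"
  shows "fst (w (cotangent_chart A c)) = 0"
proof -
  interpret T: atlas "cotangent_atlas A" by (rule atlas_cotangent)
  define cc where "cc = cotangent_chart A c"
  define c' where "c' = (SOME c. c \<in> charts_at (cotangent_atlas A) z)"
  have cc: "cc \<in> charts_at (cotangent_atlas A) z"
    using c z by (simp add: charts_at_def cotangent_atlas_def cc_def)
  then have c': "c' \<in> charts_at (cotangent_atlas A) z"
    unfolding c'_def by (rule someI)
  then obtain c0 where c0: "c0 \<in> A" "c' = cotangent_chart A c0" "z \<in> cdom (cotangent_chart A c0)"
    unfolding charts_at_def cotangent_atlas_def by blast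
  have fz: "fst z \<in> cdom c0" "fst z \<in> cdom c" using c0(3) z by (simp_all add: cotangent_chart_simps)
  have wT: "w \<in> tangent_space (cotangent_atlas A) z" and
    "differential_at (cotangent_atlas A) A fst z w = (\<lambda>_. 0)"
    using w unfolding vertical_space_def by blast+
  from fun_cong[OF this(2), of c0]
  have 0: "frechet_derivative (cmap c0 \<circ> fst \<circ> cinv c') (at (cmap c' z)) (w c') = 0"
    using charts_atI[OF c0(1) fz(1)] by (simp add: differential_at_def Let_def c'_def)
  have op: "open (cimg c0 \<times> (UNIV :: 'e set))" using open_cimg[OF c0(1)] by (simp add: open_Times)
  have z0: "cmap c' z \<in> cimg c0 \<times> UNIV"
    using T.cmap_in_cimg[OF c0(3)] cimg_cotangent_chart[OF c0(1)] c0(2) by simp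
  have "(cmap c0 \<circ> fst \<circ> cinv c' has_derivative fst) (at (cmap c' z))"
  proof (rule has_derivative_transform_within_open[OF _ op z0])
    show "(fst has_derivative fst) (at (cmap c' z))" by (rule has_derivative_fst[OF has_derivative_ident])
    show "fst y = (cmap c0 \<circ> fst \<circ> cinv c') y" if "y \<in> cimg c0 \<times> UNIV" for y
      using that cotangent_chart_inverse(3)[OF c0(1), of "fst y" "snd y"] cmap_cinv[of "fst y" c0]
      by (simp add: c0(2) mem_Times_iff)
  qed
  from frechet_derivative_at[OF this] 0 have fw: "fst (w c') = 0" by simp
  define D where "D = frechet_derivative (cmap cc \<circ> cinv c') (at (cmap c' z))"
  define E where "E = frechet_derivative (cmap c \<circ> cinv c0) (at (cmap c0 (fst z)))"
  have wcc: "w cc = D (w c')"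
    using wT cc c' unfolding tangent_space_def D_def by blast
  have "(cmap cc \<circ> cinv c' has_derivative D) (at (cmap c' z))"
    unfolding D_def by (rule T.transition_has_derivative) (use cc c' in \<open>auto simp: charts_at_def\<close>)
  then have D1: "((\<lambda>y. fst ((cmap cc \<circ> cinv c') y)) has_derivative (\<lambda>v. fst (D v))) (at (cmap c' z))"
    by (rule has_derivative_fst)
  have fst_z: "fst (cmap c' z) = cmap c0 (fst z)" unfolding c0(2) by (cases z) (simp add: cotangent_chart_simps)
  have E0: "(cmap c \<circ> cinv c0 has_derivative E) (at (fst (cmap c' z)))"
    unfolding E_def fst_z by (rule transition_has_derivative[OF c0(1) c fz])
  have "((\<lambda>y. (cmap c \<circ> cinv c0) (fst y)) has_derivative (\<lambda>v. E (fst v))) (at (cmap c' z))"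
    by (rule has_derivative_compose[OF has_derivative_fst[OF has_derivative_ident] E0])
  then have D2: "((\<lambda>y. fst ((cmap cc \<circ> cinv c') y)) has_derivative (\<lambda>v. E (fst v))) (at (cmap c' z))"
  proof (rule has_derivative_transform_within_open)
    show "open (cmap c0 ` (cdom c0 \<inter> cdom c) \<times> (UNIV :: 'e set))"
      using open_overlap[OF c0(1) c] by (simp add: open_Times)
    have "fst (cmap c' z) \<in> cmap c0 ` (cdom c0 \<inter> cdom c)" unfolding fst_z using fz by blast
    then show "cmap c' z \<in> cmap c0 ` (cdom c0 \<inter> cdom c) \<times> UNIV" by (simp add: mem_Times_iff)
    show "(cmap c \<circ> cinv c0) (fst y) = fst ((cmap cc \<circ> cinv c') y)" if "y \<in> cmap c0 ` (cdom c0 \<inter> cdom c) \<times> UNIV" for y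
      unfolding cc_def c0(2) cotangent_transition[OF c0(1) c that] by simp
  qed
  from fun_cong[OF has_derivative_unique[OF D1 D2], of "w c'"]
  have "fst (D (w c')) = E 0" using fw by simp
  then show ?thesis using wcc linear_0[OF has_derivative_linear[OF E0]] unfolding cc_def by simp
qed

text \<open>Take \<open>f = a \<bullet> d\<close> for a straightening chart \<open>d\<close> and a
  vector \<open>a\<close> orthogonal to the subspace that \<open>N\<close> becomes. The differential
  of \<open>f\<close> kills the tangent vectors of \<open>N\<close>; if it also killed the vertical,
  transversality would make it 0, contrary to \<open>a \<noteq> 0\<close> and the invertibility of
  the transition.\<close>

lemma slice_function:
  assumes N: "submanifold (cotangent_atlas A) k N" "k < DIM('e \<times> 'e)" "transversal_to_vertical A N"
    and c: "c \<in> A" and z: "z \<in> N" "z \<in> cdom (cotangent_chart A c)"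
  obtains V and f :: "'e \<times> 'e \<Rightarrow> real" and p where
    "open V" "cmap (cotangent_chart A c) z \<in> V" "V \<subseteq> cimg c \<times> UNIV" "smooth_on V f"
    "\<And>y. y \<in> V \<Longrightarrow> cinv (cotangent_chart A c) y \<in> N \<Longrightarrow> f y = 0"
    "frechet_derivative f (at (cmap (cotangent_chart A c) z)) (0, p) \<noteq> 0"
proof -
  define B where "B = cotangent_atlas A"
  define cc where "cc = cotangent_chart A c"
  obtain d S where d: "admissible_chart B d" "z \<in> cdom d" and S: "subspace S" "dim S = k" "cmap d ` (N \<inter> cdom d) = cimg d \<inter> S"
    using N(1) z(1) unfolding submanifold_def B_def by metis
  interpret T0: atlas B unfolding B_def by (rule atlas_cotangent)
  interpret T: atlas "insert d B" by (rule T0.atlas_insert_admissible[OF d(1)])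
  have ccB: "cc \<in> B" using c by (simp add: B_def cc_def cotangent_atlas_def)
  then have cc: "cc \<in> insert d B" and dB: "d \<in> insert d B" by simp_all
  have zcc: "z \<in> cdom cc" using z by (simp add: cc_def)
  \<comment> \<open>The positive codimension provides a normal direction. If the codimension exceeds
    1, the hypersurface is strictly larger than \<open>N\<close>, which is harmless.\<close>
  obtain a where a: "a \<noteq> 0" "\<And>y. y \<in> span S \<Longrightarrow> orthogonal a y"
    using orthogonal_to_subspace_exists[of S] S(2) N(2) by auto
  define V where "V = cmap cc ` (cdom cc \<inter> cdom d)"
  define f where "f = (\<lambda>x. a \<bullet> cmap d x) \<circ> cinv cc"
  define Df where "Df = frechet_derivative f (at (cmap cc z))"
  have V: "open V" "cmap cc z \<in> V" unfolding V_def using T.open_overlap[OF cc dB] zcc d(2) by auto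
  have "V \<subseteq> cimg cc" by (auto simp: V_def cimg_def)
  then have Vc: "V \<subseteq> cimg c \<times> UNIV" using cimg_cotangent_chart[OF c] by (simp add: cc_def)
  have smf: "smooth_on V f"
  proof (rule smooth_on_cong[OF V(1)])
    show "smooth_on V (\<lambda>y. a \<bullet> (cmap d \<circ> cinv cc) y)"
      using T.smooth_on_transition[OF cc dB] V(1) unfolding V_def by (intro smooth_on_inner smooth_on_const)
  qed (simp add: f_def)
  have f0: "f y = 0" if y: "y \<in> V" "cinv cc y \<in> N" for y
  proof -
    have "cinv cc y \<in> N \<inter> cdom d" using y T.cinv_cmap[OF cc] by (auto simp: V_def)
    then have "cmap d (cinv cc y) \<in> S" using S(3) by blast
    then have "orthogonal a (cmap d (cinv cc y))" using a(2) span_base by blast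
    then show ?thesis by (simp add: f_def orthogonal_def)
  qed
  have Df: "(f has_derivative Df) (at (cmap cc z))"
    unfolding Df_def by (rule smooth_on_has_derivative[OF smf V(2)])
  have "\<exists>p. Df (0, p) \<noteq> 0"
  proof (rule ccontr)
    assume "\<not> ?thesis"
    then have vert: "Df (0, p) = 0" for p by blast
    have tang: "Df (v cc) = 0" if v: "v \<in> submanifold_tangent_space B N z" for v
    proof -
      from v obtain \<gamma> \<epsilon> where v_eq: "v = velocity B \<gamma> 0" and \<epsilon>: "\<epsilon> > 0"
        and sm: "smooth_map (std_atlas {-\<epsilon><..<\<epsilon>}) B \<gamma>" and \<gamma>N: "\<gamma> ` {-\<epsilon><..<\<epsilon>} \<subseteq> N" and \<gamma>0: "\<gamma> 0 = z"
        unfolding submanifold_tangent_space_def by blast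
      define I where "I = {-\<epsilon><..<\<epsilon>}"
      define U where "U = {x \<in> I. \<gamma> x \<in> cdom cc}"
      have chart: "cinv (I, \<lambda>x. x) x = x" if "x \<in> I" for x
        using that inv_into_f_f[of "\<lambda>x. x" I x] by (simp add: cinv_def)
      have "open ((\<lambda>x. x) ` U) \<and> smooth_on ((\<lambda>x. x) ` U) (cmap cc \<circ> \<gamma> \<circ> cinv (I, \<lambda>x. x))"
        using sm ccB unfolding smooth_map_def std_atlas_def I_def[symmetric] U_def by simp
      then have U: "open U" "smooth_on U (cmap cc \<circ> \<gamma> \<circ> cinv (I, \<lambda>x. x))" by simp_all
      have smg: "smooth_on U (cmap cc \<circ> \<gamma>)"
        by (rule smooth_on_cong[OF U(1) _ U(2)]) (simp add: U_def chart)
      have U0: "0 \<in> U" using \<epsilon> zcc by (simp add: U_def I_def \<gamma>0)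
      have "(cmap cc \<circ> \<gamma>) differentiable (at 0)" by (rule smooth_on_differentiable[OF smg U0])
      then have vd: "(cmap cc \<circ> \<gamma> has_vector_derivative vector_derivative (cmap cc \<circ> \<gamma>) (at 0)) (at 0)"
        by (simp add: vector_derivative_works)
      have vcc: "v cc = vector_derivative (cmap cc \<circ> \<gamma>) (at 0)"
        using ccB zcc by (simp add: v_eq velocity_def charts_at_def \<gamma>0)
      have Df': "(f has_derivative Df) (at ((cmap cc \<circ> \<gamma>) 0))" using Df by (simp add: \<gamma>0)
      have 1: "((\<lambda>t. f ((cmap cc \<circ> \<gamma>) t)) has_derivative (\<lambda>h. Df (h *\<^sub>R v cc))) (at 0)"
        unfolding vcc by (rule has_derivative_compose[OF vd[unfolded has_vector_derivative_def] Df'])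
      have 2: "((\<lambda>t. f ((cmap cc \<circ> \<gamma>) t)) has_derivative (\<lambda>h. 0)) (at 0)"
      proof (rule has_derivative_transform_within_open[OF has_derivative_const])
        show "open (U \<inter> (cmap cc \<circ> \<gamma>) -` V)"
          by (rule continuous_open_preimage[OF smooth_on_continuous[OF smg] U(1) V(1)])
        show "0 \<in> U \<inter> (cmap cc \<circ> \<gamma>) -` V" using U0 V(2) by (simp add: \<gamma>0)
        show "0 = f ((cmap cc \<circ> \<gamma>) t)" if "t \<in> U \<inter> (cmap cc \<circ> \<gamma>) -` V" for t
        proof -
          have "\<gamma> t \<in> cdom cc" "\<gamma> t \<in> N" using that \<gamma>N by (auto simp: U_def I_def)
          then have "cinv cc (cmap cc (\<gamma> t)) \<in> N" using T.cinv_cmap[OF cc] by simp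
          then show ?thesis using f0[of "cmap cc (\<gamma> t)"] that by simp
        qed
      qed
      from fun_cong[OF has_derivative_unique[OF 1 2], of 1] show ?thesis by simp
    qed
    have ccz: "cc \<in> charts_at B z" using ccB zcc by (simp add: charts_at_def)
    have all: "Df x = 0" for x
    proof -
      have "coord_vector B z cc x \<in> tangent_space B z" by (rule T0.coord_vector_in_tangent_space[OF ccz])
      also have "tangent_space B z = {\<lambda>c. v c + w c | v w. v \<in> submanifold_tangent_space B N z \<and> w \<in> vertical_space A z}"
        using bspec[OF N(3)[unfolded transversal_to_vertical_def] z(1)] unfolding B_def by (rule sym)
      finally obtain v w where vw: "coord_vector B z cc x = (\<lambda>c. v c + w c)"
        "v \<in> submanifold_tangent_space B N z" "w \<in> vertical_space A z"
        unfolding mem_Collect_eq by (elim exE conjE)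
      have "x = v cc + w cc" using fun_cong[OF vw(1), of cc] T0.coord_vector_same[OF ccz] by simp
      moreover have "w cc = (0, snd (w cc))"
        using vertical_in_chart[OF c z(2) vw(3)] by (simp add: cc_def prod_eq_iff)
      moreover have "Df (v cc + w cc) = Df (v cc) + Df (w cc)"
        by (rule linear_add[OF has_derivative_linear[OF Df]])
      ultimately show ?thesis
        using tang[OF vw(2)] vert[of "snd (w cc)"] by simp
    qed
    \<comment> \<open>In the straightening chart the differential is pairing with \<open>a\<close>,
      so evaluating it at the preimage of \<open>a\<close> under the transition gives
      \<open>a \<bullet> a\<close>.\<close>
    have rd: "((\<lambda>x. a \<bullet> cmap d x) \<circ> cinv d has_derivative (\<lambda>v. a \<bullet> v)) (at (cmap d z))"
    proof (rule has_derivative_transform_within_open[OF _ T.open_cimg[OF dB] T.cmap_in_cimg[OF d(2)]])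
      show "((\<lambda>v. a \<bullet> v) has_derivative (\<lambda>v. a \<bullet> v)) (at (cmap d z))"
        by (rule bounded_linear_imp_has_derivative[OF bounded_linear_inner_right])
    qed (simp add: T.cmap_cinv)
    have "(f has_derivative (\<lambda>v. a \<bullet> frechet_derivative (cmap d \<circ> cinv cc) (at (cmap cc z)) v)) (at (cmap cc z))"
      unfolding f_def by (rule T.read_in_chart_has_derivative[OF cc dB zcc d(2) rd])
    from has_derivative_unique[OF Df this]
    have "Df v = a \<bullet> frechet_derivative (cmap d \<circ> cinv cc) (at (cmap cc z)) v" for v
      by (rule fun_cong)
    moreover have "frechet_derivative (cmap d \<circ> cinv cc) (at (cmap cc z))
        (frechet_derivative (cmap cc \<circ> cinv d) (at (cmap d z)) a) = a"
      using T.frechet_derivative_transition_compose[OF dB cc dB d(2) zcc d(2), of a]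
        T.frechet_derivative_transition_same[OF dB d(2), of a] by simp
    ultimately have "a \<bullet> a = 0" using all by metis
    then show False using a(1) by simp
  qed
  then obtain p where "Df (0, p) \<noteq> 0" by blast
  then show ?thesis using that[OF V(1) _ Vc smf _ _] V(2) f0 unfolding Df_def cc_def by blast
qed

end

text \<open>Two hyperplanes do not cover the space. With the momentum gradients of \<open>f\<close>
  and \<open>H\<close> as \<open>v\<close> and \<open>w\<close>, this supplies the differential of
  \<open>\<sigma>\<close> at a point.\<close>

lemma exists_common_nonorthogonal:
  fixes v w :: "'a::real_inner"
  assumes "v \<noteq> 0" "w \<noteq> 0"
  obtains l where "l \<bullet> v \<noteq> 0" "l \<bullet> w \<noteq> 0"
proof (cases "v \<bullet> w = 0")
  case True
  then have "(v + w) \<bullet> v = v \<bullet> v" "(v + w) \<bullet> w = w \<bullet> w"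
    by (simp_all add: inner_add_left inner_commute[of w v])
  then show ?thesis using that[of "v + w"] assms by simp
next
  case False
  then show ?thesis using that[of v] assms by simp
qed

section \<open>Compact pieces of the hypersurfaces\<close>

context manifold
begin

text \<open>The local data of \<open>segments_nowhere_dense\<close> together with compactness, as
  needed for \<open>segments_closed\<close>. The nondegeneracy is required on an open
  \<open>W\<close> around \<open>Q\<close>, where the map \<open>\<Psi>\<close> is to be
  smooth.\<close>

definition good_piece :: "('m, 'e) chart \<Rightarrow> ('e \<times> 'e \<Rightarrow> real) \<Rightarrow> ('e \<times> 'e) set \<Rightarrow> bool" where
  "good_piece c h Q \<longleftrightarrow> compact Q \<and> (\<exists>W f \<sigma>. open W \<and> Q \<subseteq> W \<and> W \<subseteq> cimg c \<times> UNIV \<and>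
     smooth_on W f \<and> (\<forall>y\<in>Q. f y = (0::real)) \<and> \<sigma> \<in> smooth_functions A \<and>
     (\<forall>y\<in>W. frechet_derivative f (at y) (0, grad (\<sigma> \<circ> cinv c) (fst y)) \<noteq> 0 \<and>
        frechet_derivative (\<sigma> \<circ> cinv c) (at (fst y)) (fst (hamiltonian_vector h y)) \<noteq> 0))"

text \<open>Both pairings are arranged at the single point \<open>y\<close> by the choice of the
  differential of \<open>\<sigma>\<close>; they persist nearby by continuity.\<close>

lemma good_piece_near:
  assumes N: "submanifold (cotangent_atlas A) k N" "k < DIM('e \<times> 'e)" "transversal_to_vertical A N"
    and c: "c \<in> A" and h: "smooth_on (cimg c \<times> UNIV) h"
    and y: "y \<in> cimg c \<times> UNIV" "cinv (cotangent_chart A c) y \<in> N"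
    and hp: "frechet_derivative h (at y) (0, p) \<noteq> 0"
  shows "\<exists>V Q. open V \<and> y \<in> V \<and> good_piece c h Q \<and> (\<forall>x\<in>V. cinv (cotangent_chart A c) x \<in> N \<longrightarrow> x \<in> Q)"
proof -
  interpret T: atlas "cotangent_atlas A" by (rule atlas_cotangent)
  define z where "z = cinv (cotangent_chart A c) y"
  have yc: "y \<in> cimg (cotangent_chart A c)" using y cimg_cotangent_chart[OF c] by simp
  have z: "z \<in> N" "z \<in> cdom (cotangent_chart A c)" "cmap (cotangent_chart A c) z = y"
    unfolding z_def using y(2) T.cinv_in_cdom[OF yc] T.cmap_cinv[OF yc] by simp_all
  obtain V and f :: "'e \<times> 'e \<Rightarrow> real" and p' where V: "open V" "y \<in> V" "V \<subseteq> cimg c \<times> UNIV" "smooth_on V f"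
    and f0: "\<And>x. x \<in> V \<Longrightarrow> cinv (cotangent_chart A c) x \<in> N \<Longrightarrow> f x = 0"
    and fp: "frechet_derivative f (at y) (0, p') \<noteq> 0"
    using slice_function[OF N c z(1,2)] unfolding z(3) by blast
  have op: "open (cimg c)" "open (cimg c \<times> (UNIV :: 'e set))" using open_cimg[OF c] by (auto simp: open_Times)
  have fy: "fst y \<in> cimg c" using y by auto
  define v where "v = (\<Sum>b\<in>Basis. frechet_derivative f (at y) (0, b) *\<^sub>R b)"
  define w where "w = fst (hamiltonian_vector h y)"
  have lin: "linear (\<lambda>p. frechet_derivative f (at y) (0, p))"
    using linear_compose[OF _ linear_frechet_derivative[OF smooth_on_differentiable[OF V(4,2)]], of "\<lambda>p. (0, p)"]
    by (simp add: comp_def linear_iff)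
  have v: "l \<bullet> v = frechet_derivative f (at y) (0, l)" for l
    using linear_sum_Basis[OF lin, of l] by (simp add: v_def inner_sum_right mult.commute)
  have "v \<noteq> 0" using fp v[of p'] by auto
  moreover have "w \<noteq> 0"
    using fst_hamiltonian_vector_inner[OF smooth_on_differentiable[OF h y(1)], of p] hp unfolding w_def by auto
  ultimately obtain l where l: "l \<bullet> v \<noteq> 0" "l \<bullet> w \<noteq> 0" by (rule exists_common_nonorthogonal)
  obtain \<sigma> where \<sigma>: "\<sigma> \<in> smooth_functions A" "(\<sigma> \<circ> cinv c has_derivative (\<lambda>v. l \<bullet> v)) (at (fst y))"
    using function_with_gradient[OF c fy] by blast
  have Ds: "frechet_derivative (\<sigma> \<circ> cinv c) (at (fst y)) = (\<lambda>v. l \<bullet> v)"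
    using frechet_derivative_at[OF \<sigma>(2)] by simp
  have gs: "grad (\<sigma> \<circ> cinv c) (fst y) = l"
    unfolding grad_def Ds by (rule euclidean_representation)
  define m where "m x = frechet_derivative f (at x) (0, grad (\<sigma> \<circ> cinv c) (fst x))" for x
  define \<kappa> where "\<kappa> x = grad (\<sigma> \<circ> cinv c) (fst x) \<bullet> fst (hamiltonian_vector h x)" for x
  have \<kappa>_eq: "\<kappa> x = frechet_derivative (\<sigma> \<circ> cinv c) (at (fst x)) (fst (hamiltonian_vector h x))" if "x \<in> cimg c \<times> UNIV" for x
    unfolding \<kappa>_def by (rule inner_grad[OF smooth_on_differentiable[OF smooth_in_chart[OF \<sigma>(1) c]]]) (use that in auto)
  have sm: "smooth_on (cimg c \<times> UNIV) (\<lambda>x. (0 :: 'e, grad (\<sigma> \<circ> cinv c) (fst x)))" "smooth_on (cimg c \<times> UNIV) \<kappa>"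
    unfolding \<kappa>_def[abs_def]
    by (intro smooth_on_Pair smooth_on_const smooth_on_inner smooth_on_fst smooth_on_comp_fst op smooth_on_grad
        smooth_in_chart[OF \<sigma>(1) c] smooth_on_hamiltonian_vector h)+
  have sm_m: "smooth_on V m"
    unfolding m_def[abs_def] by (rule smooth_on_frechet_apply[OF V(1,4) smooth_on_subset[OF sm(1) V(3)]])
  \<comment> \<open>The product is nonzero exactly where both pairings are.\<close>
  define W where "W = V \<inter> (\<lambda>x. m x * \<kappa> x) -` (- {0})"
  have "smooth_on V (\<lambda>x. m x * \<kappa> x)" by (rule smooth_on_mult[OF V(1) sm_m smooth_on_subset[OF sm(2) V(3)]])
  then have W: "open W"
    unfolding W_def by (intro continuous_open_preimage smooth_on_continuous V(1)) (simp_all add: open_Compl)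
  have "m y \<noteq> 0" using l(1) v by (simp add: m_def gs)
  moreover have "\<kappa> y \<noteq> 0" using l(2) by (simp add: \<kappa>_def gs w_def)
  ultimately have "y \<in> W" using V(2) by (simp add: W_def)
  then obtain r where r: "r > 0" "cball y r \<subseteq> W" using W open_contains_cball by blast
  have WV: "W \<subseteq> V" by (auto simp: W_def)
  \<comment> \<open>Cut out by \<open>f\<close> and not by \<open>N\<close>: the zero set in the
    closed ball is compact, whereas \<open>N\<close> need not be closed there.\<close>
  define Q where "Q = cball y r \<inter> f -` {0}"
  have "continuous_on (cball y r) f"
    using continuous_on_subset[OF smooth_on_continuous[OF V(4)]] r(2) WV by blast
  then have "closed Q" unfolding Q_def by (intro continuous_closed_preimage) simp_all
  then have "compact Q" unfolding Q_def using compact_Int_closed[OF compact_cball[of y r], of Q] by (simp add: Q_def Int_absorb1 Int_assoc[symmetric])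
  moreover have "frechet_derivative f (at x) (0, grad (\<sigma> \<circ> cinv c) (fst x)) \<noteq> 0 \<and>
      frechet_derivative (\<sigma> \<circ> cinv c) (at (fst x)) (fst (hamiltonian_vector h x)) \<noteq> 0" if "x \<in> W" for x
  proof -
    have "x \<in> cimg c \<times> UNIV" using that WV V(3) by blast
    moreover have "m x \<noteq> 0" "\<kappa> x \<noteq> 0" using that by (auto simp: W_def)
    ultimately show ?thesis using \<kappa>_eq unfolding m_def by simp
  qed
  moreover have "Q \<subseteq> W" "\<forall>y\<in>Q. f y = 0" using r(2) by (auto simp: Q_def)
  moreover have "W \<subseteq> cimg c \<times> UNIV" using WV V(3) by blast
  ultimately have "good_piece c h Q"
    unfolding good_piece_def using W smooth_on_subset[OF V(4) WV] \<sigma>(1) by blast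
  moreover have "x \<in> Q" if "x \<in> ball y r" "cinv (cotangent_chart A c) x \<in> N" for x
  proof -
    have xb: "x \<in> cball y r" using that(1) by simp
    then have "f x = 0" using f0[OF _ that(2)] r(2) WV by blast
    with xb show ?thesis by (simp add: Q_def)
  qed
  ultimately show ?thesis using r(1) by (intro exI[of _ "ball y r"] exI[of _ Q]) simp
qed

text \<open>The neighbourhoods of \<open>good_piece_near\<close> cover the relevant part of
  \<open>N\<close>, and by Lindelof's theorem in coordinate space countably many suffice.\<close>

lemma countable_good_pieces:
  assumes N: "\<exists>k < DIM('e \<times> 'e). submanifold (cotangent_atlas A) k N" "transversal_to_vertical A N"
    and c: "c \<in> A" and h: "smooth_on (cimg c \<times> UNIV) h"
  shows "\<exists>\<Q>. countable \<Q> \<and> (\<forall>Q\<in>\<Q>. good_piece c h Q) \<and>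
    (\<forall>y\<in>cimg c \<times> UNIV. \<forall>p. cinv (cotangent_chart A c) y \<in> N \<longrightarrow> frechet_derivative h (at y) (0, p) \<noteq> 0 \<longrightarrow> y \<in> \<Union>\<Q>)"
proof -
  obtain k where k: "k < DIM('e \<times> 'e)" "submanifold (cotangent_atlas A) k N" using N(1) by blast
  define \<V> where "\<V> = {V. open V \<and> (\<exists>Q. good_piece c h Q \<and> (\<forall>x\<in>V. cinv (cotangent_chart A c) x \<in> N \<longrightarrow> x \<in> Q))}"
  obtain \<V>' where \<V>': "\<V>' \<subseteq> \<V>" "countable \<V>'" "\<Union>\<V>' = \<Union>\<V>"
    by (rule Lindelof[of \<V>]) (auto simp: \<V>_def)
  have "\<forall>V\<in>\<V>'. \<exists>Q. good_piece c h Q \<and> (\<forall>x\<in>V. cinv (cotangent_chart A c) x \<in> N \<longrightarrow> x \<in> Q)"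
    using \<V>'(1) unfolding \<V>_def by blast
  from bchoice[OF this] obtain q where q: "\<forall>V\<in>\<V>'. good_piece c h (q V) \<and> (\<forall>x\<in>V. cinv (cotangent_chart A c) x \<in> N \<longrightarrow> x \<in> q V)"
    by (elim exE)
  show ?thesis
  proof (intro exI[of _ "q ` \<V>'"] conjI ballI allI impI)
    show "countable (q ` \<V>')" using \<V>'(2) by simp
    show "good_piece c h Q" if "Q \<in> q ` \<V>'" for Q using that q by blast
    fix y p assume y: "y \<in> cimg c \<times> UNIV" "cinv (cotangent_chart A c) y \<in> N" "frechet_derivative h (at y) (0, p) \<noteq> 0"
    from good_piece_near[OF k(2,1) N(2) c h y] have "y \<in> \<Union>\<V>" unfolding \<V>_def by blast
    then obtain V where "V \<in> \<V>'" "y \<in> V" using \<V>'(3) by blast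
    then show "y \<in> \<Union>(q ` \<V>')" using q y(2) by blast
  qed
qed

end

section \<open>The theorem\<close>

text \<open>If no member contained a subinterval, all complements in the interval would be open and
  dense; by Baire's theorem their intersection would be dense, but it is empty because the members
  cover.\<close>

lemma interval_countable_closed_cover:
  fixes a b :: real
  assumes ab: "a < b" and C: "countable \<C>" "\<And>C. C \<in> \<C> \<Longrightarrow> closed C" and cover: "{a..b} \<subseteq> \<Union>\<C>"
  obtains C c d where "C \<in> \<C>" "c < d" "{c..d} \<subseteq> {a..b}" "{c..d} \<subseteq> C"
proof -
  define \<G> where "\<G> = (\<lambda>C. {a..b} - C) ` \<C>"
  have "\<exists>C\<in>\<C>. \<not> {a..b} \<subseteq> closure ({a..b} - C)"
  proof (rule ccontr)
    assume neg: "\<not> ?thesis"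
    have "{a..b} \<subseteq> closure (\<Inter>\<G>)"
    proof (rule Baire)
      show "closed {a..b}" by simp
      show "countable \<G>" using C(1) by (simp add: \<G>_def)
      fix T assume "T \<in> \<G>"
      then obtain D where D: "D \<in> \<C>" "T = {a..b} - D" by (auto simp: \<G>_def)
      have "openin (top_of_set {a..b}) ({a..b} \<inter> (- D))"
        using C(2)[OF D(1)] by (intro openin_open_Int) (simp add: open_Compl)
      then show "openin (top_of_set {a..b}) T \<and> {a..b} \<subseteq> closure T"
        using neg D by (auto simp: Diff_eq)
    qed
    moreover have "a \<in> {a..b}" using ab by simp
    then have "\<Inter>\<G> = {}" using cover by (auto simp: \<G>_def)
    ultimately show False using ab by simp
  qed
  then obtain C x where C': "C \<in> \<C>" and x: "x \<in> {a..b}" "x \<notin> closure ({a..b} - C)" by blast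
  from x(2) obtain e where e: "e > 0" "\<And>y. y \<in> {a..b} - C \<Longrightarrow> \<not> dist y x < e"
    unfolding closure_approachable by blast
  define c where "c = max a (x - e / 2)"
  define d where "d = min b (x + e / 2)"
  show ?thesis
  proof
    show "C \<in> \<C>" by (rule C')
    show "c < d" using ab x(1) e(1) by (auto simp: c_def d_def)
    show sub: "{c..d} \<subseteq> {a..b}" by (auto simp: c_def d_def)
    show "{c..d} \<subseteq> C"
    proof
      fix y assume y: "y \<in> {c..d}"
      then have "dist y x < e" using e(1) by (auto simp: c_def d_def dist_real_def)
      then show "y \<in> C" using e(2)[of y] sub y by blast
    qed
  qed
qed

section \<open>Orbits leave the pieces, and the bad potentials are meagre\<close>

context manifold
begin

lemma good_piece_subset: "good_piece c h Q \<Longrightarrow> Q \<subseteq> cimg c \<times> UNIV"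
  unfolding good_piece_def by blast

text \<open>Otherwise the times at which the orbit lies in the various pieces form a countable
  closed cover of a small interval. Some piece then contains the orbit for an interval of times, and
  shifting time yields a forbidden segment.\<close>

lemma orbit_leaves_pieces:
  assumes H: "smooth_map (cotangent_atlas A) (std_atlas UNIV) H" and c: "c \<in> A"
    and u: "u \<in> smooth_functions A"
    and orb: "hamiltonian_orbit A (\<lambda>z. H z + u (fst z)) I \<theta>"
    and t0: "t\<^sub>0 \<in> I" "\<theta> t\<^sub>0 \<in> cdom (cotangent_chart A c)"
    and p: "frechet_derivative (H \<circ> cinv (cotangent_chart A c)) (at (cmap (cotangent_chart A c) (\<theta> t\<^sub>0))) (0, p) \<noteq> 0"
    and \<Q>: "countable \<Q>" "\<And>Q. Q \<in> \<Q> \<Longrightarrow> closed Q"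
    and u_avoids: "\<And>Q n. Q \<in> \<Q> \<Longrightarrow> u \<notin> segments c (H \<circ> cinv (cotangent_chart A c)) Q (1 / real (Suc n))"
    and \<epsilon>: "\<epsilon> > 0"
  shows "\<exists>t\<in>I. \<bar>t - t\<^sub>0\<bar> < \<epsilon> \<and> \<theta> t \<in> cdom (cotangent_chart A c) \<and>
    frechet_derivative (H \<circ> cinv (cotangent_chart A c)) (at (cmap (cotangent_chart A c) (\<theta> t))) (0, p) \<noteq> 0 \<and>
    cmap (cotangent_chart A c) (\<theta> t) \<notin> \<Union>\<Q>"
proof (rule ccontr)
  define h where "h = H \<circ> cinv (cotangent_chart A c)"
  define y where "y = cmap (cotangent_chart A c) \<circ> \<theta>"
  define V where "V = {t \<in> I. \<theta> t \<in> cdom (cotangent_chart A c)}"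
  define X where "X x = hamiltonian_vector h x - (0, grad (u \<circ> cinv c) (fst x))" for x
  assume "\<not> ?thesis"
  then have inQ: "y t \<in> \<Union>\<Q>" if "t \<in> V" "\<bar>t - t\<^sub>0\<bar> < \<epsilon>" "frechet_derivative h (at (y t)) (0, p) \<noteq> 0" for t
    using that unfolding V_def y_def h_def by auto
  have y': "(y has_vector_derivative X (y t)) (at t)" if "t \<in> V" for t
    using orbit_in_chart[OF H c u orb] that unfolding V_def y_def X_def h_def by simp
  have V: "open V"
    using orb c unfolding hamiltonian_orbit_def V_def cotangent_atlas_def by blast
  have cont: "continuous_on V y"
    using y' has_vector_derivative_continuous continuous_at_imp_continuous_on by blast
  have yc: "y t \<in> cimg c \<times> UNIV" if "t \<in> V" for t
    using that cimg_cotangent_chart[OF c] unfolding V_def y_def by (auto simp: cimg_def[of "cotangent_chart A c"])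
  have "continuous_on (cimg c \<times> UNIV) (\<lambda>x. frechet_derivative h (at x) (0, p))"
    unfolding h_def by (rule smooth_on_continuous[OF smooth_on_frechet[OF hamiltonian_in_chart[OF H c]]])
  then have contp: "continuous_on V (\<lambda>t. frechet_derivative h (at (y t)) (0, p))"
    using continuous_on_compose2[OF _ cont] yc by blast
  \<comment> \<open>The momentum derivative in the direction \<open>p\<close> stays nonzero near
    \<open>t\<^sub>0\<close>, so the assumption places the orbit in some piece at all these
    times.\<close>
  define U where "U = (V \<inter> (\<lambda>t. frechet_derivative h (at (y t)) (0, p)) -` (- {0})) \<inter> ball t\<^sub>0 \<epsilon>"
  have "open U"
    unfolding U_def by (intro open_Int continuous_open_preimage[OF contp V] open_ball) (simp add: open_Compl)
  moreover have "t\<^sub>0 \<in> U" using t0 p \<epsilon> by (simp add: U_def V_def h_def y_def)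
  ultimately obtain \<rho> where \<rho>: "\<rho> > 0" "cball t\<^sub>0 \<rho> \<subseteq> U" using open_contains_cball by blast
  define a where "a = t\<^sub>0 - \<rho>"
  define b where "b = t\<^sub>0 + \<rho>"
  have ab: "a < b" using \<rho>(1) by (simp add: a_def b_def)
  have abU: "{a..b} \<subseteq> U" using \<rho>(2) by (simp add: a_def b_def cball_eq_atLeastAtMost)
  have UV: "U \<subseteq> V" by (auto simp: U_def)
  have cont_ab: "continuous_on {a..b} y" using continuous_on_subset[OF cont] abU UV by blast
  define \<C> where "\<C> = (\<lambda>Q. {a..b} \<inter> y -` Q) ` \<Q>"
  obtain C s s' where C: "C \<in> \<C>" "s < s'" "{s..s'} \<subseteq> {a..b}" "{s..s'} \<subseteq> C"
  proof (rule interval_countable_closed_cover[OF ab])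
    show "countable \<C>" using \<Q>(1) by (simp add: \<C>_def)
    show "closed C" if "C \<in> \<C>" for C
      using that \<Q>(2) unfolding \<C>_def by (auto intro!: continuous_closed_preimage[OF cont_ab])
    show "{a..b} \<subseteq> \<Union>\<C>"
    proof
      fix t assume t: "t \<in> {a..b}"
      then have "t \<in> U" using abU by blast
      then have "y t \<in> \<Union>\<Q>" using inQ[of t] by (auto simp: U_def dist_real_def abs_minus_commute)
      then show "t \<in> \<Union>\<C>" using t by (auto simp: \<C>_def)
    qed
  qed
  then obtain Q where Q: "Q \<in> \<Q>" "\<And>t. t \<in> {s..s'} \<Longrightarrow> y t \<in> Q" unfolding \<C>_def by blast
  \<comment> \<open>The durations \<open>1 / Suc n\<close> are countably many and arbitrarily short,
    and a segment may be cut down to any of them below its length.\<close>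
  obtain n where n: "1 / real (Suc n) < s' - s"
    using nat_approx_posE[of "s' - s"] C(2) by auto
  have seg: "y (s + t) \<in> Q \<and> ((\<lambda>t. y (s + t)) has_vector_derivative X (y (s + t))) (at t within {0..1 / real (Suc n)})"
    if t: "t \<in> {0..1 / real (Suc n)}" for t
  proof
    have st: "s + t \<in> {s..s'}" using t n by auto
    show "y (s + t) \<in> Q" by (rule Q(2)[OF st])
    have "s + t \<in> V" using st C(3) abU UV by blast
    from y'[OF this] have D: "(y has_vector_derivative X (y (s + t))) (at (s + t))" .
    have "((\<lambda>t. s + t) has_vector_derivative 1) (at t)" by (auto intro!: derivative_eq_intros)
    from vector_diff_chain_at[OF this D]
    have "((\<lambda>t. y (s + t)) has_vector_derivative X (y (s + t))) (at t)" by (simp add: comp_def)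
    then show "((\<lambda>t. y (s + t)) has_vector_derivative X (y (s + t))) (at t within {0..1 / real (Suc n)})"
      by (rule has_vector_derivative_at_within)
  qed
  have "u \<in> segments c h Q (1 / real (Suc n))"
    unfolding segments_def X_def mem_Collect_eq
    by (intro conjI[OF u] exI[of _ "\<lambda>t. y (s + t)"]) (rule ballI, rule seg[unfolded X_def])
  then show False using u_avoids[OF Q(1)] unfolding h_def by blast
qed

lemma good_piece_nowhere_dense:
  assumes "good_piece c h Q" "c \<in> A" "smooth_on (cimg c \<times> UNIV) h" "\<tau> > 0"
    and "u \<in> smooth_functions A" "finite F" "F \<subseteq> indices" "e > 0"
  shows "\<exists>v\<in>nb F e u. v \<notin> segments c h Q \<tau>"
proof -
  from assms(1) obtain W f \<sigma> where W: "open W" "Q \<subseteq> W" "W \<subseteq> cimg c \<times> UNIV"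
     "smooth_on W f" and f: "\<forall>y\<in>Q. f y = (0::real)" and \<sigma>: "\<sigma> \<in> smooth_functions A"
     and nz: "\<forall>y\<in>W. frechet_derivative f (at y) (0, grad (\<sigma> \<circ> cinv c) (fst y)) \<noteq> 0 \<and>
        frechet_derivative (\<sigma> \<circ> cinv c) (at (fst y)) (fst (hamiltonian_vector h y)) \<noteq> 0"
    unfolding good_piece_def by (elim exE conjE)
  from f have f': "f y = 0" if "y \<in> Q" for y using that by (rule bspec)
  note nz' = bspec[OF nz]
  show ?thesis
    by (rule segments_nowhere_dense[OF assms(2,3) W f' \<sigma> conjunct1[OF nz'] conjunct2[OF nz'] assms(4-8)])
qed

text \<open>Countably many charts, pieces and durations give countably many closed sets. Their
  closedness is tested by the seminorms in the countable set \<open>J\<close>, so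
  \<open>potentials_baire\<close> applies even if the atlas is uncountable.\<close>

lemma meagre_bad_potentials:
  assumes A0: "A\<^sub>0 \<subseteq> A" "countable A\<^sub>0" "carrier_of A \<subseteq> carrier_of A\<^sub>0"
    and h: "\<And>c. c \<in> A\<^sub>0 \<Longrightarrow> smooth_on (cimg c \<times> UNIV) (h c)"
    and \<P>: "\<And>c. c \<in> A\<^sub>0 \<Longrightarrow> countable (\<P> c)" "\<And>c Q. c \<in> A\<^sub>0 \<Longrightarrow> Q \<in> \<P> c \<Longrightarrow> good_piece c (h c) Q"
  defines "\<F> \<equiv> \<Union>c\<in>A\<^sub>0. \<Union>Q\<in>\<P> c. \<Union>n. segments c (h c) Q (1 / real (Suc n))"
  shows "fsigma_in potentials \<F>" and "potentials interior_of \<F> = {}"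
proof -
  define \<X> where "\<X> = (\<lambda>(c, Q, n). segments c (h c) Q (1 / real (Suc n))) ` (SIGMA c:A\<^sub>0. \<P> c \<times> UNIV)"
  have member: "\<exists>c Q n. X = segments c (h c) Q (1 / real (Suc n)) \<and> c \<in> A\<^sub>0 \<and> Q \<in> \<P> c" if "X \<in> \<X>" for X
  proof -
    from that obtain j where j: "j \<in> (SIGMA c:A\<^sub>0. \<P> c \<times> UNIV)" "X = (\<lambda>(c, Q, n). segments c (h c) Q (1 / real (Suc n))) j"
      unfolding \<X>_def by (rule imageE)
    obtain c Q n where "j = (c, Q, n)" by (rule prod_cases3)
    with j have "X = segments c (h c) Q (1 / real (Suc n))" "c \<in> A\<^sub>0" "Q \<in> \<P> c" by simp_all
    then show ?thesis by blast
  qed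
  have F: "\<F> = \<Union>\<X>" unfolding \<F>_def \<X>_def by force
  have \<X>: "countable \<X>"
    unfolding \<X>_def using A0(2) \<P>(1) by (intro countable_image countable_SIGMA) auto
  define J where "J = (\<Union>c\<in>A\<^sub>0. \<Union>Q\<in>\<P> c. first_indices c Q)"
  have J1: "countable J" unfolding J_def
    by (intro countable_UN A0(2) \<P>(1) countable_finite first_indices_finite)
  have piece: "compact Q" "Q \<subseteq> cimg c \<times> UNIV" if "c \<in> A\<^sub>0" "Q \<in> \<P> c" for c Q
    using \<P>(2)[OF that] good_piece_subset unfolding good_piece_def by blast+
  have J2: "J \<subseteq> indices"
    unfolding J_def by (intro UN_least first_indices_subset piece subsetD[OF A0(1)])
  have closed: "\<exists>F e. finite F \<and> F \<subseteq> J \<and> e > 0 \<and> nb F e u \<inter> X = {}"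
    if "X \<in> \<X>" and u: "u \<in> smooth_functions A - X" for X u
  proof -
    obtain c Q n where X: "X = segments c (h c) Q (1 / real (Suc n))" and cQ: "c \<in> A\<^sub>0" "Q \<in> \<P> c"
      using member[OF \<open>X \<in> \<X>\<close>] by blast
    have cA: "c \<in> A" using cQ(1) A0(1) by blast
    have \<tau>: "1 / real (Suc n) > 0" by simp
    obtain e where "e > 0" "nb (first_indices c Q) e u \<inter> X = {}"
      using segments_closed[OF cA piece[OF cQ] h[OF cQ(1)] \<tau>] u unfolding X by blast
    moreover have "first_indices c Q \<subseteq> J" using cQ unfolding J_def by blast
    ultimately show ?thesis
      by (intro exI[of _ "first_indices c Q"] exI[of _ e] conjI first_indices_finite)
  qed
  have nowhere: "\<exists>v\<in>nb F e u. v \<notin> X"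
    if "X \<in> \<X>" "u \<in> smooth_functions A" "finite F" "F \<subseteq> indices" "e > 0" for X u F e
  proof -
    obtain c Q n where X: "X = segments c (h c) Q (1 / real (Suc n))" and cQ: "c \<in> A\<^sub>0" "Q \<in> \<P> c"
      using member[OF \<open>X \<in> \<X>\<close>] by blast
    have cA: "c \<in> A" using cQ(1) A0(1) by blast
    show ?thesis
      unfolding X using good_piece_nowhere_dense[OF \<P>(2)[OF cQ] cA h[OF cQ(1)] _ that(2-5)] by simp
  qed
  have sub: "X \<subseteq> smooth_functions A" if "X \<in> \<X>" for X
    using member[OF that] unfolding segments_def by blast
  have "closedin potentials X" if "X \<in> \<X>" for X
  proof (rule closedin_potentialsI[OF sub[OF that]])
    fix u assume "u \<in> smooth_functions A - X"
    from closed[OF that this] J2 show "\<exists>F e. finite F \<and> F \<subseteq> indices \<and> e > 0 \<and> nb F e u \<inter> X = {}" by blast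
  qed
  then show "fsigma_in potentials \<F>"
    unfolding fsigma_in_def union_of_def F using \<X> by blast
  show "potentials interior_of \<F> = {}"
  proof (rule ccontr)
    assume "potentials interior_of \<F> \<noteq> {}"
    then obtain U u where U: "openin potentials U" "u \<in> U" "U \<subseteq> \<F>" unfolding interior_of_def by blast
    have u: "u \<in> smooth_functions A" using openin_subset[OF U(1)] U(2) topspace_potentials by blast
    obtain F e where Fe: "finite F" "F \<subseteq> indices" "e > 0" "nb F e u \<subseteq> U"
      using openin_contains_nb[OF U(1,2)] by blast
    from potentials_baire[OF A0 J1 J2 \<X> closed nowhere u Fe(1-3)]
    obtain v where "v \<in> nb F e u" "v \<notin> \<Union>\<X>" by blast
    then show False using Fe(4) U(3) F by blast
  qed
qed

end

theorem theorem3: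
  fixes M :: "'m topology"
    and A :: "('m, 'e::euclidean_space) chart set"
    and H :: "'m \<times> ('m, 'e) covector \<Rightarrow> real"
    and \<Sigma> :: "('m \<times> ('m, 'e) covector) set"
    and \<N> :: "('m \<times> ('m, 'e) covector) set set"
  assumes "smooth_manifold M A"
    and "smooth_map (cotangent_atlas A) (std_atlas UNIV) H"
    and "countable \<N>"
    and "\<And>N. N \<in> \<N> \<Longrightarrow>
           (\<exists>k < DIM('e \<times> 'e). submanifold (cotangent_atlas A) k N) \<and>
           transversal_to_vertical A N"
    and "\<Sigma> \<subseteq> \<Union>\<N>"
  shows "\<exists>\<F>. fsigma_in (smooth_functions_topology A) \<F> \<and>
           smooth_functions_topology A interior_of \<F> = {} \<and>
           (\<forall>u \<in> smooth_functions A - \<F>.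
              \<forall>I \<theta> t\<^sub>0. hamiltonian_orbit A (\<lambda>z. H z + u (fst z)) I \<theta> \<and> t\<^sub>0 \<in> I \<and>
                (\<exists>\<eta>\<in>cotangent_space A (fst (\<theta> t\<^sub>0)). fiber_derivative H (\<theta> t\<^sub>0) \<eta> \<noteq> 0) \<longrightarrow>
                (\<forall>\<epsilon>>0. \<exists>t\<in>I. \<bar>t - t\<^sub>0\<bar> < \<epsilon> \<and> \<theta> t \<notin> \<Sigma>))"
proof -
  interpret manifold M A by standard (rule assms(1))
  interpret T: atlas "cotangent_atlas A" by (rule atlas_cotangent)
  obtain A\<^sub>0 where A0: "A\<^sub>0 \<subseteq> A" "countable A\<^sub>0" "carrier_of A\<^sub>0 = carrier_of A"
    by (rule countable_subatlas)
  define h where "h c = H \<circ> cinv (cotangent_chart A c)" for c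
  have h: "smooth_on (cimg c \<times> UNIV) (h c)" if "c \<in> A\<^sub>0" for c
    unfolding h_def by (rule hamiltonian_in_chart[OF assms(2)]) (use that A0(1) in blast)
  \<comment> \<open>Choosing the pieces separately for each chart of the countable subatlas and each
    submanifold keeps their total number countable.\<close>
  define pieces where "pieces c N \<Q> \<longleftrightarrow> countable \<Q> \<and> (\<forall>Q\<in>\<Q>. good_piece c (h c) Q) \<and>
    (\<forall>y\<in>cimg c \<times> UNIV. \<forall>p. cinv (cotangent_chart A c) y \<in> N \<longrightarrow> frechet_derivative (h c) (at y) (0, p) \<noteq> 0 \<longrightarrow> y \<in> \<Union>\<Q>)"
    for c N \<Q>
  define \<Q> where "\<Q> c N = (SOME \<Q>. pieces c N \<Q>)" for c N
  have \<Q>: "pieces c N (\<Q> c N)" if "c \<in> A\<^sub>0" "N \<in> \<N>" for c N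
  proof -
    have "c \<in> A" using that A0(1) by blast
    from countable_good_pieces[OF _ _ this h[OF that(1)]] assms(4)[OF that(2)]
    have "\<exists>\<Q>. pieces c N \<Q>" unfolding pieces_def by blast
    then show ?thesis unfolding \<Q>_def by (rule someI_ex)
  qed
  define \<P> where "\<P> c = (\<Union>N\<in>\<N>. \<Q> c N)" for c
  have \<P>1: "countable (\<P> c)" if "c \<in> A\<^sub>0" for c
    unfolding \<P>_def using \<Q>[OF that] assms(3) by (intro countable_UN) (auto simp: pieces_def)
  have \<P>2: "good_piece c (h c) Q" if "c \<in> A\<^sub>0" "Q \<in> \<P> c" for c Q
    using \<Q>[OF that(1)] that(2) unfolding \<P>_def pieces_def by blast
  define \<F> where "\<F> = (\<Union>c\<in>A\<^sub>0. \<Union>Q\<in>\<P> c. \<Union>n. segments c (h c) Q (1 / real (Suc n)))"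
  show ?thesis
  proof (intro exI[of _ \<F>] conjI ballI allI impI; (elim conjE bexE)?)
    show "fsigma_in (smooth_functions_topology A) \<F>" "smooth_functions_topology A interior_of \<F> = {}"
      unfolding \<F>_def by (intro meagre_bad_potentials A0 h \<P>1 \<P>2; simp add: A0)+
    fix u I \<theta> t\<^sub>0 \<eta> and \<epsilon> :: real
    assume u: "u \<in> smooth_functions A - \<F>" and orb: "hamiltonian_orbit A (\<lambda>z. H z + u (fst z)) I \<theta>"
      and t0: "t\<^sub>0 \<in> I" and \<eta>: "\<eta> \<in> cotangent_space A (fst (\<theta> t\<^sub>0))" "fiber_derivative H (\<theta> t\<^sub>0) \<eta> \<noteq> 0" and \<epsilon>: "0 < \<epsilon>"
    have z: "\<theta> t\<^sub>0 \<in> cotangent_bundle A" using orb t0 unfolding hamiltonian_orbit_def by blast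
    then have "fst (\<theta> t\<^sub>0) \<in> carrier_of A\<^sub>0" unfolding A0(3) cotangent_bundle_def by auto
    then obtain c where c0: "c \<in> A\<^sub>0" and zc: "fst (\<theta> t\<^sub>0) \<in> cdom c" unfolding carrier_of_def by blast
    have c: "c \<in> A" using c0 A0(1) by blast
    have zcc: "\<theta> t\<^sub>0 \<in> cdom (cotangent_chart A c)" using z zc by (simp add: cotangent_chart_simps)
    obtain p where p: "frechet_derivative (h c) (at (cmap (cotangent_chart A c) (\<theta> t\<^sub>0))) (0, p) \<noteq> 0"
      using fiber_derivative_in_chart[OF assms(2) c zcc \<eta>(1)] \<eta>(2) unfolding h_def by metis
    have clQ: "closed Q" if "Q \<in> \<P> c" for Q
      using \<P>2[OF c0 that] compact_imp_closed unfolding good_piece_def by blast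
    have uS: "u \<in> smooth_functions A" using u by blast
    have avoid: "u \<notin> segments c (H \<circ> cinv (cotangent_chart A c)) Q (1 / real (Suc n))" if "Q \<in> \<P> c" for Q n
      using u that c0 unfolding \<F>_def h_def by blast
    \<comment> \<open>The direction \<open>p\<close> is the same at \<open>t\<close> as at
      \<open>t\<^sub>0\<close>: since the momentum derivative along it is still nonzero, the pieces
      contain every point of a submanifold there, and a point outside all pieces is outside all
      submanifolds.\<close>
    obtain t where t: "t \<in> I" "\<bar>t - t\<^sub>0\<bar> < \<epsilon>" "\<theta> t \<in> cdom (cotangent_chart A c)"
      "frechet_derivative (h c) (at (cmap (cotangent_chart A c) (\<theta> t))) (0, p) \<noteq> 0"
      "cmap (cotangent_chart A c) (\<theta> t) \<notin> \<Union>(\<P> c)"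
      using orbit_leaves_pieces[OF assms(2) c uS orb t0 zcc p[unfolded h_def] \<P>1[OF c0] clQ avoid \<epsilon>] unfolding h_def by blast
    have cc: "cotangent_chart A c \<in> cotangent_atlas A" using c by (simp add: cotangent_atlas_def)
    have "\<theta> t \<notin> N" if N: "N \<in> \<N>" for N
    proof
      assume "\<theta> t \<in> N"
      then have 1: "cinv (cotangent_chart A c) (cmap (cotangent_chart A c) (\<theta> t)) \<in> N"
        using T.cinv_cmap[OF cc t(3)] by simp
      have 2: "cmap (cotangent_chart A c) (\<theta> t) \<in> cimg c \<times> UNIV"
        using T.cmap_in_cimg[OF t(3)] cimg_cotangent_chart[OF c] by simp
      have 3: "\<forall>y\<in>cimg c \<times> UNIV. \<forall>p. cinv (cotangent_chart A c) y \<in> N \<longrightarrow>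
          frechet_derivative (h c) (at y) (0, p) \<noteq> 0 \<longrightarrow> y \<in> \<Union>(\<Q> c N)"
        using \<Q>[OF c0 N] unfolding pieces_def by (elim conjE)
      have "cmap (cotangent_chart A c) (\<theta> t) \<in> \<Union>(\<Q> c N)"
        by (rule mp[OF mp[OF spec[OF bspec[OF 3 2], of p] 1] t(4)])
      then show False using t(5) N unfolding \<P>_def by blast
    qed
    then have "\<theta> t \<notin> \<Sigma>" using assms(5) by blast
    with t show "\<exists>t\<in>I. \<bar>t - t\<^sub>0\<bar> < \<epsilon> \<and> \<theta> t \<notin> \<Sigma>" by blast
  qed
qed

end
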